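(* Let $\mathcal{A}$ be a $C^*$-algebra, $\mathcal{M},\mathcal{N}$ Hilbert $C^*$-modules over $\mathcal{A}$, $F:\mathcal{M}\to\mathcal{N}$ a bounded (resp., adjointable) $\mathcal{A}$-linear operator, and $B$ the unit ball of $\mathcal{M}$. If $F$ is Banach-compact (resp., $\mathcal{A}$-compact), then $F(B)$ is $(\mathcal{N},\mathcal{N})$-totally bounded. If, in addition, $\mathcal{N}$ admits a standard frame (for example, if $\mathcal{N}$ is countably generated), then the converse is also true: if $F(B)$ is $(\mathcal{N},\mathcal{N})$-totally bounded, then $F$ is Banach-compact (resp., $\mathcal{A}$-compact).
   Context: Hilbert $C^*$-modules are right Hilbert modules with $\langle x,ya\rangle=\langle x,y\rangle a$. $\mathcal{M}'$ is the set of bounded $\mathcal{A}$-linear maps $\mathcal{M}\to\mathcal{A}$. For $x\in\mathcal{N}$, $f\in\mathcal{M}'$ let $\theta_{x,f}(z)=x\,f(z)$. Banach-compact operators $\mathcal{M}\to\mathcal{N}$ are the elements of the operator-norm closure of the linear span of all $\theta_{x,f}$; $\mathcal{A}$-compact operators are the elements of the norm closure of the linear span of those $\theta_{x,f}$ with $f=\langle y,\cdot\rangle$, $y\in\mathcal{M}$. A countable system $X=\{x_i\}$ of elements of $\mathcal{N}$ is $\mathcal{N}$-admissible if for each $x\in\mathcal{N}$ the series $\sum_i\langle x,x_i\rangle\langle x_i,x\rangle$ converges in $\mathcal{A}$, its sum is $\le\langle x,x\rangle$, and $\|x_i\|\le1$ for all $i$. For an admissible $X$ and a countable collection $\Phi=\{\varphi_1,\varphi_2,\dots\}$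 of states on $\mathcal{A}$ (positive linear functionals of norm 1), put $$d_{X,\Phi}(x,y)^2=\sup_k\sum_{i=k}^\infty|\varphi_k(\langle x-y,x_i\rangle)|^2,\quad x,y\in\mathcal{N}.$$ A set $Y\subseteq\mathcal{N}$ is $(\mathcal{N},\mathcal{N})$-totally bounded if for every such $(X,\Phi)$ and every $\varepsilon>0$ there are finitely many $y_1,\dots,y_n\in Y$ such that the sets $\{y\in Y: d_{X,\Phi}(y_i,y)<\varepsilon\}$ cover $Y$. A family $\{x_j\}_{j\in J}$ in $\mathcal{N}$ is a standard frame if there are constants $c_1,c_2>0$ such that for every $x\in\mathcal{N}$ the series $\sum_j\langle x,x_j\rangle\langle x_j,x\rangle$ converges in norm and $c_1\langle x,x\rangle\le\sum_j\langle x,x_j\rangle\langle x_j,x\rangle\le c_2\langle x,x\rangle$. $\mathcal{N}$ is countably generated if the $\mathcal{A}$-linear combinations of some countable collection of its elements are dense. *)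

theory Defs
  imports "HOL-Analysis.Analysis"
begin

class complex_vector = real_vector +
  fixes scaleC :: "complex \<Rightarrow> 'a \<Rightarrow> 'a" (infixr "*\<^sub>C" 75)
  assumes scaleC_add_right: "c *\<^sub>C (x + y) = c *\<^sub>C x + c *\<^sub>C y"
    and scaleC_add_left: "(c + d) *\<^sub>C x = c *\<^sub>C x + d *\<^sub>C x"
    and scaleC_scaleC: "c *\<^sub>C (d *\<^sub>C x) = (c * d) *\<^sub>C x"
    and scaleC_of_real: "complex_of_real r *\<^sub>C x = r *\<^sub>R x"

text \<open>C*-algebras, not assumed unital.\<close>

class cstar_algebra = complex_vector + real_normed_algebra + banach +
  fixes star :: "'a \<Rightarrow> 'a"
  assumes mult_scaleC_left: "(c *\<^sub>C a) * b = c *\<^sub>C (a * b)"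
    and mult_scaleC_right: "a * (c *\<^sub>C b) = c *\<^sub>C (a * b)"
    and norm_scaleC: "norm (c *\<^sub>C a) = cmod c * norm a"
    and star_add: "star (a + b) = star a + star b"
    and star_scaleC: "star (c *\<^sub>C a) = cnj c *\<^sub>C star a"
    and star_mult: "star (a * b) = star b * star a"
    and star_star: "star (star a) = a"
    and norm_star_mult: "norm (star a * a) = (norm a)\<^sup>2"

definition positive :: "'a::cstar_algebra \<Rightarrow> bool" where
  "positive a \<longleftrightarrow> (\<exists>b. a = star b * b)"

definition cstar_le :: "'a::cstar_algebra \<Rightarrow> 'a \<Rightarrow> bool" where
  "cstar_le a b \<longleftrightarrow> positive (b - a)"

definition state :: "('a::cstar_algebra \<Rightarrow> complex) \<Rightarrow> bool" where
  "state \<phi> \<longleftrightarrow> bounded_linear \<phi> \<and> (\<forall>c a. \<phi> (c *\<^sub>C a) = c * \<phi> a) \<and>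
     (\<forall>a. positive a \<longrightarrow> \<phi> a \<in> \<real>\<^sub>\<ge>\<^sub>0) \<and> onorm \<phi> = 1"

text \<open>Right Hilbert modules. The norm of the carrier type is required to be the one given by the
  inner product; its completeness is the class constraint \<^class>\<open>banach\<close>.\<close>

locale hilbert_module =
  fixes act :: "'m::{complex_vector, banach} \<Rightarrow> 'a::cstar_algebra \<Rightarrow> 'm"
    and ip :: "'m \<Rightarrow> 'm \<Rightarrow> 'a"
  assumes act_add_left: "act (x + y) a = act x a + act y a"
    and act_add_right: "act x (a + b) = act x a + act x b"
    and act_mult: "act x (a * b) = act (act x a) b"
    and act_scaleC_left: "act (c *\<^sub>C x) a = c *\<^sub>C act x a"
    and act_scaleC_right: "act x (c *\<^sub>C a) = c *\<^sub>C act x a"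
    and ip_add_right: "ip x (y + z) = ip x y + ip x z"
    and ip_scaleC_right: "ip x (c *\<^sub>C y) = c *\<^sub>C ip x y"
    and ip_act_right: "ip x (act y a) = ip x y * a"
    and ip_star: "ip y x = star (ip x y)"
    and ip_positive: "positive (ip x x)"
    and ip_definite: "ip x x = 0 \<Longrightarrow> x = 0"
    and norm_eq_ip: "norm x = sqrt (norm (ip x x))"

definition bounded_module_map ::
  "('m::{complex_vector, real_normed_vector} \<Rightarrow> 'a \<Rightarrow> 'm) \<Rightarrow>
   ('n::{complex_vector, real_normed_vector} \<Rightarrow> 'a \<Rightarrow> 'n) \<Rightarrow> ('m \<Rightarrow> 'n) \<Rightarrow> bool" where
  "bounded_module_map actM actN F \<longleftrightarrow> bounded_linear F \<and>
     (\<forall>c x. F (c *\<^sub>C x) = c *\<^sub>C F x) \<and> (\<forall>x a. F (actM x a) = actN (F x) a)"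

definition adjointable :: "('m \<Rightarrow> 'm \<Rightarrow> 'a) \<Rightarrow> ('n \<Rightarrow> 'n \<Rightarrow> 'a) \<Rightarrow> ('m \<Rightarrow> 'n) \<Rightarrow> bool" where
  "adjointable ipM ipN F \<longleftrightarrow> (\<exists>G. \<forall>x y. ipN (F x) y = ipM x (G y))"

definition module_dual ::
  "('m::{complex_vector, banach} \<Rightarrow> 'a::cstar_algebra \<Rightarrow> 'm) \<Rightarrow> ('m \<Rightarrow> 'a) set" where
  "module_dual actM = {f. bounded_module_map actM (*) f}"

definition theta :: "('n \<Rightarrow> 'a \<Rightarrow> 'n) \<Rightarrow> 'n \<Rightarrow> ('m \<Rightarrow> 'a) \<Rightarrow> 'm \<Rightarrow> 'n" where
  "theta actN x f z = actN x (f z)"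

text \<open>The complex linear span of the operators \<open>theta actN x f\<close> with \<open>f \<in> D\<close>.\<close>

definition theta_span ::
  "('n::{complex_vector, banach} \<Rightarrow> 'a \<Rightarrow> 'n) \<Rightarrow> ('m::{complex_vector, banach} \<Rightarrow> 'a) set \<Rightarrow>
   ('m \<Rightarrow>\<^sub>L 'n) set" where
  "theta_span actN D = {T. \<exists>(k::nat) c x f. (\<forall>i<k. f i \<in> D) \<and>
     (\<forall>z. blinfun_apply T z = (\<Sum>i<k. c i *\<^sub>C theta actN (x i) (f i) z))}"

definition banach_compact ::
  "('m::{complex_vector, banach} \<Rightarrow> 'a::cstar_algebra \<Rightarrow> 'm) \<Rightarrow>
   ('n::{complex_vector, banach} \<Rightarrow> 'a \<Rightarrow> 'n) \<Rightarrow> ('m \<Rightarrow>\<^sub>L 'n) \<Rightarrow> bool" where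
  "banach_compact actM actN F \<longleftrightarrow> F \<in> closure (theta_span actN (module_dual actM))"

definition A_compact ::
  "('m::{complex_vector, banach} \<Rightarrow> 'm \<Rightarrow> 'a::cstar_algebra) \<Rightarrow>
   ('n::{complex_vector, banach} \<Rightarrow> 'a \<Rightarrow> 'n) \<Rightarrow> ('m \<Rightarrow>\<^sub>L 'n) \<Rightarrow> bool" where
  "A_compact ipM actN F \<longleftrightarrow> F \<in> closure (theta_span actN (range ipM))"

text \<open>Countable systems are sequences indexed from \<open>0\<close>. Finite systems are covered: pad a system of
  vectors with zeros, and a collection of states by repeating its last member; neither changes
  \<open>frame_dist\<close> below.\<close>

definition admissible ::
  "('n \<Rightarrow> 'n \<Rightarrow> 'a::cstar_algebra) \<Rightarrow> (nat \<Rightarrow> 'n::real_normed_vector) \<Rightarrow> bool" where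
  "admissible ip X \<longleftrightarrow>
     (\<forall>x. summable (\<lambda>i. ip x (X i) * ip (X i) x) \<and>
          cstar_le (\<Sum>i. ip x (X i) * ip (X i) x) (ip x x)) \<and>
     (\<forall>i. norm (X i) \<le> 1)"

text \<open>For admissible \<open>X\<close> and states \<open>\<phi> k\<close>, the Cauchy-Schwarz inequality bounds the inner sums by
  the squared norm of \<open>x - y\<close>, so both the series and the supremum are finite.\<close>

definition frame_dist ::
  "('n \<Rightarrow> 'n \<Rightarrow> 'a) \<Rightarrow> (nat \<Rightarrow> 'n) \<Rightarrow> (nat \<Rightarrow> 'a \<Rightarrow> complex) \<Rightarrow> 'n::real_normed_vector \<Rightarrow> 'n \<Rightarrow> real"
  where
  "frame_dist ip X \<phi> x y = sqrt (SUP k. \<Sum>i. (cmod (\<phi> k (ip (x - y) (X (k + i)))))\<^sup>2)"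

definition NN_totally_bounded ::
  "('n \<Rightarrow> 'n \<Rightarrow> 'a::cstar_algebra) \<Rightarrow> 'n::real_normed_vector set \<Rightarrow> bool" where
  "NN_totally_bounded ip Y \<longleftrightarrow>
     (\<forall>X \<phi>. admissible ip X \<longrightarrow> (\<forall>k. state (\<phi> k)) \<longrightarrow>
        (\<forall>\<epsilon>>0. \<exists>T. finite T \<and> T \<subseteq> Y \<and> Y \<subseteq> (\<Union>t\<in>T. {y \<in> Y. frame_dist ip X \<phi> t y < \<epsilon>})))"

definition standard_frame ::
  "('n \<Rightarrow> 'n \<Rightarrow> 'a::cstar_algebra) \<Rightarrow> 'j set \<Rightarrow> ('j \<Rightarrow> 'n) \<Rightarrow> bool" where
  "standard_frame ip J f \<longleftrightarrow> (\<exists>c1>0. \<exists>c2>0. \<forall>x.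
     (\<lambda>j. ip x (f j) * ip (f j) x) summable_on J \<and>
     cstar_le (c1 *\<^sub>R ip x x) (\<Sum>\<^sub>\<infinity>j\<in>J. ip x (f j) * ip (f j) x) \<and>
     cstar_le (\<Sum>\<^sub>\<infinity>j\<in>J. ip x (f j) * ip (f j) x) (c2 *\<^sub>R ip x x))"

definition countably_generated :: "('n::real_normed_vector \<Rightarrow> 'a \<Rightarrow> 'n) \<Rightarrow> bool" where
  "countably_generated act \<longleftrightarrow> (\<exists>C. countable C \<and>
     closure {\<Sum>x\<in>T. act x (a x) | T a. finite T \<and> T \<subseteq> C} = UNIV)"

end

theory Submission
  imports Defs
begin

text \<open>The pseudometrics \<open>frame_dist\<close> detect one thing about a bounded set \<open>Y\<close> in \<open>N\<close>: whether for a
  system \<open>x\<close> the sums \<open>\<Sum> \<langle>y, x j\<rangle>\<langle>x j, y\<rangle>\<close> over indices \<open>j\<close> outside a finite set are small in norm,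
  uniformly for \<open>y \<in> Y\<close>. This property, \<open>uniform_tails\<close>, links both sides of the equivalence.

  If \<open>F\<close> is a norm limit of sums of \<open>theta\<close>s, the image of the ball is approximated by combinations
  \<open>\<Sum> x i \<cdot> a i\<close> of finitely many fixed vectors with bounded coefficients, so it inherits uniform tails
  from the convergence of the series at each \<open>x i\<close>. Uniform tails for an admissible system leave
  finitely many bounded functions \<open>\<phi> k \<langle>y, x i\<rangle>\<close> to be controlled, whence total boundedness
  (\<open>compact_imp_NN_totally_bounded\<close>).

  Conversely, suppose the tails of a frame are not uniformly small on the image of the ball. Blocks
  of the frame on which points \<open>y k\<close> have large sums are collapsed to single vectors, which after
  rescaling form an admissible system, and states norming these sums separate the \<open>y k\<close> from every finite
  set (\<open>NN_totally_bounded_imp_uniform_tails\<close>). So the tails are uniformly small, and the frame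
  operator \<open>S\<close> composed with \<open>F\<close> is a norm limit of the operators \<open>z \<mapsto> \<Sum> f j \<cdot> \<langle>f j, F z\<rangle>\<close> over finite
  sets of indices. After scaling, \<open>S = 1 - T\<close> with \<open>\<parallel>T\<parallel> < 1\<close>, and \<open>F = S F + T F\<close> then is a limit of sums
  of \<open>theta\<close>s as well (\<open>uniform_tails_imp_compact\<close>). The functionals occurring in them are
  \<open>\<langle>f j, F \<cdot>\<rangle>\<close>, which for an adjointable \<open>F\<close> equal \<open>\<langle>G (f j), \<cdot>\<rangle>\<close>, where \<open>G\<close> is the adjoint.

  A countably generated module has the frame \<open>T\<^sup>m (g n)\<close>, where \<open>T = 1 - \<Sum> \<theta>_{g n, g n}\<close> for
  suitably scaled generators \<open>g n\<close> (\<open>countably_generated_imp_standard_frame\<close>); its frame operator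
  is \<open>\<Sum> T^(2 m) (1 - T) = (1 + T)^(-1)\<close>, which lies between \<open>1/2\<close> and \<open>1\<close>.

  The facts about C*-algebras that this needs are proved without spectral theory. Square roots come
  from a fixed-point iteration, norm estimates from unitaries \<open>b + \<i>c\<close>, and the positivity of \<open>b* b\<close>
  from a norm comparison. States are obtained from the Hahn-Banach theorem on the unitization.\<close>

section \<open>Complex scalars and the involution\<close>

lemma scaleC_zero_left [simp]: "(0::complex) *\<^sub>C (x::'a::complex_vector) = 0"
  using scaleC_of_real[of 0 x] by simp

lemma scaleC_one [simp]: "(1::complex) *\<^sub>C (x::'a::complex_vector) = x"
  using scaleC_of_real[of 1 x] by simp

lemma scaleC_zero_right [simp]: "c *\<^sub>C (0::'a::complex_vector) = 0"
  using scaleC_scaleC[of c 0 "0::'a"] by simp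

lemma scaleC_minus_left [simp]: "(- c) *\<^sub>C (x::'a::complex_vector) = - (c *\<^sub>C x)"
  by (rule sym, rule minus_unique) (simp flip: scaleC_add_left)

lemma scaleC_minus_right [simp]: "c *\<^sub>C (- (x::'a::complex_vector)) = - (c *\<^sub>C x)"
  by (rule sym, rule minus_unique) (simp flip: scaleC_add_right)

lemma scaleC_diff_right: "c *\<^sub>C ((x::'a::complex_vector) - y) = c *\<^sub>C x - c *\<^sub>C y"
  using scaleC_add_right[of c x "- y"] by simp

lemma scaleC_scaleR: "c *\<^sub>C (r *\<^sub>R (x::'a::complex_vector)) = r *\<^sub>R (c *\<^sub>C x)"
  by (metis scaleC_of_real scaleC_scaleC mult.commute)

lemma scaleR_scaleC: "(r *\<^sub>R c) *\<^sub>C (x::'a::complex_vector) = r *\<^sub>R (c *\<^sub>C x)"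
  by (simp add: scaleR_conv_of_real scaleC_of_real flip: scaleC_scaleC)

lemma scaleC_sum_right: "c *\<^sub>C (\<Sum>i\<in>I. f i) = (\<Sum>i\<in>I. c *\<^sub>C (f i :: 'a::complex_vector))"
  by (induction I rule: infinite_finite_induct) (auto simp: scaleC_add_right)

lemma star_zero [simp]: "star (0::'a::cstar_algebra) = 0"
  using star_add[of 0 "0::'a"] by simp

lemma star_minus [simp]: "star (- (a::'a::cstar_algebra)) = - star a"
  using star_add[of a "- a"] by (simp add: eq_neg_iff_add_eq_0 add.commute)

lemma star_diff: "star ((a::'a::cstar_algebra) - b) = star a - star b"
  using star_add[of a "- b"] by simp

lemma star_scaleR [simp]: "star (r *\<^sub>R (a::'a::cstar_algebra)) = r *\<^sub>R star a"
  by (metis complex_cnj_complex_of_real scaleC_of_real star_scaleC)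

lemma star_sum: "star (\<Sum>i\<in>I. f i) = (\<Sum>i\<in>I. star (f i :: 'a::cstar_algebra))"
  by (induction I rule: infinite_finite_induct) (auto simp: star_add)

lemma norm_star [simp]: "norm (star (a::'a::cstar_algebra)) = norm a"
proof -
  have le: "norm b \<le> norm (star b)" for b :: 'a
  proof (cases "b = 0")
    case False
    have "norm b * norm b \<le> norm (star b) * norm b"
      using norm_star_mult[of b] norm_mult_ineq[of "star b" b] by (simp add: power2_eq_square)
    then show ?thesis using False by simp
  qed simp
  show ?thesis using le[of a] le[of "star a"] by (simp add: star_star)
qed

lemma norm_mult_star: "norm ((a::'a::cstar_algebra) * star a) = (norm a)\<^sup>2"
  using norm_star_mult[of "star a"] by (simp add: star_star)

lemma norm_square_self_adjoint: "star a = a \<Longrightarrow> norm (a * a) = (norm (a::'a::cstar_algebra))\<^sup>2"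
  using norm_star_mult[of a] by simp

lemma bounded_linear_star: "bounded_linear (star :: 'a::cstar_algebra \<Rightarrow> 'a)"
  by (rule bounded_linear_intro[where K=1]) (auto simp: star_add)

lemma star_one [simp]: "star 1 = (1::'a::{cstar_algebra, real_normed_algebra_1})"
  by (metis mult.right_neutral mult_1 star_mult star_star)

section \<open>The unitization\<close>

text \<open>Every C*-algebra, unital or not, embeds into \<open>A \<oplus> \<complex>\<close> with the norm
  \<open>max \<bar>c\<bar> \<parallel>L_a + c\<parallel>\<close>, where \<open>L_a\<close> is left multiplication on \<open>A\<close>. Taking the maximum makes this a
  C*-norm also when \<open>A\<close> already has a unit, where \<open>L_a + c\<close> may vanish for \<open>c \<noteq> 0\<close>.\<close>

datatype 'a unitization = Unitization (alg_part: 'a) (scalar_part: complex)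

definition left_mult :: "'a::cstar_algebra unitization \<Rightarrow> 'a \<Rightarrow>\<^sub>L 'a" where
  "left_mult x = Blinfun (\<lambda>b. alg_part x * b + scalar_part x *\<^sub>C b)"

lemma left_mult_apply:
  "blinfun_apply (left_mult x) b = alg_part x * b + scalar_part x *\<^sub>C (b::'a::cstar_algebra)"
proof -
  have "bounded_linear (\<lambda>b::'a. scalar_part x *\<^sub>C b)"
    by (rule bounded_linear_intro[where K="cmod (scalar_part x)"])
       (auto simp: scaleC_add_right scaleC_scaleR norm_scaleC)
  then show ?thesis unfolding left_mult_def
    by (subst bounded_linear_Blinfun_apply)
       (auto intro!: bounded_linear_add bounded_linear_mult_right)
qed

instantiation unitization :: (cstar_algebra) "{complex_vector, ring_1}"
begin

definition "0 = Unitization 0 0"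
definition "1 = Unitization 0 1"
definition "x + y = Unitization (alg_part x + alg_part y) (scalar_part x + scalar_part y)"
definition "x - y = Unitization (alg_part x - alg_part y) (scalar_part x - scalar_part y)"
definition "- x = Unitization (- alg_part x) (- scalar_part x)"
definition "x * y = Unitization
  (alg_part x * alg_part y + scalar_part x *\<^sub>C alg_part y + scalar_part y *\<^sub>C alg_part x)
  (scalar_part x * scalar_part y)"
definition "r *\<^sub>R x = Unitization (r *\<^sub>R alg_part x) (r *\<^sub>R scalar_part x)"
definition "c *\<^sub>C x = Unitization (c *\<^sub>C alg_part x) (c * scalar_part x)"

lemmas unitization_defs = zero_unitization_def one_unitization_def plus_unitization_def
  minus_unitization_def uminus_unitization_def times_unitization_def scaleR_unitization_def
  scaleC_unitization_def

instance
  by standard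
     (auto simp: unitization_defs algebra_simps scaleC_add_left scaleC_add_right scaleC_scaleC
        mult_scaleC_left mult_scaleC_right scaleC_of_real scaleR_conv_of_real[where 'a=complex])

end

lemma unitization_parts [simp]:
  fixes x y :: "'a::cstar_algebra unitization"
  shows "alg_part 0 = (0::'a)" "scalar_part (0 :: 'a unitization) = 0"
    "alg_part 1 = (0::'a)" "scalar_part (1 :: 'a unitization) = 1"
    "alg_part (x + y) = alg_part x + alg_part y" "scalar_part (x + y) = scalar_part x + scalar_part y"
    "alg_part (x - y) = alg_part x - alg_part y" "scalar_part (x - y) = scalar_part x - scalar_part y"
    "alg_part (- x) = - alg_part x" "scalar_part (- x) = - scalar_part x"
    "alg_part (x * y)
       = alg_part x * alg_part y + scalar_part x *\<^sub>C alg_part y + scalar_part y *\<^sub>C alg_part x"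
    "scalar_part (x * y) = scalar_part x * scalar_part y"
    "alg_part (r *\<^sub>R x) = r *\<^sub>R alg_part x" "scalar_part (r *\<^sub>R x) = r *\<^sub>R scalar_part x"
    "alg_part (c *\<^sub>C x) = c *\<^sub>C alg_part x" "scalar_part (c *\<^sub>C x) = c * scalar_part x"
  by (auto simp: unitization_defs)

lemma left_mult_add: "left_mult (x + y) = left_mult x + left_mult y"
  by (rule blinfun_eqI) (simp add: left_mult_apply blinfun.bilinear_simps algebra_simps scaleC_add_left)

lemma left_mult_mult: "left_mult (x * y) = left_mult x o\<^sub>L left_mult y"
  by (rule blinfun_eqI)
     (simp add: left_mult_apply algebra_simps scaleC_add_right scaleC_scaleC
        mult_scaleC_left mult_scaleC_right)

lemma left_mult_scaleR: "left_mult (r *\<^sub>R x) = r *\<^sub>R left_mult x"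
  by (rule blinfun_eqI)
     (simp add: left_mult_apply blinfun.bilinear_simps scaleR_right_distrib
        scaleR_conv_of_real[where 'a=complex] scaleC_of_real flip: scaleC_scaleC)

lemma norm_left_mult_scaleC: "norm (left_mult (c *\<^sub>C x)) = cmod c * norm (left_mult x)"
proof -
  have eq: "blinfun_apply (left_mult (c *\<^sub>C x)) = (\<lambda>b. c *\<^sub>C blinfun_apply (left_mult x) b)"
    for c and x :: "'a unitization"
    by (auto simp: left_mult_apply scaleC_add_right scaleC_scaleC mult_scaleC_left)
  have le: "norm (left_mult (c *\<^sub>C x)) \<le> cmod c * norm (left_mult x)" for c and x :: "'a unitization"
    by (rule norm_blinfun_bound) (auto simp: eq norm_scaleC mult.assoc intro!: mult_left_mono norm_blinfun)
  show ?thesis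
  proof (cases "c = 0")
    case True then show ?thesis using le[of c x] by simp
  next
    case False
    have "norm (left_mult x) \<le> cmod (inverse c) * norm (left_mult (c *\<^sub>C x))"
      using le[of "inverse c" "c *\<^sub>C x"] False by (simp add: scaleC_scaleC)
    then have "cmod c * norm (left_mult x) \<le> norm (left_mult (c *\<^sub>C x))"
      using False by (simp add: norm_divide norm_inverse field_simps)
    then show ?thesis using le[of c x] by linarith
  qed
qed

lemma norm_left_mult_alg: "norm (left_mult (Unitization a 0)) = norm (a::'a::cstar_algebra)"
proof (rule antisym)
  show "norm (left_mult (Unitization a 0)) \<le> norm a"
    by (rule norm_blinfun_bound) (auto simp: left_mult_apply norm_mult_ineq)
  show "norm a \<le> norm (left_mult (Unitization a 0))"
  proof (cases "a = 0")
    case False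
    have "norm a * norm a \<le> norm (left_mult (Unitization a 0)) * norm (star a)"
      using norm_blinfun[of "left_mult (Unitization a 0)" "star a"] norm_mult_star[of a]
      by (simp add: left_mult_apply power2_eq_square)
    then show ?thesis using False by simp
  qed simp
qed

instantiation unitization :: (cstar_algebra) real_normed_algebra_1
begin

definition "norm x = max (cmod (scalar_part x)) (norm (left_mult x))"
definition dist_unitization :: "'a unitization \<Rightarrow> 'a unitization \<Rightarrow> real"
  where "dist_unitization x y = norm (x - y)"
definition sgn_unitization :: "'a unitization \<Rightarrow> 'a unitization"
  where "sgn_unitization x = x /\<^sub>R norm x"
definition uniformity_unitization :: "('a unitization \<times> 'a unitization) filter"
  where "uniformity_unitization = (INF e\<in>{0 <..}. principal {(x, y). dist x y < e})"
definition open_unitization :: "'a unitization set \<Rightarrow> bool"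
  where "open_unitization S \<longleftrightarrow> (\<forall>x\<in>S. \<forall>\<^sub>F (x', y) in uniformity. x' = x \<longrightarrow> y \<in> S)"

lemma norm_alg_part_le: "norm (alg_part x) \<le> 2 * norm (x::'a unitization)"
proof -
  have "left_mult (Unitization (alg_part x) 0) = left_mult x + left_mult (Unitization 0 (- scalar_part x))"
    by (simp flip: left_mult_add add: plus_unitization_def)
  moreover have "norm (left_mult (Unitization 0 (- scalar_part x) :: 'a unitization)) \<le> cmod (scalar_part x)"
    by (rule norm_blinfun_bound) (auto simp: left_mult_apply norm_scaleC)
  ultimately have "norm (alg_part x) \<le> norm (left_mult x) + cmod (scalar_part x)"
    by (metis add_left_mono norm_left_mult_alg norm_triangle_le)
  then show ?thesis by (simp add: norm_unitization_def)
qed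

lemma norm_scalar_part_le: "cmod (scalar_part x) \<le> norm (x::'a unitization)"
  by (simp add: norm_unitization_def)

instance
proof
  fix x y :: "'a unitization" and r :: real
  show "(norm x = 0) = (x = 0)"
  proof
    assume "norm x = 0"
    then have "alg_part x = 0" "scalar_part x = 0"
      using norm_alg_part_le[of x] norm_scalar_part_le[of x] by auto
    then show "x = 0" by (metis unitization.collapse zero_unitization_def)
  next
    assume "x = 0"
    moreover have "left_mult (0::'a unitization) = 0"
      by (rule blinfun_eqI) (simp add: left_mult_apply)
    ultimately show "norm x = 0" by (simp add: norm_unitization_def)
  qed
  show "norm (x + y) \<le> norm x + norm y"
    using norm_triangle_ineq[of "scalar_part x" "scalar_part y"]
      norm_triangle_ineq[of "left_mult x" "left_mult y"]
    by (auto simp: norm_unitization_def left_mult_add)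
  show "norm (r *\<^sub>R x) = \<bar>r\<bar> * norm x"
    by (auto simp: norm_unitization_def left_mult_scaleR max_mult_distrib_left)
  show "norm (x * y) \<le> norm x * norm y"
  proof -
    have "norm (left_mult x o\<^sub>L left_mult y) \<le> norm x * norm y"
      by (rule order_trans[OF norm_blinfun_compose]) (auto simp: norm_unitization_def intro!: mult_mono simp: le_max_iff_disj)
    moreover have "cmod (scalar_part x * scalar_part y) \<le> norm x * norm y"
      by (auto simp: norm_mult norm_unitization_def intro!: mult_mono simp: le_max_iff_disj)
    ultimately show ?thesis by (simp add: norm_unitization_def left_mult_mult)
  qed
  have "norm (left_mult (1::'a unitization)) \<le> 1"
    by (rule norm_blinfun_bound) (auto simp: left_mult_apply)
  then show "norm (1::'a unitization) = 1" by (simp add: norm_unitization_def)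
qed (auto simp: dist_unitization_def sgn_unitization_def uniformity_unitization_def
       open_unitization_def algebra_simps unitization_defs scaleC_scaleR scaleR_scaleC)

end

abbreviation of_alg :: "'a::cstar_algebra \<Rightarrow> 'a unitization" where
  "of_alg a \<equiv> Unitization a 0"

lemma norm_of_alg [simp]: "norm (of_alg a) = norm a"
  by (simp add: norm_unitization_def norm_left_mult_alg)

lemma of_alg_simps:
  "of_alg (a + b) = of_alg a + of_alg b" "of_alg (a - b) = of_alg a - of_alg b"
  "of_alg (- a) = - of_alg a" "of_alg (a * b) = of_alg a * of_alg b" "of_alg 0 = 0"
  "of_alg (r *\<^sub>R a) = r *\<^sub>R of_alg a" "of_alg (c *\<^sub>C a) = c *\<^sub>C of_alg a"
  by (auto simp: unitization_defs)

instantiation unitization :: (cstar_algebra) cstar_algebra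
begin

definition "star x = Unitization (star (alg_part x)) (cnj (scalar_part x))"

instance
proof
  fix c and x y :: "'a unitization"
  show "c *\<^sub>C x * y = c *\<^sub>C (x * y)" "x * c *\<^sub>C y = c *\<^sub>C (x * y)"
    by (simp_all add: unitization_defs scaleC_add_right scaleC_scaleC mult_scaleC_left
          mult_scaleC_right mult.commute mult.left_commute)
  show "norm (c *\<^sub>C x) = cmod c * norm x"
    by (simp add: norm_unitization_def norm_left_mult_scaleC norm_mult max_mult_distrib_left)
  show "star (x + y) = star x + star y" "star (c *\<^sub>C x) = cnj c *\<^sub>C star x"
    "star (x * y) = star y * star x" and ss: "star (star x) = x" for x y :: "'a unitization"
    by (simp_all add: star_unitization_def unitization_defs star_add star_scaleC star_mult star_star
         add_ac)
  have sq: "(norm (left_mult z))\<^sup>2 \<le> norm (left_mult (star z * z))" for z :: "'a unitization"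
  proof -
    have "norm (left_mult z) \<le> sqrt (norm (left_mult (star z * z)))"
    proof (rule norm_blinfun_bound)
      fix b :: 'a
      let ?w = "blinfun_apply (left_mult z) b"
      have "star ?w * ?w = star b * blinfun_apply (left_mult (star z * z)) b"
        by (simp add: left_mult_apply star_unitization_def star_add star_mult star_scaleC
             algebra_simps mult_scaleC_left mult_scaleC_right scaleC_add_left scaleC_add_right
             scaleC_scaleC)
      then have "(norm ?w)\<^sup>2 = norm (star b * blinfun_apply (left_mult (star z * z)) b)"
        by (metis norm_star_mult)
      also have "\<dots> \<le> norm (star b) * norm (blinfun_apply (left_mult (star z * z)) b)"
        by (rule norm_mult_ineq)
      also have "\<dots> \<le> norm b * (norm (left_mult (star z * z)) * norm b)"
        by (intro mult_mono) (auto simp: norm_blinfun)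
      also have "\<dots> = (sqrt (norm (left_mult (star z * z))) * norm b)\<^sup>2"
        by (simp add: power_mult_distrib power2_eq_square)
      finally show "norm ?w \<le> sqrt (norm (left_mult (star z * z))) * norm b"
        by (rule power2_le_imp_le) simp
    qed simp
    then show ?thesis using sqrt_ge_absD by fastforce
  qed
  have prod: "norm (left_mult (star z * z)) \<le> norm (left_mult (star z)) * norm (left_mult z)"
    for z :: "'a unitization"
    by (simp add: left_mult_mult norm_blinfun_compose)
  have le: "norm (left_mult z) \<le> norm (left_mult (star z))" for z :: "'a unitization"
  proof (cases "left_mult z = 0")
    case False
    then show ?thesis
      using order_trans[OF sq[of z] prod[of z]] by (simp add: power2_eq_square)
  qed simp
  have "norm (left_mult (star x)) = norm (left_mult x)"
    using le[of x] le[of "star x"] ss[of x] by simp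
  then have "norm (left_mult (star x * x)) = (norm (left_mult x))\<^sup>2"
    using sq[of x] prod[of x] by (simp add: power2_eq_square)
  moreover have "cmod (scalar_part (star x * x)) = (cmod (scalar_part x))\<^sup>2"
    by (simp add: star_unitization_def norm_mult power2_eq_square)
  ultimately show "norm (star x * x) = (norm x)\<^sup>2"
    by (auto simp: norm_unitization_def max_def power2_le_iff_abs_le power_mono abs_le_square_iff)
next
  fix X :: "nat \<Rightarrow> 'a unitization"
  assume X: "Cauchy X"
  have "Cauchy (\<lambda>n. alg_part (X n))"
  proof (rule metric_CauchyI)
    fix e :: real assume "e > 0"
    then obtain M where M: "\<And>m n. m \<ge> M \<Longrightarrow> n \<ge> M \<Longrightarrow> dist (X m) (X n) < e/2"
      using X by (metis half_gt_zero metric_CauchyD)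
    have "dist (alg_part (X m)) (alg_part (X n)) < e" if "m \<ge> M" "n \<ge> M" for m n
      using norm_alg_part_le[of "X m - X n"] M[OF that] by (simp add: dist_norm)
    then show "\<exists>M. \<forall>m\<ge>M. \<forall>n\<ge>M. dist (alg_part (X m)) (alg_part (X n)) < e" by blast
  qed
  then obtain a where a: "(\<lambda>n. alg_part (X n)) \<longlonglongrightarrow> a"
    using Cauchy_convergent_iff convergent_def by blast
  have "Cauchy (\<lambda>n. scalar_part (X n))"
  proof (rule metric_CauchyI)
    fix e :: real assume "e > 0"
    then obtain M where M: "\<And>m n. m \<ge> M \<Longrightarrow> n \<ge> M \<Longrightarrow> dist (X m) (X n) < e"
      using X by (metis metric_CauchyD)
    have "dist (scalar_part (X m)) (scalar_part (X n)) < e" if "m \<ge> M" "n \<ge> M" for m n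
      using norm_scalar_part_le[of "X m - X n"] M[OF that] by (simp add: dist_norm)
    then show "\<exists>M. \<forall>m\<ge>M. \<forall>n\<ge>M. dist (scalar_part (X m)) (scalar_part (X n)) < e" by blast
  qed
  then obtain c where c: "(\<lambda>n. scalar_part (X n)) \<longlonglongrightarrow> c"
    using Cauchy_convergent_iff convergent_def by blast
  have bound: "norm x \<le> norm (alg_part x) + cmod (scalar_part x)" for x :: "'a unitization"
  proof -
    have "x = of_alg (alg_part x) + scalar_part x *\<^sub>C 1"
      by (simp add: unitization_defs)
    then have "norm x \<le> norm (of_alg (alg_part x)) + norm (scalar_part x *\<^sub>C (1::'a unitization))"
      by (metis norm_triangle_ineq)
    moreover have "norm (scalar_part x *\<^sub>C (1::'a unitization)) = cmod (scalar_part x) * norm (1::'a unitization)"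
      by (simp only: norm_unitization_def norm_left_mult_scaleC) (simp add: max_mult_distrib_left)
    ultimately show ?thesis by simp
  qed
  have "X \<longlonglongrightarrow> Unitization a c"
  proof (rule metric_LIMSEQ_I)
    fix e :: real assume e: "e > 0"
    obtain M where M: "\<And>n. n \<ge> M \<Longrightarrow> dist (alg_part (X n)) a < e/2"
      using metric_LIMSEQ_D[OF a, of "e/2"] e by auto
    obtain M' where M': "\<And>n. n \<ge> M' \<Longrightarrow> dist (scalar_part (X n)) c < e/2"
      using metric_LIMSEQ_D[OF c, of "e/2"] e by auto
    have "dist (X n) (Unitization a c) < e" if "n \<ge> max M M'" for n
      using bound[of "X n - Unitization a c"] M[of n] M'[of n] that by (simp add: dist_norm)
    then show "\<exists>no. \<forall>n\<ge>no. dist (X n) (Unitization a c) < e" by blast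
  qed
  then show "convergent X" by (auto simp: convergent_def)
qed

end

lemma star_of_alg: "star (of_alg a) = of_alg (star a)"
  by (simp add: star_unitization_def)

section \<open>Square roots and positivity in a unital C*-algebra\<close>

text \<open>The fixed-point iteration for \<open>y = (t + y\<^sup>2) / 2\<close>, whose solution is \<open>1 - \<surd>(1 - t)\<close>.\<close>

primrec sqrt_iter :: "'a::real_algebra_1 \<Rightarrow> nat \<Rightarrow> 'a" where
  "sqrt_iter t 0 = 0"
| "sqrt_iter t (Suc n) = (1/2) *\<^sub>R (t + sqrt_iter t n * sqrt_iter t n)"

text \<open>The increments are dominated by those of the scalar iteration for \<open>t = 1\<close>, which increases to
  \<open>1\<close>; so the iteration converges whenever \<open>\<parallel>t\<parallel> \<le> 1\<close>.\<close>

lemma norm_sqrt_iter_le: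
  fixes t :: "'a::real_normed_algebra_1"
  assumes t: "norm t \<le> 1"
  shows "norm (sqrt_iter t n) \<le> sqrt_iter 1 n \<and>
    norm (sqrt_iter t (Suc n) - sqrt_iter t n) \<le> sqrt_iter 1 (Suc n) - sqrt_iter 1 n"
proof (induction n)
  case 0
  then show ?case using t by simp
next
  case (Suc n)
  let ?y = "sqrt_iter t" and ?r = "sqrt_iter (1::real)"
  have bd: "norm (?y (Suc n)) \<le> ?r (Suc n)"
    using Suc norm_triangle_ineq[of "?y n" "?y (Suc n) - ?y n"]
    by (simp del: sqrt_iter.simps)
  have "?y (Suc (Suc n)) - ?y (Suc n)
      = (1/2) *\<^sub>R (t + ?y (Suc n) * ?y (Suc n)) - (1/2) *\<^sub>R (t + ?y n * ?y n)"
    by (simp only: sqrt_iter.simps(2))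
  also have "\<dots> = (1/2) *\<^sub>R (?y (Suc n) * (?y (Suc n) - ?y n) + (?y (Suc n) - ?y n) * ?y n)"
    by (simp only: right_diff_distrib left_diff_distrib flip: scaleR_diff_right) simp
  finally have "norm (?y (Suc (Suc n)) - ?y (Suc n))
      \<le> (1/2) * (norm (?y (Suc n)) * norm (?y (Suc n) - ?y n) + norm (?y (Suc n) - ?y n) * norm (?y n))"
    by (simp del: sqrt_iter.simps) (intro norm_triangle_le add_mono norm_mult_ineq)
  also have "\<dots> \<le> (1/2) * (?r (Suc n) * (?r (Suc n) - ?r n) + (?r (Suc n) - ?r n) * ?r n)"
    using Suc bd by (intro mult_left_mono add_mono mult_mono) (auto simp del: sqrt_iter.simps intro: order_trans[OF norm_ge_zero]
         dest: order_trans[OF norm_ge_zero])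
  also have "\<dots> = ?r (Suc (Suc n)) - ?r (Suc n)"
    by (simp add: algebra_simps)
  finally show ?case using bd by blast
qed

lemma sqrt_iter_one: "0 \<le> sqrt_iter (1::real) n \<and> sqrt_iter (1::real) n \<le> 1"
proof (induction n)
  case (Suc n)
  then have "sqrt_iter 1 n * sqrt_iter 1 n \<le> (1::real)" by (simp add: mult_le_one)
  then show ?case using Suc by simp
qed simp

lemma sqrt_iter_convergent:
  fixes t :: "'a::{real_normed_algebra_1, banach}"
  assumes t: "norm t \<le> 1"
  shows "convergent (sqrt_iter t)"
proof -
  let ?r = "sqrt_iter (1::real)"
  have mono: "incseq ?r"
    using norm_sqrt_iter_le[of "1::real"] by (intro incseq_SucI) (smt (verit) norm_ge_zero norm_one)
  have "convergent ?r"
    by (rule Bseq_mono_convergent)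
       (use sqrt_iter_one mono in \<open>auto simp: incseq_def intro!: BseqI'[where K=1]\<close>)
  then have r: "Cauchy ?r" by (simp add: convergent_Cauchy)
  have diff: "norm (sqrt_iter t (m + k) - sqrt_iter t m) \<le> ?r (m + k) - ?r m" for m k
  proof (induction k)
    case (Suc k)
    have "norm (sqrt_iter t (m + Suc k) - sqrt_iter t m)
        \<le> norm (sqrt_iter t (Suc (m + k)) - sqrt_iter t (m + k)) + norm (sqrt_iter t (m + k) - sqrt_iter t m)"
      by (rule order_trans[OF eq_refl norm_triangle_ineq]) (simp del: sqrt_iter.simps)
    then show ?case using Suc norm_sqrt_iter_le[OF t, of "m + k"] by (simp del: sqrt_iter.simps)
  qed simp
  have "Cauchy (sqrt_iter t)"
  proof (rule metric_CauchyI)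
    fix e :: real assume "e > 0"
    then obtain M where M: "\<And>m n. m \<ge> M \<Longrightarrow> n \<ge> M \<Longrightarrow> norm (?r m - ?r n) < e"
      using CauchyD[OF r] by blast
    have "norm (sqrt_iter t m - sqrt_iter t n) < e" if "m \<ge> M" "n > m" for m n
      using diff[of m "n - m"] M[of n m] that by (simp add: norm_minus_commute)
    then show "\<exists>M. \<forall>m\<ge>M. \<forall>n\<ge>M. dist (sqrt_iter t m) (sqrt_iter t n) < e"
      by (intro exI[of _ M]) (metis \<open>e > 0\<close> dist_commute dist_norm dist_self linorder_neqE_nat)
  qed
  then show ?thesis by (simp add: Cauchy_convergent)
qed

lemma sqrt_one_minus_exists:
  fixes t :: "'a::{cstar_algebra, real_normed_algebra_1}"
  assumes t: "norm t \<le> 1" and sa: "star t = t"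
  obtains y where "norm y \<le> 1" "star y = y" "(1 - y) * (1 - y) = 1 - t"
    "\<And>c. c * t = t * c \<Longrightarrow> c * y = y * c"
proof -
  obtain y where lim: "sqrt_iter t \<longlonglongrightarrow> y"
    using sqrt_iter_convergent[OF t] by (auto simp: convergent_def)
  have "(\<lambda>n. sqrt_iter t (Suc n)) \<longlonglongrightarrow> (1/2) *\<^sub>R (t + y * y)"
    unfolding sqrt_iter.simps by (intro tendsto_intros lim)
  then have fix_eq: "y = (1/2) *\<^sub>R (t + y * y)"
    using LIMSEQ_unique lim LIMSEQ_Suc by blast
  have "2 *\<^sub>R y = t + y * y" by (subst fix_eq) simp
  then have "(1 - y) * (1 - y) = 1 - t" by (simp add: algebra_simps scaleR_2)
  moreover have "norm y \<le> 1"
    by (rule LIMSEQ_le_const2[OF tendsto_norm[OF lim]])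
       (use norm_sqrt_iter_le[OF t] sqrt_iter_one order_trans in blast)
  moreover have "star y = y"
  proof (rule LIMSEQ_unique[OF _ lim])
    have "star (sqrt_iter t n) = sqrt_iter t n" for n
      by (induction n) (auto simp: star_add star_mult sa)
    then show "sqrt_iter t \<longlonglongrightarrow> star y"
      using bounded_linear.tendsto[OF bounded_linear_star lim] by simp
  qed
  moreover have "c * y = y * c" if c: "c * t = t * c" for c
  proof (rule LIMSEQ_unique)
    have "c * sqrt_iter t n = sqrt_iter t n * c" for n
    proof (induction n)
      case (Suc n)
      then have "c * (sqrt_iter t n * sqrt_iter t n) = sqrt_iter t n * sqrt_iter t n * c"
        by (metis mult.assoc)
      then show ?case by (simp add: algebra_simps c)
    qed simp
    moreover have "(\<lambda>n. c * sqrt_iter t n) \<longlonglongrightarrow> c * y" by (intro tendsto_intros lim)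
    ultimately show "(\<lambda>n. sqrt_iter t n * c) \<longlonglongrightarrow> c * y" by simp
    show "(\<lambda>n. sqrt_iter t n * c) \<longlonglongrightarrow> y * c" by (intro tendsto_intros lim)
  qed
  ultimately show thesis using that by blast
qed

text \<open>Being a square of a self-adjoint element is the working notion of positivity; it is only shown
  below that every \<open>star b * b\<close> is of this form.\<close>

definition sa_square :: "'a::cstar_algebra \<Rightarrow> bool" where
  "sa_square a \<longleftrightarrow> (\<exists>s. star s = s \<and> a = s * s)"

lemma sa_square_self_adjoint: "sa_square a \<Longrightarrow> star a = a"
  by (auto simp: sa_square_def star_mult)

lemma sqrt_exists:
  fixes a :: "'a::{cstar_algebra, real_normed_algebra_1}"
  assumes sa: "star a = a" and le: "norm (\<tau> *\<^sub>R 1 - a) \<le> \<tau>"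
  obtains s where "star s = s" "s * s = a" "norm (sqrt \<tau> *\<^sub>R 1 - s) \<le> sqrt \<tau>"
    "\<And>c. c * a = a * c \<Longrightarrow> c * s = s * c"
proof (cases "\<tau> = 0")
  case True
  then show ?thesis using le by (intro that[of 0]) auto
next
  case False
  then have \<tau>: "\<tau> > 0" using le norm_ge_zero order.trans by (metis less_eq_real_def)
  let ?t = "1 - (1/\<tau>) *\<^sub>R a"
  have "?t = (1/\<tau>) *\<^sub>R (\<tau> *\<^sub>R 1 - a)" using \<tau> by (simp add: scaleR_diff_right)
  then have "norm ?t = norm (\<tau> *\<^sub>R 1 - a) / \<tau>" using \<tau> by simp
  then have "norm ?t \<le> 1" using le \<tau> by simp
  moreover have "star ?t = ?t" by (simp add: star_diff sa)
  ultimately obtain y where y: "norm y \<le> 1" "star y = y" "(1 - y) * (1 - y) = 1 - ?t"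
    and comm: "\<And>c. c * ?t = ?t * c \<Longrightarrow> c * y = y * c"
    using sqrt_one_minus_exists by blast
  show ?thesis
  proof (rule that[of "sqrt \<tau> *\<^sub>R (1 - y)"])
    show "star (sqrt \<tau> *\<^sub>R (1 - y)) = sqrt \<tau> *\<^sub>R (1 - y)" by (simp add: star_diff y)
    show "sqrt \<tau> *\<^sub>R (1 - y) * sqrt \<tau> *\<^sub>R (1 - y) = a" using y \<tau> by simp
    have "sqrt \<tau> *\<^sub>R 1 - sqrt \<tau> *\<^sub>R (1 - y) = sqrt \<tau> *\<^sub>R y" by (simp add: algebra_simps)
    then show "norm (sqrt \<tau> *\<^sub>R 1 - sqrt \<tau> *\<^sub>R (1 - y)) \<le> sqrt \<tau>"
      using y \<tau> by (simp add: mult_left_le)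
    show "c * sqrt \<tau> *\<^sub>R (1 - y) = sqrt \<tau> *\<^sub>R (1 - y) * c" if "c * a = a * c" for c
      using comm[of c] that by (simp add: algebra_simps)
  qed
qed

text \<open>The element \<open>u = b + \<i>c\<close> satisfies \<open>star u * u = r\<close>, and \<open>b\<close>, \<open>c\<close> are its real and imaginary
  parts. This replaces spectral arguments: it bounds the norm of a summand by that of the sum.\<close>

lemma norm_summand_of_squares:
  fixes b c :: "'a::{cstar_algebra, real_normed_algebra_1}"
  assumes b: "star b = b" and c: "star c = c" and comm: "b * c = c * b"
    and sum: "b * b + c * c = r *\<^sub>R 1" and r: "r \<ge> 0"
  shows "(norm c)\<^sup>2 \<le> r"
proof -
  define u where "u = b + \<i> *\<^sub>C c"
  have su: "star u = b - \<i> *\<^sub>C c" by (simp add: u_def star_add star_scaleC b c)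
  have "star u * u = (b - \<i> *\<^sub>C c) * (b + \<i> *\<^sub>C c)" by (simp only: su) (simp only: u_def)
  also have "\<dots> = b * b + c * c"
    by (simp add: algebra_simps mult_scaleC_left mult_scaleC_right scaleC_scaleC scaleC_diff_right comm)
  finally have "(norm u)\<^sup>2 = r" using norm_star_mult[of u] sum r by simp
  moreover have "u - star u = (2 * \<i>) *\<^sub>C c"
    using scaleC_add_left[of \<i> \<i> c] unfolding su by (simp add: u_def)
  then have "2 * norm c \<le> norm u + norm (star u)"
    using norm_triangle_ineq4[of u "star u"] by (simp add: norm_scaleC norm_mult)
  then have "(norm c)\<^sup>2 \<le> (norm u)\<^sup>2" by (simp add: power_mono)
  ultimately show ?thesis by simp
qed

lemma sa_square_iff_norm:
  fixes a :: "'a::{cstar_algebra, real_normed_algebra_1}"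
  assumes "star a = a" "norm (\<tau> *\<^sub>R 1 - a) \<le> \<tau>"
  shows "sa_square a"
  using sqrt_exists[OF assms] unfolding sa_square_def by metis

lemma sa_square_norm_bound:
  fixes a :: "'a::{cstar_algebra, real_normed_algebra_1}"
  assumes a: "sa_square a" and \<tau>: "norm a \<le> \<tau>"
  shows "norm (\<tau> *\<^sub>R 1 - a) \<le> \<tau>"
proof -
  obtain b where b: "star b = b" "a = b * b" using a by (auto simp: sa_square_def)
  have "norm (\<tau> *\<^sub>R 1 - (\<tau> *\<^sub>R 1 - a)) \<le> \<tau>" using \<tau> by simp
  moreover have "star (\<tau> *\<^sub>R 1 - a) = \<tau> *\<^sub>R 1 - a" by (simp add: star_diff sa_square_self_adjoint[OF a])
  ultimately obtain c where c: "star c = c" "c * c = \<tau> *\<^sub>R 1 - a"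
    "\<And>d. d * (\<tau> *\<^sub>R 1 - a) = (\<tau> *\<^sub>R 1 - a) * d \<Longrightarrow> d * c = c * d"
    using sqrt_exists by metis
  have "b * c = c * b" by (rule c(3)) (simp add: b algebra_simps)
  then have "(norm c)\<^sup>2 \<le> \<tau>"
    by (rule norm_summand_of_squares[OF b(1) c(1)]) (use b(2) c(2) \<tau> norm_ge_zero[of a] in \<open>auto simp del: norm_ge_zero\<close>)
  then show ?thesis using norm_square_self_adjoint[OF c(1)] c(2) by simp
qed

lemma sa_square_norm_minus:
  fixes a :: "'a::{cstar_algebra, real_normed_algebra_1}"
  assumes "sa_square a" "norm a \<le> \<tau>"
  shows "sa_square (\<tau> *\<^sub>R 1 - a)"
  by (rule sa_square_iff_norm[of _ \<tau>]) (use assms in \<open>auto simp: star_diff sa_square_self_adjoint\<close>)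

lemma sa_square_sqrt:
  fixes a :: "'a::{cstar_algebra, real_normed_algebra_1}"
  assumes "sa_square a"
  obtains s where "sa_square s" "s * s = a" "\<And>c. c * a = a * c \<Longrightarrow> c * s = s * c"
  by (rule sqrt_exists[OF sa_square_self_adjoint[OF assms] sa_square_norm_bound[OF assms order_refl]])
     (metis sa_square_iff_norm)

lemma sa_square_add:
  fixes a b :: "'a::{cstar_algebra, real_normed_algebra_1}"
  assumes "sa_square a" "sa_square b"
  shows "sa_square (a + b)"
proof (rule sa_square_iff_norm[of _ "norm a + norm b"])
  show "star (a + b) = a + b" using assms by (simp add: star_add sa_square_self_adjoint)
  have "(norm a + norm b) *\<^sub>R 1 - (a + b) = (norm a *\<^sub>R 1 - a) + (norm b *\<^sub>R 1 - b)"
    by (simp add: algebra_simps)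
  then show "norm ((norm a + norm b) *\<^sub>R 1 - (a + b)) \<le> norm a + norm b"
    using norm_triangle_mono[OF sa_square_norm_bound[OF assms(1) order_refl]
        sa_square_norm_bound[OF assms(2) order_refl]] by metis
qed

lemma sa_square_scaleR: "sa_square a \<Longrightarrow> r \<ge> 0 \<Longrightarrow> sa_square (r *\<^sub>R (a::'a::cstar_algebra))"
proof -
  assume "sa_square a" "r \<ge> 0"
  then obtain s where "star s = s" "a = s * s" by (auto simp: sa_square_def)
  with \<open>r \<ge> 0\<close> show ?thesis
    unfolding sa_square_def by (intro exI[of _ "sqrt r *\<^sub>R s"]) simp
qed

lemma sa_square_mult:
  fixes a b :: "'a::{cstar_algebra, real_normed_algebra_1}"
  assumes "sa_square a" "sa_square b" and comm: "a * b = b * a"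
  shows "sa_square (a * b)"
proof -
  obtain s where s: "sa_square s" "s * s = a" "\<And>c. c * a = a * c \<Longrightarrow> c * s = s * c"
    using sa_square_sqrt[OF assms(1)] by blast
  obtain r where r: "sa_square r" "r * r = b" "\<And>c. c * b = b * c \<Longrightarrow> c * r = r * c"
    using sa_square_sqrt[OF assms(2)] by blast
  have "b * s = s * b" by (rule s(3)) (simp add: comm)
  then have sr: "s * r = r * s" by (intro r(3)) simp
  then have "star (s * r) = s * r"
    by (simp add: star_mult sa_square_self_adjoint[OF s(1)] sa_square_self_adjoint[OF r(1)])
  moreover have "a * b = (s * r) * (s * r)" using s(2) r(2) sr by (metis mult.assoc)
  ultimately show ?thesis unfolding sa_square_def by blast
qed

lemma sa_square_closed:
  fixes a :: "'a::{cstar_algebra, real_normed_algebra_1}"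
  assumes lim: "(f \<longlongrightarrow> a) F" and pos: "eventually (\<lambda>x. sa_square (f x)) F" and F: "F \<noteq> bot"
  shows "sa_square a"
proof (rule sa_square_iff_norm)
  have ev: "eventually (\<lambda>x. norm (norm (f x) *\<^sub>R 1 - f x) \<le> norm (f x)) F"
    using pos by eventually_elim (simp add: sa_square_norm_bound)
  then show "norm (norm a *\<^sub>R 1 - a) \<le> norm a"
    by (intro tendsto_le[OF F _ _ ev] tendsto_intros lim)
  show "star a = a"
  proof (rule tendsto_unique[OF F _ lim])
    show "(f \<longlongrightarrow> star a) F"
      by (rule Lim_transform_eventually[OF bounded_linear.tendsto[OF bounded_linear_star lim]])
         (use pos in eventually_elim, simp add: sa_square_self_adjoint)
  qed
qed

lemma sa_square_norm_mono:
  fixes a b :: "'a::{cstar_algebra, real_normed_algebra_1}"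
  assumes a: "sa_square a" and ba: "sa_square (b - a)"
  shows "norm a \<le> norm b"
proof -
  have b: "sa_square b" using sa_square_add[OF a ba] by simp
  have "sa_square ((norm b *\<^sub>R 1 - b) + (b - a))"
    by (rule sa_square_add[OF sa_square_norm_minus[OF b order_refl] ba])
  then have d: "sa_square (norm b *\<^sub>R 1 - a)" by simp
  obtain s where s: "sa_square s" "s * s = a" "\<And>c. c * a = a * c \<Longrightarrow> c * s = s * c"
    using sa_square_sqrt[OF a] by blast
  obtain e where e: "sa_square e" "e * e = norm b *\<^sub>R 1 - a"
    "\<And>c. c * (norm b *\<^sub>R 1 - a) = (norm b *\<^sub>R 1 - a) * c \<Longrightarrow> c * e = e * c"
    using sa_square_sqrt[OF d] by blast
  have "s * e = e * s" by (rule e(3)) (use s(2) in \<open>auto simp: algebra_simps\<close>)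
  then have "(norm s)\<^sup>2 \<le> norm b"
    by (intro norm_summand_of_squares[of e s]) (use s(1,2) e(1,2) in \<open>auto simp: sa_square_self_adjoint\<close>)
  then show ?thesis using norm_square_self_adjoint[OF sa_square_self_adjoint[OF s(1)]] s(2) by simp
qed

text \<open>If \<open>c* c = -k\<close>, then \<open>h = c c*\<close> is positive because \<open>c* c + c c*\<close> is half a sum of two squares.
  With \<open>t = \<parallel>c\<parallel>\<^sup>2\<close> this gives \<open>\<parallel>t - h\<parallel> \<le> t\<close>, so \<open>c* (t - h) c = - (t k + k\<^sup>2)\<close> has norm at most \<open>t\<^sup>2\<close>,
  whereas \<open>t k + k\<^sup>2 \<ge> 2 k\<^sup>2\<close> has norm at least \<open>2 t\<^sup>2\<close>.\<close>

lemma star_mult_self_negative_imp_zero: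
  fixes c :: "'a::{cstar_algebra, real_normed_algebra_1}"
  assumes k: "sa_square k" and ck: "star c * c = - k"
  shows "c = 0"
proof -
  define u v where "u = c + star c" and "v = \<i> *\<^sub>C (c - star c)"
  have "star u = u" "star v = v"
    by (simp_all add: u_def v_def star_add star_diff star_star star_scaleC scaleC_diff_right)
  then have "sa_square (u * u + v * v)" by (intro sa_square_add) (auto simp: sa_square_def)
  moreover have "u * u + v * v = 2 *\<^sub>R (c * star c + star c * c)"
    by (simp add: u_def v_def mult_scaleC_left mult_scaleC_right scaleC_scaleC algebra_simps scaleR_2 scaleC_diff_right)
  ultimately have "sa_square ((1/2) *\<^sub>R (2 *\<^sub>R (c * star c + star c * c)) + k)"
    using k by (metis sa_square_add sa_square_scaleR zero_le_divide_1_iff zero_le_numeral)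
  then have h: "sa_square (c * star c)" by (simp add: ck)
  define t where "t = (norm c)\<^sup>2"
  have nk: "norm k = t" using norm_star_mult[of c] ck t_def by simp
  have t0: "t \<ge> 0" by (simp add: t_def)
  have "norm (t *\<^sub>R 1 - c * star c) \<le> t"
    by (rule sa_square_norm_bound[OF h]) (simp add: norm_mult_star t_def)
  then have "norm (star c * (t *\<^sub>R 1 - c * star c) * c) \<le> norm c * t * norm c"
    by (intro order_trans[OF norm_mult_ineq] mult_right_mono order_trans[OF norm_mult_ineq])
       (auto intro!: mult_left_mono)
  moreover have "star c * (t *\<^sub>R 1 - c * star c) * c = t *\<^sub>R (star c * c) - (star c * c) * (star c * c)"
    by (simp add: algebra_simps)
  then have "star c * (t *\<^sub>R 1 - c * star c) * c = - (t *\<^sub>R k + k * k)" by (simp add: ck)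
  ultimately have upper: "norm (t *\<^sub>R k + k * k) \<le> t * t"
    by (metis norm_minus_cancel mult.commute mult.left_commute power2_eq_square t_def)
  have "sa_square (k * (t *\<^sub>R 1 - k))"
    by (rule sa_square_mult[OF k sa_square_norm_minus[OF k]]) (auto simp: nk algebra_simps)
  then have "sa_square ((t *\<^sub>R k + k * k) - 2 *\<^sub>R (k * k))"
    by (simp add: algebra_simps scaleR_2)
  moreover have "sa_square (2 *\<^sub>R (k * k))"
    using k sa_square_self_adjoint[OF k] by (intro sa_square_scaleR) (auto simp: sa_square_def)
  ultimately have "norm (2 *\<^sub>R (k * k)) \<le> norm (t *\<^sub>R k + k * k)"
    using sa_square_norm_mono by blast
  moreover have "norm (k * k) = t * t"
    using norm_square_self_adjoint[OF sa_square_self_adjoint[OF k]] nk by (simp add: power2_eq_square)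
  ultimately have "2 * (t * t) \<le> t * t" using upper by simp
  then have "t = 0" using t0 by (metis mult_2 add_le_same_cancel1 mult_eq_0_iff order_antisym mult_nonneg_nonneg)
  then show ?thesis by (simp add: t_def)
qed

text \<open>Let \<open>a = b* b\<close>, \<open>q = \<bar>a\<bar>\<close> and \<open>m = q - a\<close>, which is twice the negative part of \<open>a\<close>. Since
  \<open>a m = - q m\<close>, the element \<open>c = b m\<close> has \<open>c* c = - m q m \<le> 0\<close>, so it vanishes; hence \<open>m = 0\<close>.\<close>

lemma sa_square_star_mult:
  fixes b :: "'a::{cstar_algebra, real_normed_algebra_1}"
  shows "sa_square (star b * b)"
proof -
  define a where "a = star b * b"
  have sa: "star a = a" by (simp add: a_def star_mult star_star)
  have "sa_square (a * a)" using sa by (auto simp: sa_square_def)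
  then obtain q where q: "sa_square q" "q * q = a * a" "\<And>c. c * (a * a) = a * a * c \<Longrightarrow> c * q = q * c"
    using sa_square_sqrt by blast
  have aq: "a * q = q * a" by (rule q(3)) (simp add: mult.assoc)
  obtain r where r: "sa_square r" "r * r = q" "\<And>c. c * q = q * c \<Longrightarrow> c * r = r * c"
    using sa_square_sqrt[OF q(1)] by blast
  define m where "m = q - a"
  have sm: "star m = m" by (simp add: m_def star_diff sa sa_square_self_adjoint[OF q(1)])
  have am: "a * m = - (q * m)" by (simp add: m_def algebra_simps aq q(2))
  have mr: "m * r = r * m" by (rule r(3)) (simp add: m_def algebra_simps aq)
  have srm: "star (r * m) = r * m"
    by (simp add: star_mult sm sa_square_self_adjoint[OF r(1)] mr)
  define k where "k = (r * m) * (r * m)"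
  have "k = m * (q * m)" unfolding k_def using mr r(2) by (metis mult.assoc)
  moreover have "star (b * m) * (b * m) = m * (a * m)"
    by (simp add: star_mult sm a_def mult.assoc)
  ultimately have ck: "star (b * m) * (b * m) = - k" by (simp add: am)
  have "b * m = 0"
    by (rule star_mult_self_negative_imp_zero[OF _ ck]) (use srm in \<open>auto simp: sa_square_def k_def\<close>)
  then have "k = 0" using ck by simp
  then have "r * m = 0" using norm_square_self_adjoint[OF srm] by (simp add: k_def)
  then have "q * m = 0" using r(2) by (metis mult.assoc mult_zero_right)
  then have "m * m = 0" using am by (simp add: m_def left_diff_distrib)
  then have "m = 0" using norm_square_self_adjoint[OF sm] by simp
  then show ?thesis using q(1) by (simp add: m_def a_def)
qed

section \<open>The order of a C*-algebra\<close>

lemma positive_iff_sa_square_of_alg: "positive a \<longleftrightarrow> sa_square (of_alg (a::'a::cstar_algebra))"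
proof
  assume "positive a"
  then obtain b where "a = star b * b" by (auto simp: positive_def)
  then show "sa_square (of_alg a)"
    using sa_square_star_mult[of "of_alg b"] by (simp add: star_of_alg of_alg_simps)
next
  assume "sa_square (of_alg a)"
  then obtain s where s: "star s = s" "of_alg a = s * s" by (auto simp: sa_square_def)
  \<comment> \<open>The scalar part is multiplicative, so the square root of an element of \<open>A\<close> lies in \<open>A\<close>.\<close>
  have "scalar_part s * scalar_part s = 0" using arg_cong[OF s(2), of scalar_part] by simp
  then obtain b where b: "s = of_alg b" by (metis mult_eq_0_iff unitization.collapse)
  then show "positive a" unfolding positive_def
    using s by (intro exI[of _ b]) (simp add: star_of_alg flip: of_alg_simps)
qed

lemma positive_iff_sa_square:
  "positive a \<longleftrightarrow> sa_square (a::'a::{cstar_algebra, real_normed_algebra_1})"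
  unfolding positive_def using sa_square_star_mult by (metis sa_square_def)

lemma positive_self_adjoint: "positive a \<Longrightarrow> star a = a"
  by (auto simp: positive_def star_mult star_star)

lemma positive_star_mult [intro]: "positive (star b * b)"
  by (auto simp: positive_def)

lemma positive_mult_star: "positive (b * star b)"
  using positive_star_mult[of "star b"] by (simp add: star_star)

lemma positive_zero [simp]: "positive (0::'a::cstar_algebra)"
  using positive_star_mult[of "0::'a"] by simp

lemma positive_add: "positive a \<Longrightarrow> positive b \<Longrightarrow> positive (a + b)"
  by (simp add: positive_iff_sa_square_of_alg of_alg_simps sa_square_add)

lemma positive_scaleR: "positive a \<Longrightarrow> r \<ge> 0 \<Longrightarrow> positive (r *\<^sub>R a)"
  by (simp add: positive_iff_sa_square_of_alg of_alg_simps sa_square_scaleR)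

lemma positive_sum: "(\<And>i. i \<in> I \<Longrightarrow> positive (f i)) \<Longrightarrow> positive (\<Sum>i\<in>I. f i)"
  by (induction I rule: infinite_finite_induct) (auto intro: positive_add)

lemma positive_conj:
  assumes "positive p" shows "positive (star a * p * a)"
proof -
  obtain b where "p = star b * b" using assms by (auto simp: positive_def)
  then have "star a * p * a = star (b * a) * (b * a)" by (simp add: star_mult mult.assoc)
  then show ?thesis by auto
qed

lemma positive_closed:
  fixes a :: "'a::cstar_algebra"
  assumes lim: "(f \<longlongrightarrow> a) F" and "eventually (\<lambda>x. positive (f x)) F" and "F \<noteq> bot"
  shows "positive a"
proof -
  have "bounded_linear (of_alg :: 'a \<Rightarrow> _)"
    by (rule bounded_linear_intro[where K=1]) (auto simp: of_alg_simps)
  then have "((\<lambda>x. of_alg (f x)) \<longlongrightarrow> of_alg a) F" by (rule bounded_linear.tendsto[OF _ lim])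
  then show ?thesis
    using sa_square_closed assms by (simp add: positive_iff_sa_square_of_alg)
qed

lemma cstar_le_refl [simp]: "cstar_le a a"
  by (simp add: cstar_le_def)

lemma cstar_le_zero_iff [simp]: "cstar_le 0 a \<longleftrightarrow> positive a"
  by (simp add: cstar_le_def)

lemma cstar_le_trans [trans]: "cstar_le a b \<Longrightarrow> cstar_le b c \<Longrightarrow> cstar_le a c"
  unfolding cstar_le_def using positive_add[of "b - a" "c - b"] by simp

lemma cstar_le_add: "cstar_le a b \<Longrightarrow> cstar_le c d \<Longrightarrow> cstar_le (a + c) (b + d)"
  unfolding cstar_le_def using positive_add[of "b - a" "d - c"] by (simp add: algebra_simps)

lemma cstar_le_sum: "(\<And>i. i \<in> I \<Longrightarrow> cstar_le (f i) (g i)) \<Longrightarrow> cstar_le (\<Sum>i\<in>I. f i) (\<Sum>i\<in>I. g i)"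
  unfolding cstar_le_def sum_subtractf[symmetric] by (rule positive_sum)

lemma cstar_le_scaleR: "cstar_le a b \<Longrightarrow> r \<ge> 0 \<Longrightarrow> cstar_le (r *\<^sub>R a) (r *\<^sub>R b)"
  unfolding cstar_le_def using positive_scaleR[of "b - a" r] by (simp add: scaleR_diff_right)

lemma cstar_le_scaleR_left: "positive a \<Longrightarrow> r \<le> s \<Longrightarrow> cstar_le (r *\<^sub>R a) (s *\<^sub>R a)"
  unfolding cstar_le_def using positive_scaleR[of a "s - r"] by (simp add: scaleR_diff_left)

lemma cstar_le_sum_mono:
  assumes "finite K" "I \<subseteq> K" "\<And>i. i \<in> K \<Longrightarrow> positive (f i)"
  shows "cstar_le (\<Sum>i\<in>I. f i) (\<Sum>i\<in>K. f i)"
  unfolding cstar_le_def sum_diff[OF assms(1,2), symmetric] using assms by (intro positive_sum) auto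

lemma cstar_le_tendsto:
  assumes "(f \<longlongrightarrow> a) F" "(g \<longlongrightarrow> b) F" "eventually (\<lambda>x. cstar_le (f x) (g x)) F" "F \<noteq> bot"
  shows "cstar_le a b"
  unfolding cstar_le_def
  by (rule positive_closed[OF tendsto_diff[OF assms(2,1)]]) (use assms in \<open>auto simp: cstar_le_def\<close>)

lemma cstar_le_norm_mono: "positive a \<Longrightarrow> cstar_le a b \<Longrightarrow> norm a \<le> norm b"
  using sa_square_norm_mono[of "of_alg a" "of_alg b"]
  by (simp add: cstar_le_def positive_iff_sa_square_of_alg of_alg_simps)

lemma cstar_le_conj:
  assumes "positive p"
  shows "cstar_le (star a * p * a) (norm p *\<^sub>R (star a * a))"
proof -
  have "sa_square (norm p *\<^sub>R 1 - of_alg p)"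
    using assms by (intro sa_square_norm_minus) (auto simp: positive_iff_sa_square_of_alg)
  then have "positive (star (of_alg a) * (norm p *\<^sub>R 1 - of_alg p) * of_alg a)"
    by (intro positive_conj) (simp add: positive_iff_sa_square)
  also have "star (of_alg a) * (norm p *\<^sub>R 1 - of_alg p) * of_alg a
      = of_alg (norm p *\<^sub>R (star a * a) - star a * p * a)"
    by (simp add: star_of_alg of_alg_simps algebra_simps)
  finally have "sa_square (of_alg (norm p *\<^sub>R (star a * a) - star a * p * a))"
    by (simp only: positive_iff_sa_square)
  then show ?thesis by (simp only: cstar_le_def positive_iff_sa_square_of_alg)
qed

text \<open>The parameters stand for \<open>p = \<langle>x, x\<rangle>\<close>, \<open>q = \<langle>x, y\<rangle>\<close> and \<open>r = \<langle>y, y\<rangle>\<close> for an algebra-valued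
  semi-inner product, and the hypothesis for \<open>\<langle>x a - t y, x a - t y\<rangle> \<ge> 0\<close>. Stating it for the values
  alone makes it apply to Hilbert modules, to finite families of algebra elements and to the forms
  \<open>\<langle>x, T y\<rangle>\<close> of positive operators alike.\<close>

lemma cauchy_schwarz_cstar:
  fixes p q r :: "'a::cstar_algebra"
  assumes p: "positive p"
    and form: "\<And>a t. positive (star a * p * a - t *\<^sub>R (star a * q) - t *\<^sub>R (star q * a) + t\<^sup>2 *\<^sub>R r)"
  shows "cstar_le (star q * q) (norm p *\<^sub>R r)"
proof (cases "p = 0")
  case True
  have "norm (star q * q) * n \<le> norm r" for n :: nat
  proof -
    have "positive (r - (2 * real n) *\<^sub>R (star q * q))"
      using form[of "real n *\<^sub>R q" 1] True by (simp add: algebra_simps flip: scaleR_2)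
    then have "norm ((2 * real n) *\<^sub>R (star q * q)) \<le> norm r"
      by (intro cstar_le_norm_mono positive_scaleR) (auto simp: cstar_le_def)
    moreover have "norm (star q * q) * n \<le> norm ((2 * real n) *\<^sub>R (star q * q))"
      by (simp add: mult.commute mult_right_mono)
    ultimately show ?thesis by linarith
  qed
  then have "norm (star q * q) = 0"
    by (metis mult.commute norm_ge_zero not_less reals_Archimedean3 order_le_less)
  then show ?thesis using True by simp
next
  case False
  define t where "t = norm p"
  have t: "t > 0" using False by (simp add: t_def)
  have "positive ((star q * p * q - t *\<^sub>R (star q * q) - t *\<^sub>R (star q * q) + t\<^sup>2 *\<^sub>R r)
      + (t *\<^sub>R (star q * q) - star q * p * q))"
    using cstar_le_conj[OF p, of q] unfolding cstar_le_def t_def[symmetric]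
    by (rule positive_add[OF form])
  then have "positive ((1/t) *\<^sub>R (t\<^sup>2 *\<^sub>R r - t *\<^sub>R (star q * q)))"
    using t by (intro positive_scaleR) (auto simp: algebra_simps)
  then show ?thesis using t
    by (simp add: cstar_le_def scaleR_diff_right power2_eq_square t_def)
qed

lemma cauchy_schwarz_sum:
  fixes u v :: "'i \<Rightarrow> 'a::cstar_algebra" and I :: "'i set"
  defines "q \<equiv> \<Sum>i\<in>I. star (u i) * v i"
  shows "cstar_le (star q * q) (norm (\<Sum>i\<in>I. star (u i) * u i) *\<^sub>R (\<Sum>i\<in>I. star (v i) * v i))"
proof (rule cauchy_schwarz_cstar)
  fix a :: 'a and t :: real
  have "positive (\<Sum>i\<in>I. star (u i * a - t *\<^sub>R v i) * (u i * a - t *\<^sub>R v i))"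
    by (intro positive_sum) auto
  also have "(\<Sum>i\<in>I. star (u i * a - t *\<^sub>R v i) * (u i * a - t *\<^sub>R v i))
     = star a * (\<Sum>i\<in>I. star (u i) * u i) * a - t *\<^sub>R (star a * q) - t *\<^sub>R (star q * a)
       + t\<^sup>2 *\<^sub>R (\<Sum>i\<in>I. star (v i) * v i)"
    by (simp add: q_def star_sum sum_distrib_left sum_distrib_right scaleR_sum_right star_diff
        star_mult star_star power2_eq_square algebra_simps sum.distrib sum_subtractf)
  finally show "positive (star a * (\<Sum>i\<in>I. star (u i) * u i) * a - t *\<^sub>R (star a * q)
       - t *\<^sub>R (star q * a) + t\<^sup>2 *\<^sub>R (\<Sum>i\<in>I. star (v i) * v i))" .
qed (auto intro: positive_sum)

text \<open>A sequence in \<open>A\<close> that is positive, decreasing and convex has increments of order \<open>1/k\<close>, since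
  the first \<open>k + 1\<close> of them dominate the last and add up to at most \<open>c 0\<close>. It is applied to the
  powers of a positive contraction.\<close>

lemma convex_decreasing_increments:
  fixes c :: "nat \<Rightarrow> 'a::cstar_algebra"
  assumes pos: "\<And>k. positive (c k)" and dec: "\<And>k. positive (c k - c (Suc k))"
    and convex: "\<And>k. positive (c k - c (Suc k) - (c (Suc k) - c (Suc (Suc k))))"
  shows "real (Suc k) * norm (c k - c (Suc k)) \<le> norm (c 0)"
proof -
  have le: "cstar_le (real (Suc k) *\<^sub>R (c k - c (Suc k))) (c 0 - c (Suc k))" for k
  proof (induction k)
    case (Suc k)
    have "cstar_le (real (Suc k) *\<^sub>R (c (Suc k) - c (Suc (Suc k)))) (real (Suc k) *\<^sub>R (c k - c (Suc k)))"
      by (rule cstar_le_scaleR) (auto simp: cstar_le_def convex)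
    from cstar_le_trans[OF this Suc] have
      "cstar_le (real (Suc k) *\<^sub>R (c (Suc k) - c (Suc (Suc k))) + (c (Suc k) - c (Suc (Suc k))))
        ((c 0 - c (Suc k)) + (c (Suc k) - c (Suc (Suc k))))"
      by (rule cstar_le_add) simp
    then show ?case by (simp add: algebra_simps scaleR_2)
  qed simp
  have "cstar_le (c 0 - c (Suc k)) (c 0)" by (simp add: cstar_le_def pos)
  from cstar_le_trans[OF le this]
  have "norm (real (Suc k) *\<^sub>R (c k - c (Suc k))) \<le> norm (c 0)"
    by (intro cstar_le_norm_mono positive_scaleR dec) auto
  then show ?thesis by simp
qed

text \<open>With \<open>h = a* a\<close>, the elements \<open>1 - (1 - h)^k\<close> of the unitization lie in \<open>A\<close>, and
  \<open>\<parallel>a (1 - h)^k\<parallel>\<^sup>2 = \<parallel>(1 - h)^(2k) h\<parallel>\<close> is of order \<open>1/k\<close>.\<close>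

lemma approximate_unit_contraction:
  fixes a :: "'a::cstar_algebra"
  assumes a: "norm a \<le> 1"
  shows "\<exists>e. (\<forall>k. star (e k) = e k \<and> norm (e k) \<le> 1) \<and> (\<lambda>k. a * e k) \<longlonglongrightarrow> a"
proof -
  define h where "h = of_alg (star a * a)"
  define T where "T = 1 - h"
  have h: "sa_square h"
    using positive_star_mult[of a] by (simp add: h_def positive_iff_sa_square_of_alg)
  have nh: "norm h \<le> 1" using a by (simp add: h_def norm_star_mult power_le_one)
  have T: "sa_square T" using sa_square_norm_minus[OF h nh] by (simp add: T_def)
  have nT: "norm T \<le> 1" using sa_square_norm_bound[OF h nh] by (simp add: T_def)
  have Tk: "sa_square (T ^ k)" for k
  proof (induction k)
    case 0
    show ?case unfolding sa_square_def by (intro exI[of _ 1]) simp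
  next
    case (Suc k)
    then show ?case by (simp add: sa_square_mult T power_commutes)
  qed
  have comm: "T ^ k * h = h * T ^ k" for k
    by (rule power_commuting_commutes) (simp add: T_def algebra_simps)
  have Th: "T ^ k - T ^ Suc k = T ^ k * h" for k
  proof -
    have "T ^ Suc k = (1 - h) * T ^ k" by (simp add: T_def)
    then show ?thesis by (simp add: comm left_diff_distrib)
  qed
  have Tkh: "sa_square (T ^ k * h)" for k by (rule sa_square_mult[OF Tk h comm])
  have "real (Suc k) * norm (T ^ k - T ^ Suc k) \<le> norm (T ^ 0)" for k
  proof (rule convex_decreasing_increments; unfold positive_iff_sa_square)
    show "sa_square (T ^ k)" "sa_square (T ^ k - T ^ Suc k)" for k using Tk Tkh Th by metis+
    have "T ^ k * h - T ^ Suc k * h = (T ^ k * h) * h" for k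
      by (simp only: Th flip: left_diff_distrib)
    moreover have "sa_square ((T ^ k * h) * h)" for k
      by (rule sa_square_mult[OF Tkh h]) (metis comm mult.assoc)
    ultimately show "sa_square (T ^ k - T ^ Suc k - (T ^ Suc k - T ^ Suc (Suc k)))" for k
      unfolding Th by simp
  qed
  then have bound: "norm (T ^ k * h) \<le> 1 / real (Suc k)" for k
    by (simp add: Th field_simps del: of_nat_Suc power_Suc)
  have sc: "scalar_part (1 - T ^ k) = 0" for k by (induction k) (auto simp: T_def h_def)
  define e where "e k = alg_part (1 - T ^ k)" for k
  have emb: "of_alg (e k) = 1 - T ^ k" for k by (metis e_def sc unitization.collapse)
  have "star (e k) = e k" for k
  proof -
    have "of_alg (star (e k)) = of_alg (e k)"
      unfolding star_of_alg[symmetric] emb by (simp add: star_diff sa_square_self_adjoint[OF Tk])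
    then show ?thesis by simp
  qed
  moreover have "norm (e k) \<le> 1" for k
  proof -
    have "norm (T ^ k) \<le> 1" using norm_power_ineq[of T k] nT power_le_one[of "norm T" k] by simp
    then have "norm (of_alg (e k)) \<le> 1" unfolding emb using sa_square_norm_bound[OF Tk, of k 1] by simp
    then show ?thesis by simp
  qed
  moreover have "(\<lambda>k. a * e k) \<longlonglongrightarrow> a"
  proof (rule LIMSEQ_I)
    fix \<epsilon> :: real assume \<epsilon>: "\<epsilon> > 0"
    obtain N :: nat where N: "1 / real (Suc N) < \<epsilon>\<^sup>2"
      using reals_Archimedean[of "\<epsilon>\<^sup>2"] \<epsilon> by (auto simp: inverse_eq_divide)
    have "norm (a * e k - a) < \<epsilon>" if "k \<ge> N" for k
    proof -
      have "(norm (a * e k - a))\<^sup>2 = (norm (of_alg (a * e k - a)))\<^sup>2" by simp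
      also have "of_alg (a * e k - a) = - (of_alg a * T ^ k)"
        by (simp only: of_alg_simps emb) (simp add: algebra_simps)
      also have "(norm (- (of_alg a * T ^ k)))\<^sup>2 = norm (star (of_alg a * T ^ k) * (of_alg a * T ^ k))"
        by (simp only: norm_star_mult norm_minus_cancel)
      also have "star (of_alg a * T ^ k) * (of_alg a * T ^ k) = T ^ (k + k) * h"
        unfolding star_mult sa_square_self_adjoint[OF Tk] power_add
        using comm[of k] by (simp add: h_def star_of_alg of_alg_simps mult.assoc)
      also have "norm \<dots> \<le> 1 / real (Suc (k + k))" by (rule bound)
      also have "\<dots> \<le> 1 / real (Suc N)" using that by (simp add: frac_le)
      finally show ?thesis using N \<epsilon> by (meson le_less_trans less_imp_le power2_less_imp_less)
    qed
    then show "\<exists>no. \<forall>k\<ge>no. norm (a * e k - a) < \<epsilon>" by blast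
  qed
  ultimately show ?thesis by blast
qed

lemma approximate_unit:
  fixes a :: "'a::cstar_algebra"
  obtains e where "\<And>k. star (e k) = e k" "\<And>k. norm (e k) \<le> 1" "(\<lambda>k. a * e k) \<longlonglongrightarrow> a"
proof -
  let ?n = "norm a + 1"
  have n: "?n > 0" by (simp add: add_nonneg_pos)
  obtain e where e: "\<And>k. star (e k) = e k" "\<And>k. norm (e k) \<le> 1"
    "(\<lambda>k. (1/?n) *\<^sub>R a * e k) \<longlonglongrightarrow> (1/?n) *\<^sub>R a"
    using approximate_unit_contraction[of "(1/?n) *\<^sub>R a"] n by (auto simp: divide_simps)
  have "(\<lambda>k. ?n *\<^sub>R ((1/?n) *\<^sub>R a * e k)) \<longlonglongrightarrow> ?n *\<^sub>R ((1/?n) *\<^sub>R a)"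
    by (intro tendsto_intros e(3))
  then have "(\<lambda>k. a * e k) \<longlonglongrightarrow> a" using n by simp
  then show thesis using that e by blast
qed

section \<open>The Hahn-Banach theorem for the norm\<close>

definition sublinear :: "('v::real_vector \<Rightarrow> real) \<Rightarrow> bool" where
  "sublinear q \<longleftrightarrow> (\<forall>x y. q (x + y) \<le> q x + q y) \<and> (\<forall>r\<ge>0. \<forall>x. q (r *\<^sub>R x) \<le> r * q x)"

lemma sublinear_zero: "sublinear q \<Longrightarrow> q 0 = 0"
proof -
  assume "sublinear q"
  then have "q (0 + 0) \<le> q 0 + q 0" "q (0 *\<^sub>R 0) \<le> 0 * q 0"
    unfolding sublinear_def by blast+
  then show ?thesis by simp
qed

lemma sublinear_minus: "sublinear q \<Longrightarrow> - q (- x) \<le> q x"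
proof -
  assume q: "sublinear q"
  then have "q (x + - x) \<le> q x + q (- x)" unfolding sublinear_def by blast
  then show ?thesis by (simp add: sublinear_zero[OF q])
qed

lemma sublinear_scaleR: "sublinear q \<Longrightarrow> r \<ge> 0 \<Longrightarrow> q (r *\<^sub>R x) = r * q x"
proof (cases "r = 0")
  case False
  assume q: "sublinear q" and "r \<ge> 0"
  then have r: "r > 0" using False by simp
  have "q (inverse r *\<^sub>R (r *\<^sub>R x)) \<le> inverse r * q (r *\<^sub>R x)"
    using q r unfolding sublinear_def by (metis inverse_nonnegative_iff_nonnegative less_imp_le)
  then have "r * q x \<le> q (r *\<^sub>R x)" using r by (simp add: field_simps)
  then show ?thesis using q \<open>r \<ge> 0\<close> unfolding sublinear_def by (meson order_antisym)
qed (simp add: sublinear_zero)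

text \<open>Lowering a sublinear functional as far as subadditivity permits in the direction \<open>y\<close>: the
  result takes the value \<open>- q y\<close> at \<open>- y\<close>.\<close>

definition lower_towards :: "('v::real_vector \<Rightarrow> real) \<Rightarrow> 'v \<Rightarrow> 'v \<Rightarrow> real" where
  "lower_towards q y x = (INF t\<in>{0..}. q (x + t *\<^sub>R y) - t * q y)"

lemma lower_towards_le:
  assumes q: "sublinear q" and "t \<ge> 0"
  shows "lower_towards q y x \<le> q (x + t *\<^sub>R y) - t * q y"
  unfolding lower_towards_def
proof (rule cINF_lower)
  show "bdd_below ((\<lambda>t. q (x + t *\<^sub>R y) - t * q y) ` {0..})"
  proof (rule bdd_belowI2[where m="- q (- x)"])
    fix t :: real assume "t \<in> {0..}"
    then have "t * q y = q (t *\<^sub>R y)" by (simp add: sublinear_scaleR[OF q])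
    also have "\<dots> = q ((x + t *\<^sub>R y) + - x)" by simp
    also have "\<dots> \<le> q (x + t *\<^sub>R y) + q (- x)" using q unfolding sublinear_def by blast
    finally show "- q (- x) \<le> q (x + t *\<^sub>R y) - t * q y" by simp
  qed
qed (use assms in simp)

lemma sublinear_lower_towards:
  assumes q: "sublinear q"
  shows "sublinear (lower_towards q y)"
  unfolding sublinear_def
proof (intro conjI allI impI)
  fix x1 x2
  have "lower_towards q y (x1 + x2) - (q (x2 + t2 *\<^sub>R y) - t2 * q y) \<le> q (x1 + t1 *\<^sub>R y) - t1 * q y"
    if "t1 \<ge> 0" "t2 \<ge> 0" for t1 t2
  proof -
    have "lower_towards q y (x1 + x2) \<le> q ((x1 + x2) + (t1 + t2) *\<^sub>R y) - (t1 + t2) * q y"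
      using that by (intro lower_towards_le[OF q]) auto
    also have "(x1 + x2) + (t1 + t2) *\<^sub>R y = (x1 + t1 *\<^sub>R y) + (x2 + t2 *\<^sub>R y)"
      by (simp add: algebra_simps)
    also have "q \<dots> \<le> q (x1 + t1 *\<^sub>R y) + q (x2 + t2 *\<^sub>R y)" using q unfolding sublinear_def by blast
    finally show ?thesis by (simp add: algebra_simps)
  qed
  then have "lower_towards q y (x1 + x2) - (q (x2 + t2 *\<^sub>R y) - t2 * q y) \<le> lower_towards q y x1"
    if "t2 \<ge> 0" for t2
    unfolding lower_towards_def[of q y x1] using that by (intro cINF_greatest) auto
  then have "lower_towards q y (x1 + x2) - lower_towards q y x1 \<le> q (x2 + t2 *\<^sub>R y) - t2 * q y"
    if "t2 \<ge> 0" for t2 using that by (simp add: algebra_simps)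
  then have "lower_towards q y (x1 + x2) - lower_towards q y x1 \<le> lower_towards q y x2"
    unfolding lower_towards_def[of q y x2] by (intro cINF_greatest) auto
  then show "lower_towards q y (x1 + x2) \<le> lower_towards q y x1 + lower_towards q y x2" by simp
next
  fix r :: real and x assume r: "r \<ge> 0"
  show "lower_towards q y (r *\<^sub>R x) \<le> r * lower_towards q y x"
  proof (cases "r = 0")
    case True
    then show ?thesis using lower_towards_le[OF q, of 0 y 0] by (simp add: sublinear_zero[OF q])
  next
    case False
    have "lower_towards q y (r *\<^sub>R x) / r \<le> q (x + t *\<^sub>R y) - t * q y" if t: "t \<ge> 0" for t
    proof -
      have "lower_towards q y (r *\<^sub>R x) \<le> q (r *\<^sub>R x + (r * t) *\<^sub>R y) - (r * t) * q y"
        using r t by (intro lower_towards_le[OF q]) auto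
      also have "r *\<^sub>R x + (r * t) *\<^sub>R y = r *\<^sub>R (x + t *\<^sub>R y)" by (simp add: algebra_simps)
      also have "q \<dots> = r * q (x + t *\<^sub>R y)" using r by (rule sublinear_scaleR[OF q])
      finally show ?thesis using r False by (simp add: field_simps)
    qed
    then have "lower_towards q y (r *\<^sub>R x) / r \<le> lower_towards q y x"
      unfolding lower_towards_def[of q y x] by (intro cINF_greatest) auto
    then show ?thesis using r False by (simp add: field_simps)
  qed
qed

text \<open>A sublinear functional that is minimal in the pointwise order cannot be lowered in any
  direction, which makes it additive.\<close>

lemma minimal_sublinear_linear:
  assumes q: "sublinear q" and min: "\<And>r. sublinear r \<Longrightarrow> r \<le> q \<Longrightarrow> r = q"
  shows "linear q"
proof -
  have "lower_towards q y = q" for y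
  proof (rule min)
    show "lower_towards q y \<le> q" using lower_towards_le[OF q, of 0 y] by (simp add: le_fun_def)
  qed (rule sublinear_lower_towards[OF q])
  then have "q x \<le> q (x + y) - q y" for x y
    using lower_towards_le[OF q, of 1 y x] by simp
  then have add: "q (x + y) = q x + q y" for x y
    using q unfolding sublinear_def by (smt (verit))
  have neg: "q (- x) = - q x" for x using add[of x "- x"] sublinear_zero[OF q] by simp
  show ?thesis
  proof (rule linearI)
    show "q (r *\<^sub>R x) = r *\<^sub>R q x" for r x
    proof (cases "r \<ge> 0")
      case False
      then show ?thesis using sublinear_scaleR[OF q, of "- r" x] neg[of "r *\<^sub>R x"] by simp
    qed (simp add: sublinear_scaleR[OF q])
  qed (rule add)
qed

text \<open>Zorn's lemma, applied to the sublinear functionals below \<open>p\<close>. The infimum \<open>u\<close> of a chain is finite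
  since each of its members satisfies \<open>q x \<ge> - q (- x) \<ge> - p (- x)\<close>.\<close>

lemma linear_below_sublinear:
  fixes p :: "'v::real_vector \<Rightarrow> real"
  assumes p: "sublinear p"
  obtains f where "linear f" "f \<le> p"
proof -
  define A where "A = {q. sublinear q \<and> q \<le> p}"
  let ?P = "\<lambda>q r. r \<le> (q :: 'v \<Rightarrow> real)"
  have "\<exists>m\<in>A. \<forall>q\<in>A. ?P m q \<longrightarrow> q = m"
  proof (rule predicate_Zorn)
    show "partial_order_on A (relation_of ?P A)"
      by (rule partial_order_on_relation_ofI) auto
    fix C assume C: "C \<in> Chains (relation_of ?P A)"
    show "\<exists>u\<in>A. \<forall>q\<in>C. ?P q u"
    proof (cases "C = {}")
      case True
      then show ?thesis using p by (auto simp: A_def)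
    next
      case False
      have CA: "C \<subseteq> A" using C by (auto simp: Chains_def relation_of_def)
      have chain: "q \<le> r \<or> r \<le> q" if "q \<in> C" "r \<in> C" for q r
        using C that by (auto simp: Chains_def relation_of_def)
      define u where "u x = (INF q\<in>C. q x)" for x
      have low: "u x \<le> q x" if "q \<in> C" for q x unfolding u_def
      proof (rule cINF_lower[OF _ that])
        have "- p (- x) \<le> q x" if "q \<in> C" for q
        proof -
          have "sublinear q" "q (- x) \<le> p (- x)" using that CA by (auto simp: A_def le_fun_def)
          then show ?thesis using sublinear_minus[of q x] by linarith
        qed
        then show "bdd_below ((\<lambda>q. q x) ` C)" by (rule bdd_belowI2)
      qed
      have "sublinear u" unfolding sublinear_def
      proof (intro conjI allI impI)
        fix x y
        have "u (x + y) - q x \<le> r y" if "q \<in> C" "r \<in> C" for q r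
        proof -
          have "\<exists>s\<in>C. s \<le> q \<and> s \<le> r" using chain that by blast
          then obtain s where s: "s \<in> C" "s x \<le> q x" "s y \<le> r y" by (auto simp: le_fun_def)
          then have "s (x + y) \<le> s x + s y" using CA by (auto simp: A_def sublinear_def)
          then show ?thesis using s low[OF s(1), of "x + y"] by linarith
        qed
        then have "u (x + y) - q x \<le> u y" if "q \<in> C" for q
          unfolding u_def[of y] using that False by (intro cINF_greatest) auto
        then have "u (x + y) - u y \<le> q x" if "q \<in> C" for q using that by (simp add: algebra_simps)
        then have "u (x + y) - u y \<le> u x" unfolding u_def[of x] using False by (intro cINF_greatest) auto
        then show "u (x + y) \<le> u x + u y" by simp
      next
        fix r :: real and x assume r: "r \<ge> 0"
        have le: "u (r *\<^sub>R x) \<le> r * q x" if "q \<in> C" for q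
        proof -
          have "q (r *\<^sub>R x) = r * q x" using CA that r by (intro sublinear_scaleR) (auto simp: A_def)
          then show ?thesis using low[OF that, of "r *\<^sub>R x"] by simp
        qed
        show "u (r *\<^sub>R x) \<le> r * u x"
        proof (cases "r = 0")
          case True
          then show ?thesis using le False by auto
        next
          case nz: False
          then have "u (r *\<^sub>R x) / r \<le> u x" unfolding u_def[of x]
            using False le r by (intro cINF_greatest) (auto simp: field_simps)
          then show ?thesis using r nz by (simp add: field_simps)
        qed
      qed
      moreover have "u \<le> p"
      proof -
        obtain q where "q \<in> C" using False by blast
        then have "u \<le> q" "q \<le> p" using low CA by (auto simp: A_def le_fun_def)
        then show ?thesis by (rule order_trans)
      qed
      ultimately have "u \<in> A" by (simp add: A_def)
      then show ?thesis using low by (intro bexI[of _ u]) (auto simp: le_fun_def)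
    qed
  qed
  then obtain m where m: "sublinear m" "m \<le> p" "\<And>q. sublinear q \<Longrightarrow> q \<le> p \<Longrightarrow> q \<le> m \<Longrightarrow> q = m"
    by (auto simp: A_def)
  have "linear m" by (rule minimal_sublinear_linear[OF m(1)]) (use m(2,3) order_trans in blast)
  then show thesis using that m(2) by blast
qed

text \<open>Lowering the norm towards \<open>y\<close> first makes its value at \<open>- y\<close> equal to \<open>- \<parallel>y\<parallel>\<close>, which forces
  \<open>f y \<ge> \<parallel>y\<parallel>\<close> for every linear \<open>f\<close> below.\<close>

lemma norming_functional:
  fixes y :: "'v::real_normed_vector"
  obtains f :: "'v \<Rightarrow> real" where "linear f" "\<And>x. f x \<le> norm x" "f y = norm y"
proof -
  have n: "sublinear (norm :: 'v \<Rightarrow> real)" by (auto simp: sublinear_def norm_triangle_ineq)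
  obtain f where f: "linear f" "f \<le> lower_towards norm y"
    by (rule linear_below_sublinear[OF sublinear_lower_towards[OF n]])
  have le: "f x \<le> norm x" for x
    using f(2) lower_towards_le[OF n, of 0 y x] by (auto simp: le_fun_def intro: order_trans)
  have "f (- y) \<le> - norm y"
    using f(2) lower_towards_le[OF n, of 1 y "- y"] by (auto simp: le_fun_def intro: order_trans)
  then have "f y = norm y" using le[of y] by (simp add: linear_neg[OF f(1)])
  then show thesis using that f(1) le by blast
qed

section \<open>States\<close>

lemma state_norm_le: "state \<phi> \<Longrightarrow> cmod (\<phi> a) \<le> norm a"
  unfolding state_def using onorm[of \<phi> a] by simp

lemma state_positive:
  assumes "state \<phi>" "positive a"
  shows "Re (\<phi> a) \<ge> 0" "Im (\<phi> a) = 0"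
  using assms by (auto simp: state_def nonneg_Reals_def)

lemma state_cauchy_schwarz:
  assumes \<phi>: "state \<phi>"
  shows "(cmod (\<phi> (star b * a)))\<^sup>2 \<le> Re (\<phi> (star a * a)) * Re (\<phi> (star b * b))"
proof -
  have lin: "linear \<phi>" and sc: "\<And>c a. \<phi> (c *\<^sub>C a) = c * \<phi> a"
    using \<phi> by (auto simp: state_def bounded_linear.linear)
  define A B P Q where "A = \<phi> (star a * a)" and "B = \<phi> (star b * b)"
    and "P = \<phi> (star a * b)" and "Q = \<phi> (star b * a)"
  have expand: "\<phi> (star (a - l *\<^sub>C b) * (a - l *\<^sub>C b)) = A - l * P - cnj l * Q + cnj l * l * B" for l
    by (simp add: star_diff star_scaleC algebra_simps mult_scaleC_left mult_scaleC_right scaleC_scaleC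
        scaleC_diff_right linear_diff[OF lin] linear_add[OF lin] sc A_def B_def P_def Q_def)
  have pos: "Re (A - l * P - cnj l * Q + cnj l * l * B) \<ge> 0"
    "Im (A - l * P - cnj l * Q + cnj l * l * B) = 0" for l
    unfolding expand[symmetric] using state_positive[OF \<phi> positive_star_mult] by auto
  have AB: "Im A = 0" "Im B = 0" "Re B \<ge> 0"
    unfolding A_def B_def using state_positive[OF \<phi> positive_star_mult] by auto
  have "Im P = - Im Q" using pos(2)[of 1] AB by simp
  moreover have "Re P = Re Q" using pos(2)[of \<i>] AB by simp
  ultimately have P: "P = cnj Q" by (simp add: complex_eq_iff)
  have quad: "0 \<le> Re A - 2 * s * (cmod Q)\<^sup>2 + s\<^sup>2 * (cmod Q)\<^sup>2 * Re B" for s :: real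
  proof -
    have "Re (A - (of_real s * Q) * P - cnj (of_real s * Q) * Q + cnj (of_real s * Q) * (of_real s * Q) * B)
      = Re A - 2 * s * (cmod Q)\<^sup>2 + s\<^sup>2 * (cmod Q)\<^sup>2 * Re B"
      unfolding P cmod_power2 using AB by (simp add: power2_eq_square algebra_simps)
    then show ?thesis using pos(1)[of "of_real s * Q"] by simp
  qed
  have "(cmod Q)\<^sup>2 \<le> Re A * Re B"
  proof (cases "Re B = 0")
    case True
    have "(cmod Q)\<^sup>2 = 0"
    proof (rule ccontr)
      assume "(cmod Q)\<^sup>2 \<noteq> 0"
      then have "2 * ((Re A + 1) / (cmod Q)\<^sup>2) * (cmod Q)\<^sup>2 = 2 * (Re A + 1)" by simp
      then show False using quad[of "(Re A + 1) / (cmod Q)\<^sup>2"] True pos(1)[of 0] by simp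
    qed
    then show ?thesis using True by simp
  next
    case False
    then have "Re B > 0" using AB by simp
    then show ?thesis using quad[of "1 / Re B"] by (simp add: field_simps power2_eq_square)
  qed
  then show ?thesis by (simp add: A_def B_def Q_def)
qed

text \<open>Cauchy-Schwarz for \<open>a\<close> and \<open>1\<close>, where an approximate unit of contractions replaces \<open>1\<close>; the
  constant is \<open>1\<close> because \<open>\<phi>\<close> has norm \<open>1\<close>.\<close>

lemma state_square_le:
  assumes \<phi>: "state \<phi>"
  shows "(cmod (\<phi> a))\<^sup>2 \<le> Re (\<phi> (a * star a))"
proof -
  obtain e where e: "\<And>k. star (e k) = e k" "\<And>k. norm (e k) \<le> 1" "(\<lambda>k. a * e k) \<longlonglongrightarrow> a"
    using approximate_unit by blast
  have "(cmod (\<phi> (a * e k)))\<^sup>2 \<le> Re (\<phi> (a * star a))" for k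
  proof -
    have "(cmod (\<phi> (a * e k)))\<^sup>2 \<le> Re (\<phi> (star (e k) * e k)) * Re (\<phi> (a * star a))"
      using state_cauchy_schwarz[OF \<phi>, of "star a" "e k"] by (simp add: star_star)
    also have "Re (\<phi> (star (e k) * e k)) \<le> 1"
      using state_norm_le[OF \<phi>, of "star (e k) * e k"] complex_Re_le_cmod[of "\<phi> (star (e k) * e k)"]
        e(2)[of k] power_le_one[of "norm (e k)" 2] by (simp add: norm_star_mult)
    then have "Re (\<phi> (star (e k) * e k)) * Re (\<phi> (a * star a)) \<le> 1 * Re (\<phi> (a * star a))"
      by (intro mult_right_mono state_positive(1)[OF \<phi> positive_mult_star])
    finally show ?thesis by simp
  qed
  moreover have "(\<lambda>k. (cmod (\<phi> (a * e k)))\<^sup>2) \<longlonglongrightarrow> (cmod (\<phi> a))\<^sup>2"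
    using \<phi> by (intro tendsto_intros bounded_linear.tendsto[OF _ e(3)]) (simp add: state_def)
  ultimately show ?thesis by (intro LIMSEQ_le_const2) auto
qed

text \<open>In the unitization, a functional of norm \<open>1\<close> that attains its norm at \<open>1 + a/\<parallel>a\<parallel>\<close>, whose norm
  is \<open>2\<close>, takes the value \<open>1\<close> at both summands. The value at the unit alone makes it positive on
  positive elements and zero on skew-adjoint ones, so it is the real part of a state.\<close>

lemma norming_state:
  fixes a :: "'a::cstar_algebra"
  assumes a: "positive a" "a \<noteq> 0"
  obtains \<phi> where "state \<phi>" "\<phi> a = of_real (norm a)"
proof -
  define b where "b = (1 / norm a) *\<^sub>R of_alg a"
  have nb: "norm b = 1" using a by (simp add: b_def)
  have b: "sa_square b" unfolding b_def
    using a by (intro sa_square_scaleR) (auto simp: positive_iff_sa_square_of_alg)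
  have "sa_square ((1 + b) - 2 *\<^sub>R b)"
    using sa_square_norm_minus[OF b, of 1] nb by (simp add: scaleR_2)
  then have "norm (2 *\<^sub>R b) \<le> norm (1 + b)"
    using b by (intro sa_square_norm_mono sa_square_scaleR) auto
  then have two: "norm (1 + b) \<ge> 2" using nb by simp
  obtain f :: "'a unitization \<Rightarrow> real" where f: "linear f" "\<And>x. f x \<le> norm x" "f (1 + b) = norm (1 + b)"
    using norming_functional by blast
  have "f 1 + f b \<ge> 2" using two f(3) by (simp add: linear_add[OF f(1)])
  then have f1: "f 1 = 1" and fb: "f b = 1" using f(2)[of 1] f(2)[of b] nb by auto
  have pos: "f x \<ge> 0" if x: "sa_square x" for x
    using f(2)[of "norm x *\<^sub>R 1 - x"] sa_square_norm_bound[OF x order_refl]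
    by (simp add: linear_diff[OF f(1)] linear_scale[OF f(1)] f1)
  have skew_le: "f x \<le> 0" if x: "star x = - x" for x
  proof (rule ccontr)
    assume "\<not> f x \<le> 0"
    define s where "s = (norm x)\<^sup>2 / f x"
    have s0: "s \<ge> 0" using \<open>\<not> f x \<le> 0\<close> by (simp add: s_def)
    have "s + f x = f (s *\<^sub>R 1 + x)" by (simp add: linear_add[OF f(1)] linear_scale[OF f(1)] f1)
    also have "\<dots> \<le> norm (s *\<^sub>R 1 + x)" by (rule f(2))
    finally have "(s + f x)\<^sup>2 \<le> (norm (s *\<^sub>R 1 + x))\<^sup>2"
      using s0 \<open>\<not> f x \<le> 0\<close> by (intro power_mono) auto
    also have "\<dots> = norm (star (s *\<^sub>R 1 + x) * (s *\<^sub>R 1 + x))" by (simp only: norm_star_mult)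
    also have "star (s *\<^sub>R 1 + x) * (s *\<^sub>R 1 + x) = (s * s) *\<^sub>R 1 - x * x"
      by (simp add: star_add x algebra_simps)
    also have "norm ((s * s) *\<^sub>R 1 - x * x) \<le> norm ((s * s) *\<^sub>R (1 :: 'a unitization)) + norm (x * x)"
      by (rule norm_triangle_ineq4)
    also have "\<dots> \<le> s\<^sup>2 + (norm x)\<^sup>2"
      using norm_mult_ineq[of x x] by (simp add: power2_eq_square)
    finally have "2 * (s * f x) + (f x)\<^sup>2 \<le> (norm x)\<^sup>2" by (simp add: power2_sum algebra_simps)
    moreover have "s * f x = (norm x)\<^sup>2" using \<open>\<not> f x \<le> 0\<close> by (simp add: s_def)
    ultimately have "(norm x)\<^sup>2 + (f x)\<^sup>2 \<le> 0" by simp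
    then show False using \<open>\<not> f x \<le> 0\<close> by (smt (verit) zero_le_power2 power2_less_eq_zero_iff zero_less_power2)
  qed
  have skew: "f x = 0" if x: "star x = - x" for x
    using skew_le[of x] skew_le[of "- x"] x by (simp add: linear_neg[OF f(1)])
  define \<phi> where "\<phi> z = Complex (f (of_alg z)) (- f (of_alg (\<i> *\<^sub>C z)))" for z :: 'a
  have emb: "of_alg (c *\<^sub>C z) = Re c *\<^sub>R of_alg z + Im c *\<^sub>R of_alg (\<i> *\<^sub>C z)" for c and z :: 'a
  proof -
    have "c *\<^sub>C z = of_real (Re c) *\<^sub>C z + (of_real (Im c) * \<i>) *\<^sub>C z"
      by (metis complex_eq mult.commute scaleC_add_left)
    then have "c *\<^sub>C z = Re c *\<^sub>R z + Im c *\<^sub>R (\<i> *\<^sub>C z)"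
      by (simp add: scaleC_of_real flip: scaleC_scaleC)
    then show ?thesis by (simp add: of_alg_simps)
  qed
  have sc: "\<phi> (c *\<^sub>C z) = c * \<phi> z" for c z
    using emb[of c z] emb[of "\<i> * c" z]
    by (simp add: \<phi>_def complex_eq_iff linear_add[OF f(1)] linear_diff[OF f(1)] linear_scale[OF f(1)]
        scaleC_scaleC)
  have add: "\<phi> (z + w) = \<phi> z + \<phi> w" for z w
    by (simp add: \<phi>_def complex_eq_iff scaleC_add_right of_alg_simps linear_add[OF f(1)])
  have bound: "cmod (\<phi> z) \<le> norm z" for z
  proof -
    define u where "u = cnj (sgn (\<phi> z))"
    have u: "cmod u \<le> 1" by (simp add: u_def norm_sgn)
    have "cnj (\<phi> z) * \<phi> z = of_real (cmod (\<phi> z)) * of_real (cmod (\<phi> z))"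
      by (metis complex_norm_square mult.commute of_real_mult power2_eq_square)
    then have "u * \<phi> z = of_real (cmod (\<phi> z))" by (simp add: u_def sgn_eq)
    then have "cmod (\<phi> z) = Re (\<phi> (u *\<^sub>C z))" by (simp add: sc)
    also have "\<dots> = f (of_alg (u *\<^sub>C z))" by (simp add: \<phi>_def)
    also have "\<dots> \<le> norm (u *\<^sub>C z)" using f(2)[of "of_alg (u *\<^sub>C z)"] by simp
    also have "\<dots> \<le> norm z" using u by (simp add: norm_scaleC mult_left_le_one_le)
    finally show ?thesis .
  qed
  have bl: "bounded_linear \<phi>"
  proof (rule bounded_linear_intro[where K=1])
    show "\<phi> (r *\<^sub>R z) = r *\<^sub>R \<phi> z" for r z
      using sc[of "of_real r" z] by (simp add: scaleC_of_real scaleR_conv_of_real)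
  qed (auto simp: add bound)
  have \<phi>pos: "\<phi> z = of_real (f (of_alg z)) \<and> f (of_alg z) \<ge> 0" if z: "positive z" for z
  proof -
    have "star (of_alg (\<i> *\<^sub>C z)) = - of_alg (\<i> *\<^sub>C z)"
      by (simp add: star_of_alg star_scaleC positive_self_adjoint[OF z] flip: of_alg_simps)
    then have "f (of_alg (\<i> *\<^sub>C z)) = 0" by (rule skew)
    then show ?thesis using pos z by (simp add: \<phi>_def complex_eq_iff positive_iff_sa_square_of_alg)
  qed
  have "of_alg a = norm a *\<^sub>R b" using a by (simp add: b_def)
  then have \<phi>a: "\<phi> a = of_real (norm a)"
    using \<phi>pos[OF a(1)] fb by (simp add: linear_scale[OF f(1)])
  have "onorm \<phi> = 1"
  proof (rule antisym)
    show "onorm \<phi> \<le> 1" by (rule onorm_bound) (simp_all add: bound)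
    show "1 \<le> onorm \<phi>" using onorm[OF bl, of a] a by (simp add: \<phi>a)
  qed
  then have "state \<phi>" unfolding state_def using bl sc \<phi>pos by (auto simp: nonneg_Reals_of_real_iff)
  then show thesis using that \<phi>a by blast
qed

section \<open>Hilbert modules\<close>

definition frame_sum :: "('n \<Rightarrow> 'n \<Rightarrow> 'a::cstar_algebra) \<Rightarrow> ('i \<Rightarrow> 'n) \<Rightarrow> 'i set \<Rightarrow> 'n \<Rightarrow> 'a" where
  "frame_sum ip f E x = (\<Sum>j\<in>E. ip x (f j) * ip (f j) x)"

context hilbert_module
begin

lemma ip_add_left: "ip (x + y) z = ip x z + ip y z"
  by (metis ip_add_right ip_star star_add)

lemma ip_act_left: "ip (act x a) y = star a * ip x y"
  by (metis ip_act_right ip_star star_mult)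

lemma ip_scaleR_right: "ip x (r *\<^sub>R y) = r *\<^sub>R ip x y"
  by (metis ip_scaleC_right scaleC_of_real)

lemma ip_scaleR_left: "ip (r *\<^sub>R x) y = r *\<^sub>R ip x y"
  by (metis ip_scaleR_right ip_star star_scaleR)

lemma ip_minus_right: "ip x (- y) = - ip x y"
  using ip_scaleR_right[of x "-1" y] by simp

lemma ip_minus_left: "ip (- x) y = - ip x y"
  using ip_scaleR_left[of "-1" x y] by simp

lemma ip_zero_right [simp]: "ip x 0 = 0"
  using ip_scaleR_right[of x 0 0] by simp

lemma ip_zero_left [simp]: "ip 0 x = 0"
  using ip_scaleR_left[of 0 0 x] by simp

lemma ip_diff_right: "ip x (y - z) = ip x y - ip x z"
  using ip_add_right[of x y "- z"] by (simp add: ip_minus_right)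

lemma ip_diff_left: "ip (x - y) z = ip x z - ip y z"
  using ip_add_left[of x "- y" z] by (simp add: ip_minus_left)

lemma ip_sum_right: "ip x (\<Sum>i\<in>I. g i) = (\<Sum>i\<in>I. ip x (g i))"
  by (induction I rule: infinite_finite_induct) (auto simp: ip_add_right)

lemma star_ip: "star (ip x y) = ip y x"
  by (rule ip_star[symmetric])

lemma act_scaleR_right: "act x (r *\<^sub>R a) = r *\<^sub>R act x a"
  by (metis act_scaleC_right scaleC_of_real)

lemma act_scaleR_left: "act (r *\<^sub>R x) a = r *\<^sub>R act x a"
  by (metis act_scaleC_left scaleC_of_real)

lemma act_diff_left: "act (x - y) a = act x a - act y a"
  using act_add_left[of "x - y" y a] by (simp add: eq_diff_eq)

lemma ip_eqI: "(\<And>z. ip z x = ip z y) \<Longrightarrow> x = y"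
  using ip_definite[of "x - y"] by (simp add: ip_diff_right)

lemma norm_square_eq: "(norm x)\<^sup>2 = norm (ip x x)"
  by (simp add: norm_eq_ip)

lemma cauchy_schwarz: "cstar_le (ip y x * ip x y) (norm (ip x x) *\<^sub>R ip y y)"
proof -
  have "cstar_le (star (ip x y) * ip x y) (norm (ip x x) *\<^sub>R ip y y)"
  proof (rule cauchy_schwarz_cstar)
    fix a t
    have "positive (ip (act x a - t *\<^sub>R y) (act x a - t *\<^sub>R y))" by (rule ip_positive)
    also have "ip (act x a - t *\<^sub>R y) (act x a - t *\<^sub>R y)
        = star a * ip x x * a - t *\<^sub>R (star a * ip x y) - t *\<^sub>R (star (ip x y) * a) + t\<^sup>2 *\<^sub>R ip y y"
      by (simp add: ip_diff_left ip_diff_right ip_act_left ip_act_right ip_scaleR_left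
          ip_scaleR_right star_ip power2_eq_square algebra_simps)
    finally show "positive (star a * ip x x * a - t *\<^sub>R (star a * ip x y)
        - t *\<^sub>R (star (ip x y) * a) + t\<^sup>2 *\<^sub>R ip y y)" .
  qed (rule ip_positive)
  then show ?thesis by (simp add: star_ip)
qed

lemma positive_ip_mult: "positive (ip x y * ip y x)"
  using positive_star_mult[of "ip y x"] by (simp add: star_ip)

lemma norm_ip_le: "norm (ip x y) \<le> norm x * norm y"
proof -
  have "(norm (ip x y))\<^sup>2 = norm (star (ip x y) * ip x y)" by (simp add: norm_star_mult)
  also have "\<dots> \<le> norm (norm (ip x x) *\<^sub>R ip y y)"
    using cauchy_schwarz[of y x] by (intro cstar_le_norm_mono) (auto simp: star_ip positive_ip_mult)
  also have "\<dots> = (norm x * norm y)\<^sup>2" by (simp add: power_mult_distrib norm_square_eq)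
  finally show ?thesis by (rule power2_le_imp_le) simp
qed

lemma bounded_bilinear_ip: "bounded_bilinear ip"
  by (rule bounded_bilinear.intro)
     (auto simp: ip_add_left ip_add_right ip_scaleR_left ip_scaleR_right
       intro!: exI[of _ 1] norm_ip_le)

lemma norm_act_le: "norm (act x a) \<le> norm x * norm a"
proof (rule power2_le_imp_le)
  have "(norm (act x a))\<^sup>2 = norm (star a * ip x x * a)"
    by (simp add: norm_square_eq ip_act_left ip_act_right mult.assoc)
  also have "\<dots> \<le> norm (star a) * norm (ip x x) * norm a"
    by (intro order_trans[OF norm_mult_ineq] mult_right_mono norm_mult_ineq) auto
  also have "\<dots> = (norm x * norm a)\<^sup>2"
    by (simp add: power_mult_distrib power2_eq_square flip: norm_square_eq)
  finally show "(norm (act x a))\<^sup>2 \<le> (norm x * norm a)\<^sup>2" .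
qed simp

lemma bounded_linear_act_right: "bounded_linear (act x)"
  by (rule bounded_linear_intro[where K="norm x"])
     (auto simp: act_add_right act_scaleR_right intro: order_trans[OF norm_act_le])

lemma bounded_linear_act_left: "bounded_linear (\<lambda>x. act x a)"
  by (rule bounded_linear_intro[where K="norm a"])
     (auto simp: act_add_left act_scaleR_left norm_act_le)

lemma bounded_module_map_ip: "bounded_module_map act (*) (ip x)"
  unfolding bounded_module_map_def
  by (auto simp: ip_scaleC_right ip_act_right
      intro: bounded_bilinear.bounded_linear_right[OF bounded_bilinear_ip])

lemma positive_frame_sum: "positive (frame_sum ip f E x)"
  unfolding frame_sum_def by (intro positive_sum positive_ip_mult)

lemma frame_sum_mono: "finite K \<Longrightarrow> E \<subseteq> K \<Longrightarrow> cstar_le (frame_sum ip f E x) (frame_sum ip f K x)"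
  unfolding frame_sum_def by (intro cstar_le_sum_mono positive_ip_mult) auto

lemma frame_sum_act: "frame_sum ip f E (act x a) = star a * frame_sum ip f E x * a"
  by (simp add: frame_sum_def ip_act_left ip_act_right sum_distrib_left sum_distrib_right mult.assoc)

lemma norm_frame_sum_add_le:
  "norm (frame_sum ip f E (x + y)) \<le> 2 * (norm (frame_sum ip f E x) + norm (frame_sum ip f E y))"
proof -
  have "cstar_le (ip (x + y) z * ip z (x + y)) (2 *\<^sub>R (ip x z * ip z x + ip y z * ip z y))" for z
  proof -
    have "2 *\<^sub>R (ip x z * ip z x + ip y z * ip z y) - ip (x + y) z * ip z (x + y)
        = ip (x - y) z * ip z (x - y)"
      by (simp add: ip_add_left ip_add_right ip_diff_left ip_diff_right algebra_simps scaleR_2)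
    then show ?thesis by (simp add: cstar_le_def positive_ip_mult)
  qed
  then have "cstar_le (frame_sum ip f E (x + y))
      (\<Sum>j\<in>E. 2 *\<^sub>R (ip x (f j) * ip (f j) x + ip y (f j) * ip (f j) y))"
    unfolding frame_sum_def by (intro cstar_le_sum)
  also have "(\<Sum>j\<in>E. 2 *\<^sub>R (ip x (f j) * ip (f j) x + ip y (f j) * ip (f j) y))
      = 2 *\<^sub>R (frame_sum ip f E x + frame_sum ip f E y)"
    by (simp add: frame_sum_def sum.distrib scaleR_sum_right scaleR_add_right)
  finally have "norm (frame_sum ip f E (x + y)) \<le> norm (2 *\<^sub>R (frame_sum ip f E x + frame_sum ip f E y))"
    by (intro cstar_le_norm_mono positive_frame_sum)
  also have "\<dots> \<le> 2 * (norm (frame_sum ip f E x) + norm (frame_sum ip f E y))"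
    using norm_triangle_ineq[of "frame_sum ip f E x" "frame_sum ip f E y"] by simp
  finally show ?thesis .
qed

lemma frame_sum_minus: "frame_sum ip f E (- x) = frame_sum ip f E x"
  by (simp add: frame_sum_def ip_minus_left ip_minus_right)

text \<open>The finite partial sums of the frame operator.\<close>

definition synthesis :: "('i \<Rightarrow> 'm) \<Rightarrow> 'i set \<Rightarrow> 'm \<Rightarrow> 'm" where
  "synthesis f E x = (\<Sum>j\<in>E. act (f j) (ip (f j) x))"

lemma ip_synthesis: "ip y (synthesis f E x) = (\<Sum>j\<in>E. ip y (f j) * ip (f j) x)"
  by (simp add: synthesis_def ip_sum_right ip_act_right)

lemma ip_synthesis_left: "ip (synthesis f E x) y = (\<Sum>j\<in>E. ip x (f j) * ip (f j) y)"
proof -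
  have "ip (synthesis f E x) y = star (ip y (synthesis f E x))" by (rule ip_star)
  then show ?thesis by (simp add: ip_synthesis star_sum star_mult star_ip)
qed

lemma cauchy_schwarz_synthesis:
  "cstar_le (ip (synthesis f E x) y * ip y (synthesis f E x))
     (norm (frame_sum ip f E y) *\<^sub>R frame_sum ip f E x)"
  using cauchy_schwarz_sum[where u="\<lambda>j. ip (f j) y" and I=E and v="\<lambda>j. ip (f j) x"]
  by (simp add: star_ip star_sum star_mult ip_synthesis ip_synthesis_left frame_sum_def)

text \<open>Cauchy-Schwarz, tested on \<open>y = synthesis f E x\<close> itself.\<close>

lemma norm_synthesis_le:
  assumes "\<And>y. norm (frame_sum ip f E y) \<le> c * (norm y)\<^sup>2"
  shows "(norm (synthesis f E x))\<^sup>2 \<le> c * norm (frame_sum ip f E x)"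
proof (cases "synthesis f E x = 0")
  case True
  have "0 \<le> c * (norm x)\<^sup>2" using assms[of x] norm_ge_zero order_trans by blast
  then show ?thesis using True by (cases "x = 0") (auto simp: frame_sum_def zero_le_mult_iff)
next
  case False
  let ?w = "synthesis f E x"
  have "(norm (ip ?w ?w))\<^sup>2 = norm (ip ?w ?w * ip ?w ?w)"
    by (rule norm_square_self_adjoint[symmetric]) (rule star_ip)
  also have "\<dots> \<le> norm (norm (frame_sum ip f E ?w) *\<^sub>R frame_sum ip f E x)"
    by (intro cstar_le_norm_mono cauchy_schwarz_synthesis positive_ip_mult)
  also have "\<dots> \<le> (c * (norm ?w)\<^sup>2) * norm (frame_sum ip f E x)"
    by (simp add: assms mult_right_mono)
  finally have "(norm ?w)\<^sup>2 * (norm ?w)\<^sup>2 \<le> (c * norm (frame_sum ip f E x)) * (norm ?w)\<^sup>2"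
    by (simp add: power2_eq_square norm_eq_ip mult_ac)
  then show ?thesis by (rule mult_right_le_imp_le) (use False in simp)
qed

end

text \<open>Self-adjoint maps with \<open>0 \<le> T \<le> r\<close>; a map satisfying \<open>\<langle>x, T y\<rangle> = \<langle>T x, y\<rangle>\<close> is automatically linear
  and \<open>A\<close>-linear, and the order bounds make it bounded.\<close>

locale positive_contraction = hilbert_module act ip
  for act :: "'m::{complex_vector, banach} \<Rightarrow> 'a::cstar_algebra \<Rightarrow> 'm"
    and ip :: "'m \<Rightarrow> 'm \<Rightarrow> 'a" +
  fixes T :: "'m \<Rightarrow> 'm" and r :: real
  assumes T_self_adjoint: "ip x (T y) = ip (T x) y"
    and T_positive: "positive (ip x (T x))"
    and T_le: "cstar_le (ip x (T x)) (r *\<^sub>R ip x x)"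
    and r_nonneg: "r \<ge> 0"
begin

lemma T_add: "T (x + y) = T x + T y"
  by (rule ip_eqI) (simp add: T_self_adjoint ip_add_right)

lemma T_diff: "T (x - y) = T x - T y"
  by (rule ip_eqI) (simp add: T_self_adjoint ip_diff_right)

lemma T_scaleC: "T (c *\<^sub>C x) = c *\<^sub>C T x"
  by (rule ip_eqI) (simp add: T_self_adjoint ip_scaleC_right)

lemma T_scaleR: "T (t *\<^sub>R x) = t *\<^sub>R T x"
  by (rule ip_eqI) (simp add: T_self_adjoint ip_scaleR_right)

lemma T_act: "T (act x a) = act (T x) a"
  by (rule ip_eqI) (simp add: T_self_adjoint ip_act_right)

lemma cauchy_schwarz_T: "(norm (ip x (T y)))\<^sup>2 \<le> norm (ip x (T x)) * norm (ip y (T y))"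
proof -
  have "cstar_le (star (ip x (T y)) * ip x (T y)) (norm (ip x (T x)) *\<^sub>R ip y (T y))"
  proof (rule cauchy_schwarz_cstar)
    fix a t
    have "positive (ip (act x a - t *\<^sub>R y) (T (act x a - t *\<^sub>R y)))" by (rule T_positive)
    also have "ip (act x a - t *\<^sub>R y) (T (act x a - t *\<^sub>R y)) = star a * ip x (T x) * a
        - t *\<^sub>R (star a * ip x (T y)) - t *\<^sub>R (star (ip x (T y)) * a) + t\<^sup>2 *\<^sub>R ip y (T y)"
      by (simp add: ip_diff_left ip_diff_right ip_act_left ip_act_right ip_scaleR_left
          ip_scaleR_right star_ip T_diff T_scaleR T_act T_self_adjoint power2_eq_square algebra_simps)
    finally show "positive (star a * ip x (T x) * a - t *\<^sub>R (star a * ip x (T y))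
        - t *\<^sub>R (star (ip x (T y)) * a) + t\<^sup>2 *\<^sub>R ip y (T y))" .
  qed (rule T_positive)
  then have "norm (star (ip x (T y)) * ip x (T y)) \<le> norm (norm (ip x (T x)) *\<^sub>R ip y (T y))"
    by (intro cstar_le_norm_mono) auto
  then show ?thesis by (simp add: norm_star_mult)
qed

lemma norm_ip_T_le: "norm (ip x (T x)) \<le> r * (norm x)\<^sup>2"
  using cstar_le_norm_mono[OF T_positive T_le, of x] r_nonneg by (simp add: norm_square_eq)

text \<open>The bound on the form passes to \<open>T\<close> by Cauchy-Schwarz at the pair \<open>T x\<close>, \<open>x\<close>.\<close>

lemma norm_T_le: "norm (T x) \<le> r * norm x"
proof (rule power2_le_imp_le)
  have "((norm (T x))\<^sup>2)\<^sup>2 = (norm (ip (T x) (T x)))\<^sup>2" by (simp only: norm_square_eq)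
  also have "\<dots> \<le> norm (ip (T x) (T (T x))) * norm (ip x (T x))" by (rule cauchy_schwarz_T)
  also have "\<dots> \<le> (r * (norm (T x))\<^sup>2) * (r * (norm x)\<^sup>2)"
    by (intro mult_mono norm_ip_T_le) (auto simp: r_nonneg)
  finally have "(norm (T x))\<^sup>2 * (norm (T x))\<^sup>2 \<le> (r * norm x)\<^sup>2 * (norm (T x))\<^sup>2"
    by (simp add: power2_eq_square mult_ac)
  moreover have "(norm (T x))\<^sup>2 > 0" if "T x \<noteq> 0" using that by simp
  ultimately show "(norm (T x))\<^sup>2 \<le> (r * norm x)\<^sup>2"
    by (metis mult_right_le_imp_le norm_zero zero_le_power2 zero_power2)
qed (simp add: r_nonneg)

lemma bounded_linear_T: "bounded_linear T"
  by (rule bounded_linear_intro[where K=r]) (auto simp: T_add T_scaleR norm_T_le mult.commute)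

end

section \<open>Uniformly small tails\<close>

definition uniform_tails :: "('n \<Rightarrow> 'n \<Rightarrow> 'a::cstar_algebra) \<Rightarrow> ('i \<Rightarrow> 'n) \<Rightarrow> 'i set \<Rightarrow> 'n set \<Rightarrow> bool" where
  "uniform_tails ip f J Y \<longleftrightarrow> (\<forall>\<epsilon>>0. \<exists>E. finite E \<and> E \<subseteq> J \<and>
     (\<forall>E' y. finite E' \<longrightarrow> E' \<subseteq> J - E \<longrightarrow> y \<in> Y \<longrightarrow> norm (frame_sum ip f E' y) \<le> \<epsilon>))"

lemma uniform_tails_mono: "uniform_tails ip f J Y \<Longrightarrow> Z \<subseteq> Y \<Longrightarrow> uniform_tails ip f J Z"
  unfolding uniform_tails_def by (meson subsetD)

context hilbert_module
begin

lemma uniform_tails_add: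
  assumes Y: "uniform_tails ip f J Y" and Z: "uniform_tails ip f J Z"
  shows "uniform_tails ip f J {y + z | y z. y \<in> Y \<and> z \<in> Z}"
  unfolding uniform_tails_def
proof (intro allI impI)
  fix \<epsilon> :: real assume "\<epsilon> > 0"
  then have "\<epsilon> / 4 > 0" by simp
  obtain E1 where E1: "finite E1" "E1 \<subseteq> J"
    "\<And>E' y. finite E' \<Longrightarrow> E' \<subseteq> J - E1 \<Longrightarrow> y \<in> Y \<Longrightarrow> norm (frame_sum ip f E' y) \<le> \<epsilon>/4"
    using Y \<open>\<epsilon> / 4 > 0\<close> unfolding uniform_tails_def by meson
  obtain E2 where E2: "finite E2" "E2 \<subseteq> J"
    "\<And>E' y. finite E' \<Longrightarrow> E' \<subseteq> J - E2 \<Longrightarrow> y \<in> Z \<Longrightarrow> norm (frame_sum ip f E' y) \<le> \<epsilon>/4"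
    using Z \<open>\<epsilon> / 4 > 0\<close> unfolding uniform_tails_def by meson
  have "norm (frame_sum ip f E' (y + z)) \<le> \<epsilon>"
    if "finite E'" "E' \<subseteq> J - (E1 \<union> E2)" "y \<in> Y" "z \<in> Z" for E' y z
  proof -
    have "norm (frame_sum ip f E' y) \<le> \<epsilon>/4" using that by (intro E1(3)) auto
    moreover have "norm (frame_sum ip f E' z) \<le> \<epsilon>/4" using that by (intro E2(3)) auto
    ultimately show ?thesis using norm_frame_sum_add_le[of f E' y z] by simp
  qed
  then show "\<exists>E. finite E \<and> E \<subseteq> J \<and> (\<forall>E' y. finite E' \<longrightarrow> E' \<subseteq> J - E \<longrightarrow>
      y \<in> {y + z | y z. y \<in> Y \<and> z \<in> Z} \<longrightarrow> norm (frame_sum ip f E' y) \<le> \<epsilon>)"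
    using E1(1,2) E2(1,2) by (intro exI[of _ "E1 \<union> E2"]) auto
qed

lemma uniform_tails_act:
  assumes x: "uniform_tails ip f J {x}"
  shows "uniform_tails ip f J {act x a | a. norm a \<le> R}"
  unfolding uniform_tails_def
proof (intro allI impI)
  fix \<epsilon> :: real assume "\<epsilon> > 0"
  moreover have pos: "R\<^sup>2 + 1 > 0" by (simp add: add_nonneg_pos)
  ultimately have "\<epsilon> / (R\<^sup>2 + 1) > 0" by simp
  then obtain E where E: "finite E" "E \<subseteq> J"
    "\<And>E'. finite E' \<Longrightarrow> E' \<subseteq> J - E \<Longrightarrow> norm (frame_sum ip f E' x) \<le> \<epsilon> / (R\<^sup>2 + 1)"
    using x unfolding uniform_tails_def by (metis singletonI)
  have "norm (frame_sum ip f E' (act x a)) \<le> \<epsilon>"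
    if "finite E'" "E' \<subseteq> J - E" "norm a \<le> R" for E' a
  proof -
    have "norm (frame_sum ip f E' (act x a)) \<le> norm (star a) * norm (frame_sum ip f E' x) * norm a"
      unfolding frame_sum_act
      by (intro order_trans[OF norm_mult_ineq] mult_right_mono norm_mult_ineq) auto
    also have "\<dots> = (norm a)\<^sup>2 * norm (frame_sum ip f E' x)" by (simp add: power2_eq_square)
    also have "\<dots> \<le> (R\<^sup>2 + 1) * (\<epsilon> / (R\<^sup>2 + 1))"
    proof (intro mult_mono E(3) that)
      show "(norm a)\<^sup>2 \<le> R\<^sup>2 + 1" using power_mono[OF that(3), of 2] by simp
    qed (use pos in auto)
    also have "\<dots> = \<epsilon>" using pos by simp
    finally show ?thesis .
  qed
  then show "\<exists>E. finite E \<and> E \<subseteq> J \<and> (\<forall>E' y. finite E' \<longrightarrow> E' \<subseteq> J - E \<longrightarrow>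
      y \<in> {act x a | a. norm a \<le> R} \<longrightarrow> norm (frame_sum ip f E' y) \<le> \<epsilon>)"
    using E(1,2) by (intro exI[of _ E]) auto
qed

lemma uniform_tails_finite_combinations:
  fixes x :: "nat \<Rightarrow> 'm"
  assumes "\<And>y. uniform_tails ip f J {y}"
  shows "uniform_tails ip f J {\<Sum>i<k. act (x i) (a i) | a. \<forall>i<k. norm (a i) \<le> R}"
proof (induction k)
  case 0
  have "{\<Sum>i<0. act (x i) (a i) | a. \<forall>i<0. norm (a i) \<le> R} = {0}" by auto
  then show ?case using assms[of 0] by metis
next
  case (Suc k)
  have "{\<Sum>i<Suc k. act (x i) (a i) | a. \<forall>i<Suc k. norm (a i) \<le> R}
    \<subseteq> {y + z | y z. y \<in> {\<Sum>i<k. act (x i) (a i) | a. \<forall>i<k. norm (a i) \<le> R} \<and>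
                z \<in> {act (x k) a | a. norm a \<le> R}}"
    by force
  then show ?case
    by (rule uniform_tails_mono[OF uniform_tails_add[OF Suc uniform_tails_act[OF assms]], rotated])
qed

lemma uniform_tails_approx:
  assumes bessel: "\<And>E x. finite E \<Longrightarrow> E \<subseteq> J \<Longrightarrow> norm (frame_sum ip f E x) \<le> c * (norm x)\<^sup>2" and c: "c \<ge> 0"
    and approx: "\<And>\<delta>. \<delta> > 0 \<Longrightarrow> \<exists>Z. uniform_tails ip f J Z \<and> (\<forall>y\<in>Y. \<exists>z\<in>Z. norm (y - z) \<le> \<delta>)"
  shows "uniform_tails ip f J Y"
  unfolding uniform_tails_def
proof (intro allI impI)
  fix \<epsilon> :: real assume \<epsilon>: "\<epsilon> > 0"
  define \<delta> where "\<delta> = sqrt (\<epsilon> / (4 * (c + 1)))"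
  have \<delta>: "\<delta> > 0" using \<epsilon> c by (simp add: \<delta>_def)
  have \<delta>2: "c * \<delta>\<^sup>2 \<le> \<epsilon> / 4" using \<epsilon> c by (simp add: \<delta>_def field_simps)
  obtain Z where Z: "uniform_tails ip f J Z" "\<And>y. y \<in> Y \<Longrightarrow> \<exists>z\<in>Z. norm (y - z) \<le> \<delta>"
    using approx[OF \<delta>] by blast
  obtain E where E: "finite E" "E \<subseteq> J"
    "\<And>E' z. finite E' \<Longrightarrow> E' \<subseteq> J - E \<Longrightarrow> z \<in> Z \<Longrightarrow> norm (frame_sum ip f E' z) \<le> \<epsilon> / 4"
    using Z(1) \<epsilon> unfolding uniform_tails_def by (metis zero_less_divide_iff zero_less_numeral)
  have "norm (frame_sum ip f E' y) \<le> \<epsilon>" if E': "finite E'" "E' \<subseteq> J - E" "y \<in> Y" for E' y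
  proof -
    obtain z where z: "z \<in> Z" "norm (y - z) \<le> \<delta>" using Z(2) E'(3) by blast
    have "norm (frame_sum ip f E' (z + (y - z)))
        \<le> 2 * (norm (frame_sum ip f E' z) + norm (frame_sum ip f E' (y - z)))"
      by (rule norm_frame_sum_add_le)
    moreover have "norm (frame_sum ip f E' z) \<le> \<epsilon> / 4" using E' z by (intro E(3)) auto
    moreover have "norm (frame_sum ip f E' (y - z)) \<le> c * (norm (y - z))\<^sup>2"
      using E' by (intro bessel) auto
    moreover have "c * (norm (y - z))\<^sup>2 \<le> c * \<delta>\<^sup>2"
      using z c by (intro mult_left_mono power_mono) auto
    ultimately show ?thesis using \<delta>2 by simp
  qed
  then show "\<exists>E. finite E \<and> E \<subseteq> J \<and> (\<forall>E' y. finite E' \<longrightarrow> E' \<subseteq> J - E \<longrightarrow> y \<in> Y \<longrightarrow>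
      norm (frame_sum ip f E' y) \<le> \<epsilon>)"
    using E(1,2) by blast
qed

lemma frame_sum_le_of_admissible:
  assumes X: "admissible ip X" and E: "finite E"
  shows "cstar_le (frame_sum ip X E x) (ip x x)"
proof -
  have s: "summable (\<lambda>i. ip x (X i) * ip (X i) x)"
    and le: "cstar_le (\<Sum>i. ip x (X i) * ip (X i) x) (ip x x)"
    using X by (auto simp: admissible_def)
  obtain L where L: "E \<subseteq> {..<L}" using E finite_nat_bounded by blast
  have "cstar_le (frame_sum ip X E x) (\<Sum>i. ip x (X i) * ip (X i) x)"
  proof (rule cstar_le_tendsto[OF tendsto_const summable_LIMSEQ[OF s]])
    show "\<forall>\<^sub>F n in sequentially. cstar_le (frame_sum ip X E x) (\<Sum>i<n. ip x (X i) * ip (X i) x)"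
    proof (rule eventually_sequentiallyI)
      fix n assume "L \<le> n"
      then show "cstar_le (frame_sum ip X E x) (\<Sum>i<n. ip x (X i) * ip (X i) x)"
        using L frame_sum_mono[of "{..<n}" E X x] by (force simp: frame_sum_def)
    qed
  qed simp
  from this le show ?thesis by (rule cstar_le_trans)
qed

lemma norm_frame_sum_le_of_admissible:
  "admissible ip X \<Longrightarrow> finite E \<Longrightarrow> norm (frame_sum ip X E x) \<le> (norm x)\<^sup>2"
  unfolding norm_square_eq
  by (intro cstar_le_norm_mono positive_frame_sum frame_sum_le_of_admissible)

lemma uniform_tails_single_of_admissible:
  assumes X: "admissible ip X"
  shows "uniform_tails ip X UNIV {x}"
  unfolding uniform_tails_def
proof (intro allI impI)
  fix \<epsilon> :: real assume "\<epsilon> > 0"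
  moreover have "summable (\<lambda>i. ip x (X i) * ip (X i) x)" using X by (auto simp: admissible_def)
  ultimately obtain L where L: "\<And>m n. m \<ge> L \<Longrightarrow> norm (\<Sum>i=m..<n. ip x (X i) * ip (X i) x) < \<epsilon>"
    unfolding summable_Cauchy by blast
  have "norm (frame_sum ip X E' x) \<le> \<epsilon>" if E': "finite E'" "E' \<subseteq> UNIV - {..<L}" for E'
  proof -
    obtain n where "E' \<subseteq> {..<n}" using E' finite_nat_bounded by blast
    then have "E' \<subseteq> {..<n} - {..<L}" using E' by blast
    also have "\<dots> \<subseteq> {L..<n}" by auto
    finally have "norm (frame_sum ip X E' x) \<le> norm (frame_sum ip X {L..<n} x)"
      by (intro cstar_le_norm_mono positive_frame_sum frame_sum_mono) auto
    then show ?thesis using L[of L n] by (simp add: frame_sum_def)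
  qed
  then show "\<exists>E. finite E \<and> E \<subseteq> UNIV \<and> (\<forall>E' y. finite E' \<longrightarrow> E' \<subseteq> UNIV - E \<longrightarrow> y \<in> {x} \<longrightarrow>
      norm (frame_sum ip X E' y) \<le> \<epsilon>)"
    by (intro exI[of _ "{..<L}"]) auto
qed

lemma state_frame_sum_le:
  assumes "state \<phi>"
  shows "(\<Sum>i\<in>E. (cmod (\<phi> (ip x (X i))))\<^sup>2) \<le> norm (frame_sum ip X E x)"
proof -
  have "(\<Sum>i\<in>E. (cmod (\<phi> (ip x (X i))))\<^sup>2) \<le> (\<Sum>i\<in>E. Re (\<phi> (ip x (X i) * ip (X i) x)))"
    using state_square_le[OF assms] by (intro sum_mono) (metis star_ip)
  also have "\<dots> = Re (\<phi> (frame_sum ip X E x))"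
    using assms by (simp add: state_def frame_sum_def linear_sum[OF bounded_linear.linear])
  also have "\<dots> \<le> norm (frame_sum ip X E x)"
    using state_norm_le[OF assms] complex_Re_le_cmod order_trans by blast
  finally show ?thesis .
qed

lemma frame_dist_leI:
  assumes X: "admissible ip X" and \<phi>: "\<And>k. state (\<phi> k)"
    and le: "\<And>k n. (\<Sum>i=k..<k+n. (cmod (\<phi> k (ip (x - y) (X i))))\<^sup>2) \<le> d"
  shows "frame_dist ip X \<phi> x y \<le> sqrt d"
  unfolding frame_dist_def
proof (intro real_sqrt_le_mono cSUP_least)
  fix k
  have partial: "(\<Sum>i<n. (cmod (\<phi> k (ip (x - y) (X (k + i)))))\<^sup>2) \<le> d" for n
    using le[of k n] sum.shift_bounds_nat_ivl[of "\<lambda>i. (cmod (\<phi> k (ip (x - y) (X i))))\<^sup>2" 0 k n]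
    by (simp add: add.commute atLeast0LessThan)
  show "(\<Sum>i. (cmod (\<phi> k (ip (x - y) (X (k + i)))))\<^sup>2) \<le> d"
    by (rule suminf_le_const[OF summableI_nonneg_bounded[OF _ partial] partial]) simp
qed simp

lemma frame_dist_ge:
  assumes X: "admissible ip X" and \<phi>: "\<And>k. state (\<phi> k)"
  shows "cmod (\<phi> k (ip (x - y) (X k))) \<le> frame_dist ip X \<phi> x y"
proof -
  let ?g = "\<lambda>k i. (cmod (\<phi> k (ip (x - y) (X (k + i)))))\<^sup>2"
  have partial: "(\<Sum>i<n. ?g k i) \<le> (norm (x - y))\<^sup>2" for k n
  proof -
    have "(\<Sum>i<n. ?g k i) = (\<Sum>i=k..<k+n. (cmod (\<phi> k (ip (x - y) (X i))))\<^sup>2)"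
      using sum.shift_bounds_nat_ivl[of "\<lambda>i. (cmod (\<phi> k (ip (x - y) (X i))))\<^sup>2" 0 k n]
      by (simp add: add.commute atLeast0LessThan)
    also have "\<dots> \<le> norm (frame_sum ip X {k..<k+n} (x - y))" by (rule state_frame_sum_le[OF \<phi>])
    also have "\<dots> \<le> (norm (x - y))\<^sup>2" by (rule norm_frame_sum_le_of_admissible[OF X]) simp
    finally show ?thesis .
  qed
  have summable: "summable (?g k)" for k by (rule summableI_nonneg_bounded[OF _ partial]) simp
  have "?g k 0 \<le> (\<Sum>i. ?g k i)"
    using sum_le_suminf[OF summable[of k], of "{0}"] by simp
  also have "\<dots> \<le> (SUP k. \<Sum>i. ?g k i)"
    by (rule cSUP_upper) (auto intro!: bdd_aboveI2 suminf_le_const[OF summable partial])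
  finally show ?thesis unfolding frame_dist_def by (simp add: real_le_rsqrt)
qed

end

text \<open>Finitely many bounded functions are simultaneously almost constant on each of finitely many
  pieces: the pieces are the fibres of rounding all values to a grid.\<close>

lemma finite_net_of_bounded_functions:
  fixes \<psi> :: "'i \<Rightarrow> 'y \<Rightarrow> complex"
  assumes I: "finite I" and bound: "\<And>i y. i \<in> I \<Longrightarrow> y \<in> Y \<Longrightarrow> cmod (\<psi> i y) \<le> R" and \<eta>: "\<eta> > 0"
  obtains T where "finite T" "T \<subseteq> Y" "\<And>y. y \<in> Y \<Longrightarrow> \<exists>t\<in>T. \<forall>i\<in>I. cmod (\<psi> i t - \<psi> i y) \<le> \<eta>"
proof -
  define grid where "grid r = \<lfloor>2 * r / \<eta>\<rfloor>" for r :: real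
  define code where "code y = (\<lambda>i\<in>I. (grid (Re (\<psi> i y)), grid (Im (\<psi> i y))))" for y
  have grid_box: "grid r \<in> {grid (- R)..grid R}" if "\<bar>r\<bar> \<le> R" for r
  proof -
    have "2 * (- R) / \<eta> \<le> 2 * r / \<eta>" "2 * r / \<eta> \<le> 2 * R / \<eta>"
      by (intro divide_right_mono; use that \<eta> in linarith)+
    then show ?thesis unfolding grid_def atLeastAtMost_iff by (intro conjI floor_mono)
  qed
  have "code ` Y \<subseteq> (\<Pi>\<^sub>E i\<in>I. {grid (- R)..grid R} \<times> {grid (- R)..grid R})"
  proof (intro image_subsetI)
    fix y assume "y \<in> Y"
    then have "\<bar>Re (\<psi> i y)\<bar> \<le> R" "\<bar>Im (\<psi> i y)\<bar> \<le> R" if "i \<in> I" for i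
      using bound[OF that] abs_Re_le_cmod[of "\<psi> i y"] abs_Im_le_cmod[of "\<psi> i y"] by (meson order_trans)+
    then show "code y \<in> (\<Pi>\<^sub>E i\<in>I. {grid (- R)..grid R} \<times> {grid (- R)..grid R})"
      unfolding code_def restrict_PiE_iff using grid_box by blast
  qed
  then have "finite (code ` Y)" by (rule finite_subset) (simp add: finite_PiE I)
  then obtain T where T: "T \<subseteq> Y" "finite T" "code ` Y = code ` T"
    using finite_subset_image[of "code ` Y" code Y] by auto
  have close: "\<bar>r - s\<bar> \<le> \<eta> / 2" if "grid r = grid s" for r s
  proof -
    have "2 * r / \<eta> - 2 * s / \<eta> \<le> 1" "2 * s / \<eta> - 2 * r / \<eta> \<le> 1"
      using that unfolding grid_def by linarith+
    then show ?thesis using \<eta> unfolding abs_le_iff by (simp add: field_simps)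
  qed
  have "\<exists>t\<in>T. \<forall>i\<in>I. cmod (\<psi> i t - \<psi> i y) \<le> \<eta>" if "y \<in> Y" for y
  proof -
    have "code y \<in> code ` T" using that T(3) by blast
    then obtain t where t: "t \<in> T" "code t = code y" by force
    have "cmod (\<psi> i t - \<psi> i y) \<le> \<eta>" if "i \<in> I" for i
    proof -
      have "grid (Re (\<psi> i t)) = grid (Re (\<psi> i y))" "grid (Im (\<psi> i t)) = grid (Im (\<psi> i y))"
        using fun_cong[OF t(2), of i] that by (auto simp: code_def)
      then show ?thesis
        using cmod_le[of "\<psi> i t - \<psi> i y"] close[of "Re (\<psi> i t)" "Re (\<psi> i y)"]
          close[of "Im (\<psi> i t)" "Im (\<psi> i y)"] by simp
    qed
    then show ?thesis using t(1) by blast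
  qed
  then show thesis using that T by blast
qed

section \<open>Compact operators map the ball to a totally bounded set\<close>

text \<open>Beyond an index \<open>L\<close> the tails are small uniformly on \<open>Y\<close>, whatever the states. Since the sum
  in \<open>frame_dist\<close> starts at \<open>k\<close>, only the first \<open>L\<close> states meet the remaining terms, and these are
  finitely many bounded functions.\<close>

lemma (in hilbert_module) uniform_tails_imp_finite_net:
  assumes X: "admissible ip X" and \<phi>: "\<And>k. state (\<phi> k)"
    and tails: "uniform_tails ip X UNIV Y" and bounded: "\<And>y. y \<in> Y \<Longrightarrow> norm y \<le> R" and \<epsilon>: "\<epsilon> > 0"
  shows "\<exists>T. finite T \<and> T \<subseteq> Y \<and> Y \<subseteq> (\<Union>t\<in>T. {y \<in> Y. frame_dist ip X \<phi> t y < \<epsilon>})"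
proof -
  have "\<epsilon>\<^sup>2 / 16 > 0" using \<epsilon> by simp
  then obtain E where E: "finite E"
    "\<And>E' y. finite E' \<Longrightarrow> E' \<subseteq> UNIV - E \<Longrightarrow> y \<in> Y \<Longrightarrow> norm (frame_sum ip X E' y) \<le> \<epsilon>\<^sup>2 / 16"
    using tails unfolding uniform_tails_def by meson
  obtain L where L: "E \<subseteq> {..<L}" using E(1) finite_nat_bounded by blast
  define \<eta> where "\<eta> = \<epsilon> / (2 * sqrt (real L + 1))"
  have \<eta>: "\<eta> > 0" using \<epsilon> by (simp add: \<eta>_def add_nonneg_pos)
  have \<eta>2: "real L * \<eta>\<^sup>2 \<le> \<epsilon>\<^sup>2 / 4"
    by (simp add: \<eta>_def power_divide power_mult_distrib add_nonneg_pos field_simps)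
  have bnd: "cmod (\<phi> k (ip y (X i))) \<le> R" if "y \<in> Y" for k i y
  proof -
    have "cmod (\<phi> k (ip y (X i))) \<le> norm y * norm (X i)"
      using state_norm_le[OF \<phi>] norm_ip_le order_trans by blast
    also have "\<dots> \<le> norm y * 1" using X by (intro mult_left_mono) (auto simp: admissible_def)
    finally show ?thesis using bounded[OF that] by simp
  qed
  obtain T where T: "finite T" "T \<subseteq> Y" "\<And>y. y \<in> Y \<Longrightarrow>
      \<exists>t\<in>T. \<forall>(k, i)\<in>{..<L} \<times> {..<L}. cmod (\<phi> k (ip t (X i)) - \<phi> k (ip y (X i))) \<le> \<eta>"
    by (rule finite_net_of_bounded_functions[of "{..<L} \<times> {..<L}" Y "\<lambda>(k, i) y. \<phi> k (ip y (X i))" R \<eta>])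
       (use bnd \<eta> in \<open>auto simp: case_prod_beta\<close>)
  have "\<exists>t\<in>T. frame_dist ip X \<phi> t y < \<epsilon>" if y: "y \<in> Y" for y
  proof -
    obtain t where t: "t \<in> T"
      "\<And>k i. k < L \<Longrightarrow> i < L \<Longrightarrow> cmod (\<phi> k (ip t (X i)) - \<phi> k (ip y (X i))) \<le> \<eta>"
      using T(3)[OF y] by auto
    have "frame_dist ip X \<phi> t y \<le> sqrt (\<epsilon>\<^sup>2 / 2)"
    proof (rule frame_dist_leI[OF X \<phi>])
      fix k n
      let ?g = "\<lambda>i. (cmod (\<phi> k (ip (t - y) (X i))))\<^sup>2"
      let ?H = "{k..<k+n} \<inter> {..<L}" and ?K = "{k..<k+n} - {..<L}"
      have "(\<Sum>i\<in>?H. ?g i) \<le> (\<Sum>i\<in>?H. \<eta>\<^sup>2)"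
      proof (intro sum_mono power_mono)
        fix i assume i: "i \<in> ?H"
        have "\<phi> k (ip (t - y) (X i)) = \<phi> k (ip t (X i)) - \<phi> k (ip y (X i))"
          using \<phi>[of k] by (simp add: ip_diff_left state_def linear_diff[OF bounded_linear.linear])
        then show "cmod (\<phi> k (ip (t - y) (X i))) \<le> \<eta>" using t(2)[of k i] i by simp
      qed simp
      also have "\<dots> \<le> real L * \<eta>\<^sup>2"
        using card_mono[of "{..<L}" ?H] by (simp add: mult_right_mono)
      finally have head: "(\<Sum>i\<in>?H. ?g i) \<le> \<epsilon>\<^sup>2 / 4" using \<eta>2 by linarith
      have K: "finite ?K" "?K \<subseteq> UNIV - E" using L by auto
      have "(\<Sum>i\<in>?K. ?g i) \<le> norm (frame_sum ip X ?K (t + - y))"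
        using state_frame_sum_le[OF \<phi>, of k "t - y" X ?K] by simp
      also have "\<dots> \<le> 2 * (norm (frame_sum ip X ?K t) + norm (frame_sum ip X ?K (- y)))"
        by (rule norm_frame_sum_add_le)
      also have "\<dots> \<le> \<epsilon>\<^sup>2 / 4"
        using E(2)[OF K, of t] E(2)[OF K y] t(1) T(2) by (auto simp: frame_sum_minus)
      finally have "(\<Sum>i\<in>?K. ?g i) \<le> \<epsilon>\<^sup>2 / 4" .
      moreover have "(\<Sum>i=k..<k+n. ?g i) = (\<Sum>i\<in>?H. ?g i) + (\<Sum>i\<in>?K. ?g i)"
        by (rule sum.Int_Diff) simp
      ultimately show "(\<Sum>i=k..<k+n. ?g i) \<le> \<epsilon>\<^sup>2 / 2" using head by simp
    qed
    also have "\<dots> < \<epsilon>" using \<epsilon> by (simp add: real_sqrt_divide real_less_rsqrt divide_less_eq)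
    finally show ?thesis using t(1) by blast
  qed
  then show ?thesis using T(1,2) by (intro exI[of _ T]) auto
qed

text \<open>Approximating \<open>F\<close> by \<open>\<Sum> c i (theta (x i) (f i))\<close> approximates the image of the ball by elements
  \<open>\<Sum> x i \<cdot> a i\<close> with bounded coefficients, whose tails are controlled by those of the \<open>x i\<close>.\<close>

lemma compact_imp_NN_totally_bounded:
  fixes F :: "'m::{complex_vector, banach} \<Rightarrow>\<^sub>L 'n::{complex_vector, banach}"
    and actN :: "'n \<Rightarrow> 'a::cstar_algebra \<Rightarrow> 'n"
  assumes N: "hilbert_module actN ipN"
    and F: "F \<in> closure (theta_span actN (module_dual actM))"
  shows "NN_totally_bounded ipN (blinfun_apply F ` cball 0 1)"
  unfolding NN_totally_bounded_def
proof (intro allI impI)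
  interpret N: hilbert_module actN ipN by (rule N)
  fix X and \<phi> :: "nat \<Rightarrow> 'a \<Rightarrow> complex" and \<epsilon> :: real
  assume X: "admissible ipN X" and \<phi>: "\<forall>k. state (\<phi> k)" and \<epsilon>: "\<epsilon> > 0"
  let ?Y = "blinfun_apply F ` cball 0 1"
  have "uniform_tails ipN X UNIV ?Y"
  proof (rule N.uniform_tails_approx)
    show "norm (frame_sum ipN X E x) \<le> 1 * (norm x)\<^sup>2" if "finite E" for E x
      using N.norm_frame_sum_le_of_admissible[OF X that] by simp
    fix \<delta> :: real assume "\<delta> > 0"
    then obtain G where G: "G \<in> theta_span actN (module_dual actM)" "dist G F < \<delta>"
      using F by (auto simp: closure_approachable)
    then obtain k c x f where f: "\<And>i. i < (k::nat) \<Longrightarrow> f i \<in> module_dual actM"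
      and G_eq: "\<And>z. blinfun_apply G z = (\<Sum>i<k. c i *\<^sub>C theta actN (x i) (f i) z)"
      by (auto simp: theta_span_def)
    have bl: "bounded_linear (f i)" if "i < k" for i
      using f[OF that] by (simp add: module_dual_def bounded_module_map_def)
    define R where "R = (\<Sum>i<k. cmod (c i) * onorm (f i))"
    let ?Z = "{\<Sum>i<k. actN (x i) (a i) | a. \<forall>i<k. norm (a i) \<le> R}"
    have "\<exists>y\<in>?Z. norm (blinfun_apply F z - y) \<le> \<delta>" if z: "z \<in> cball 0 1" for z
    proof
      have "norm (c i *\<^sub>C f i z) \<le> R" if i: "i < k" for i
      proof -
        have "norm (c i *\<^sub>C f i z) \<le> cmod (c i) * (onorm (f i) * norm z)"
          by (auto simp: norm_scaleC intro!: mult_left_mono onorm bl i)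
        also have "\<dots> \<le> cmod (c i) * (onorm (f i) * 1)"
          using z onorm_pos_le[OF bl[OF i]] by (intro mult_left_mono) auto
        also have "\<dots> \<le> R" unfolding R_def
          using i onorm_pos_le[OF bl] by (intro order_trans[OF _ member_le_sum[of i]]) auto
        finally show ?thesis .
      qed
      then show "blinfun_apply G z \<in> ?Z"
        unfolding G_eq theta_def N.act_scaleC_right[symmetric]
        by (intro CollectI exI[of _ "\<lambda>i. c i *\<^sub>C f i z"]) simp
      have "norm (blinfun_apply (F - G) z) \<le> norm (F - G) * norm z" by (rule norm_blinfun)
      also have "\<dots> \<le> norm (F - G) * 1" using z by (intro mult_left_mono) auto
      finally show "norm (blinfun_apply F z - blinfun_apply G z) \<le> \<delta>"
        using G(2) by (simp add: blinfun.diff_left dist_norm norm_minus_commute)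
    qed
    then show "\<exists>Z. uniform_tails ipN X UNIV Z \<and> (\<forall>y\<in>?Y. \<exists>z\<in>Z. norm (y - z) \<le> \<delta>)"
      using N.uniform_tails_finite_combinations[OF N.uniform_tails_single_of_admissible[OF X]]
      by (intro exI[of _ ?Z]) blast
  qed simp
  moreover have "norm y \<le> norm F" if "y \<in> ?Y" for y
  proof -
    obtain z where "norm z \<le> 1" "y = blinfun_apply F z" using \<open>y \<in> ?Y\<close> by auto
    then show ?thesis using norm_blinfun[of F z] mult_left_mono[of "norm z" 1 "norm F"] by simp
  qed
  ultimately show "\<exists>T. finite T \<and> T \<subseteq> ?Y \<and> ?Y \<subseteq> (\<Union>t\<in>T. {y \<in> ?Y. frame_dist ipN X \<phi> t y < \<epsilon>})"
    using \<phi> by (intro N.uniform_tails_imp_finite_net[OF X _ _ _ \<epsilon>]) auto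
qed

section \<open>Total boundedness forces uniformly small tails\<close>

lemma summable_on_CauchyI:
  fixes f :: "'i \<Rightarrow> 'b::banach"
  assumes "\<And>\<epsilon>. \<epsilon> > 0 \<Longrightarrow> \<exists>E. finite E \<and> E \<subseteq> J \<and> (\<forall>E'. finite E' \<longrightarrow> E' \<subseteq> J - E \<longrightarrow> norm (sum f E') \<le> \<epsilon>)"
  shows "f summable_on J"
proof -
  have "\<exists>P. eventually P (finite_subsets_at_top J) \<and> (\<forall>F F'. P F \<and> P F' \<longrightarrow> dist (sum f F) (sum f F') < e)"
    if "e > 0" for e
  proof -
    have "e / 3 > 0" using that by simp
    then obtain E where E: "finite E" "E \<subseteq> J"
      "\<And>E'. finite E' \<Longrightarrow> E' \<subseteq> J - E \<Longrightarrow> norm (sum f E') \<le> e / 3"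
      using assms by meson
    define P where "P F \<longleftrightarrow> finite F \<and> E \<subseteq> F \<and> F \<subseteq> J" for F
    have "eventually P (finite_subsets_at_top J)"
      unfolding eventually_finite_subsets_at_top P_def using E(1,2) by blast
    moreover have "dist (sum f F) (sum f F') < e" if "P F" "P F'" for F F'
    proof -
      have close: "norm (sum f G - sum f E) \<le> e / 3" if "P G" for G
        using E(3)[of "G - E"] that by (auto simp: P_def sum_diff)
      have "norm ((sum f F - sum f E) - (sum f F' - sum f E)) \<le> e / 3 + e / 3"
        by (rule norm_triangle_le_diff) (intro add_mono close that)
      then show ?thesis using \<open>e > 0\<close> by (simp add: dist_norm)
    qed
    ultimately show ?thesis by blast
  qed
  then have "cauchy_filter (filtermap (sum f) (finite_subsets_at_top J))"
    by (simp add: cauchy_filter_metric_filtermap)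
  moreover have "complete (UNIV::'b set)"
    by (meson Cauchy_convergent UNIV_I complete_def convergent_def)
  ultimately obtain s where "(sum f \<longlongrightarrow> s) (finite_subsets_at_top J)"
    using cauchy_filter_complete_converges[of "filtermap (sum f) (finite_subsets_at_top J)" UNIV]
    by (auto simp: filterlim_def filtermap_bot_iff)
  then show ?thesis by (auto simp: summable_on_def has_sum_def)
qed

lemma summable_on_tails:
  fixes f :: "'i \<Rightarrow> 'b::real_normed_vector"
  assumes "f summable_on J" "\<epsilon> > 0"
  obtains E where "finite E" "E \<subseteq> J" "\<And>E'. finite E' \<Longrightarrow> E' \<subseteq> J - E \<Longrightarrow> norm (sum f E') \<le> \<epsilon>"
proof -
  obtain s where "(sum f \<longlongrightarrow> s) (finite_subsets_at_top J)"
    using assms(1) by (auto simp: summable_on_def has_sum_def)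
  moreover have "\<epsilon> / 2 > 0" using assms(2) by simp
  ultimately have "\<forall>\<^sub>F F in finite_subsets_at_top J. dist (sum f F) s < \<epsilon> / 2" by (rule tendstoD)
  then have "\<exists>E. finite E \<and> E \<subseteq> J \<and> (\<forall>F. finite F \<and> E \<subseteq> F \<and> F \<subseteq> J \<longrightarrow> dist (sum f F) s < \<epsilon> / 2)"
    by (simp only: eventually_finite_subsets_at_top)
  then obtain E where E: "finite E" "E \<subseteq> J"
    "\<And>F. finite F \<Longrightarrow> E \<subseteq> F \<Longrightarrow> F \<subseteq> J \<Longrightarrow> dist (sum f F) s < \<epsilon> / 2"
    by (elim exE conjE) simp
  have "norm (sum f E') \<le> \<epsilon>" if E': "finite E'" "E' \<subseteq> J - E" for E'
  proof -
    have "sum f (E \<union> E') = sum f E + sum f E'" using E(1) E' by (intro sum.union_disjoint) auto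
    then have "norm (sum f E') = dist (sum f (E \<union> E')) (sum f E)" by (simp add: dist_norm)
    also have "\<dots> \<le> dist (sum f (E \<union> E')) s + dist (sum f E) s" by (rule dist_triangle2)
    also have "\<dots> < \<epsilon> / 2 + \<epsilon> / 2" using E E' by (intro add_strict_mono E(3)) auto
    finally show ?thesis by simp
  qed
  then show thesis using that E(1,2) by blast
qed

context hilbert_module
begin

lemma frame_sum_le_infsum:
  assumes s: "(\<lambda>j. ip x (f j) * ip (f j) x) summable_on J" and E: "finite E" "E \<subseteq> J"
  shows "cstar_le (frame_sum ip f E x) (\<Sum>\<^sub>\<infinity>j\<in>J. ip x (f j) * ip (f j) x)"
proof (rule cstar_le_tendsto[OF tendsto_const infsum_tendsto[OF s]])
  show "\<forall>\<^sub>F F in finite_subsets_at_top J.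
      cstar_le (frame_sum ip f E x) (\<Sum>j\<in>F. ip x (f j) * ip (f j) x)"
    unfolding eventually_finite_subsets_at_top
    using E frame_sum_mono[of _ E f x] by (intro exI[of _ E]) (auto simp: frame_sum_def)
qed simp

lemma admissibleI:
  assumes s: "\<And>x. summable (\<lambda>i. ip x (X i) * ip (X i) x)"
    and le: "\<And>x n. cstar_le (frame_sum ip X {..<n} x) (ip x x)"
  shows "admissible ip X"
  unfolding admissible_def
proof (intro conjI allI)
  show "cstar_le (\<Sum>i. ip x (X i) * ip (X i) x) (ip x x)" for x
    by (rule cstar_le_tendsto[OF summable_LIMSEQ[OF s] tendsto_const])
       (use le in \<open>auto simp: frame_sum_def\<close>)
  show "norm (X i) \<le> 1" for i
  proof -
    let ?x = "X i"
    have "cstar_le (frame_sum ip X {i} ?x) (frame_sum ip X {..<Suc i} ?x)"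
      by (rule frame_sum_mono) auto
    from cstar_le_trans[OF this le]
    have "norm (ip ?x ?x * ip ?x ?x) \<le> norm (ip ?x ?x)"
      by (intro cstar_le_norm_mono positive_ip_mult) (simp add: frame_sum_def)
    then have le: "(norm ?x)\<^sup>2 * (norm ?x)\<^sup>2 \<le> (norm ?x)\<^sup>2"
      unfolding norm_square_eq using norm_square_self_adjoint[OF star_ip[of ?x ?x]]
      by (simp add: power2_eq_square)
    show ?thesis
    proof (rule ccontr)
      assume "\<not> norm ?x \<le> 1"
      then have "1 < (norm ?x)\<^sup>2" by (simp add: one_less_power)
      then have "1 * (norm ?x)\<^sup>2 < (norm ?x)\<^sup>2 * (norm ?x)\<^sup>2" by (intro mult_strict_right_mono) auto
      then show False using le by simp
    qed
  qed
qed (rule s)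

text \<open>Suppose the tails over \<open>Y\<close> are not uniformly small. Choose disjoint finite blocks \<open>E k\<close> of
  indices and \<open>y k \<in> Y\<close> whose block sums have norm above \<open>\<epsilon>\<close>, and collapse each block to the one
  vector \<open>w k = \<Sum>j\<in>E k. f j \<langle>f j, y k\<rangle>\<close>. By Cauchy-Schwarz
  \<open>\<langle>z, w k\<rangle>\<langle>w k, z\<rangle>\<close> is at most a constant times the block sum at \<open>z\<close>, so the rescaled \<open>w k\<close>
  form an admissible system. A state norming \<open>\<langle>y k, w k\<rangle>\<close> keeps \<open>y k\<close> away from every fixed
  \<open>t\<close> for large \<open>k\<close>, because \<open>\<langle>t, w k\<rangle>\<close> tends to zero.\<close>

lemma NN_totally_bounded_imp_uniform_tails:
  fixes f :: "'i \<Rightarrow> 'm"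
  assumes tb: "NN_totally_bounded ip Y" and bounded: "\<And>y. y \<in> Y \<Longrightarrow> norm y \<le> R"
    and s: "\<And>x. (\<lambda>j. ip x (f j) * ip (f j) x) summable_on J"
    and bessel: "\<And>x E. finite E \<Longrightarrow> E \<subseteq> J \<Longrightarrow> cstar_le (frame_sum ip f E x) (c *\<^sub>R ip x x)"
    and c: "c > 0"
  shows "uniform_tails ip f J Y"
proof (rule ccontr)
  assume "\<not> uniform_tails ip f J Y"
  then obtain \<epsilon> where \<epsilon>: "\<epsilon> > 0" and ex: "\<And>E. finite E \<Longrightarrow> E \<subseteq> J \<Longrightarrow>
      \<exists>E' y. finite E' \<and> E' \<subseteq> J - E \<and> y \<in> Y \<and> norm (frame_sum ip f E' y) > \<epsilon>"
    unfolding uniform_tails_def by (meson not_le)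
  obtain blk pt where blk: "\<And>E. finite E \<Longrightarrow> E \<subseteq> J \<Longrightarrow>
      finite (blk E) \<and> blk E \<subseteq> J - E \<and> pt E \<in> Y \<and> norm (frame_sum ip f (blk E) (pt E)) > \<epsilon>"
    using ex by metis
  define U where "U = rec_nat {} (\<lambda>_ E. E \<union> blk E)"
  have U_Suc: "U (Suc n) = U n \<union> blk (U n)" and U_0: "U 0 = {}" for n by (simp_all add: U_def)
  have U: "finite (U n) \<and> U n \<subseteq> J" for n
    by (induction n) (use blk in \<open>auto simp: U_Suc U_0\<close>)
  define B where "B n = blk (U n)" for n
  define y where "y n = pt (U n)" for n
  define a where "a n = frame_sum ip f (B n) (y n)" for n
  have B: "finite (B n)" "B n \<subseteq> J - U n" "y n \<in> Y" "norm (a n) > \<epsilon>" for n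
    using blk U unfolding B_def y_def a_def by blast+
  have blocks: "(\<Sum>i<n. frame_sum ip f (B i) z) = frame_sum ip f (U n) z" for n z
  proof (induction n)
    case 0
    then show ?case by (simp add: U_0 frame_sum_def)
  next
    case (Suc n)
    have "frame_sum ip f (U n \<union> B n) z = frame_sum ip f (U n) z + frame_sum ip f (B n) z"
      unfolding frame_sum_def using U[of n] B(1,2)[of n] by (intro sum.union_disjoint) auto
    then show ?case by (simp add: Suc U_Suc flip: B_def)
  qed
  have summable_blocks: "summable (\<lambda>i. frame_sum ip f (B i) z)" for z
  proof -
    let ?J' = "\<Union>n. U n"
    have mono: "incseq U" by (rule incseq_SucI) (simp add: U_Suc)
    have "filterlim U (finite_subsets_at_top ?J') sequentially"
      unfolding filterlim_finite_subsets_at_top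
    proof (intro allI impI)
      fix E assume E: "finite E \<and> E \<subseteq> ?J'"
      have "\<forall>j\<in>E. \<exists>n. j \<in> U n" using E by blast
      then obtain n where n: "\<And>j. j \<in> E \<Longrightarrow> j \<in> U (n j)" by metis
      obtain L where L: "n ` E \<subseteq> {..<L}" using E finite_nat_bounded by blast
      have "E \<subseteq> U m" if "m \<ge> L" for m
      proof
        fix j assume "j \<in> E"
        then have "n j \<le> m" using L that by force
        then show "j \<in> U m" using n[OF \<open>j \<in> E\<close>] mono by (auto simp: incseq_def)
      qed
      then show "\<forall>\<^sub>F m in sequentially. finite (U m) \<and> E \<subseteq> U m \<and> U m \<subseteq> ?J'"
        using U by (intro eventually_sequentiallyI[of L]) auto
    qed
    moreover have "(\<lambda>j. ip z (f j) * ip (f j) z) summable_on ?J'"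
      by (rule summable_on_subset_banach[OF s]) (use U in blast)
    ultimately have "(\<lambda>n. frame_sum ip f (U n) z) \<longlonglongrightarrow> (\<Sum>\<^sub>\<infinity>j\<in>?J'. ip z (f j) * ip (f j) z)"
      unfolding frame_sum_def by (intro filterlim_compose[OF infsum_tendsto])
    then show ?thesis unfolding summable_def sums_def blocks[symmetric] by blast
  qed
  define K where "K = c * R\<^sup>2 + 1"
  have K: "K > 0" unfolding K_def using c by (intro add_nonneg_pos) auto
  have a_le: "norm (a n) \<le> K" for n
  proof -
    have "norm (a n) \<le> norm (c *\<^sub>R ip (y n) (y n))"
      unfolding a_def using B(1,2) by (intro cstar_le_norm_mono positive_frame_sum bessel) auto
    also have "\<dots> = c * (norm (y n))\<^sup>2" using c by (simp add: norm_square_eq)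
    also have "\<dots> \<le> c * R\<^sup>2" using c bounded[OF B(3)] by (intro mult_left_mono power_mono) auto
    finally show ?thesis by (simp add: K_def)
  qed
  define \<rho> where "\<rho> = 1 / sqrt (K * c)"
  have \<rho>: "\<rho> > 0" "\<rho>\<^sup>2 = 1 / (K * c)" using K c by (simp_all add: \<rho>_def power_divide)
  define X where "X n = \<rho> *\<^sub>R synthesis f (B n) (y n)" for n
  have X_le: "cstar_le (ip z (X n) * ip (X n) z) ((1 / c) *\<^sub>R frame_sum ip f (B n) z)" for n z
  proof -
    have "ip z (X n) * ip (X n) z = \<rho>\<^sup>2 *\<^sub>R (ip (synthesis f (B n) z) (y n) * ip (y n) (synthesis f (B n) z))"
      by (simp add: X_def ip_scaleR_left ip_scaleR_right ip_synthesis ip_synthesis_left power2_eq_square)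
    also have "cstar_le \<dots> (\<rho>\<^sup>2 *\<^sub>R (norm (a n) *\<^sub>R frame_sum ip f (B n) z))"
      unfolding a_def by (intro cstar_le_scaleR cauchy_schwarz_synthesis) simp
    also have "cstar_le \<dots> (\<rho>\<^sup>2 *\<^sub>R (K *\<^sub>R frame_sum ip f (B n) z))"
      by (intro cstar_le_scaleR cstar_le_scaleR_left positive_frame_sum a_le) simp
    also have "\<rho>\<^sup>2 *\<^sub>R (K *\<^sub>R frame_sum ip f (B n) z) = (1 / c) *\<^sub>R frame_sum ip f (B n) z"
      using K by (simp add: \<rho>)
    finally show ?thesis .
  qed
  have X_summable: "summable (\<lambda>n. ip z (X n) * ip (X n) z)" for z
    unfolding summable_Cauchy
  proof (intro allI impI)
    fix e :: real assume "e > 0"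
    moreover have "summable (\<lambda>n. (1 / c) *\<^sub>R frame_sum ip f (B n) z)"
      by (intro summable_scaleR_right summable_blocks)
    ultimately obtain N where N: "\<And>m n. m \<ge> N \<Longrightarrow>
        norm (\<Sum>i=m..<n. (1 / c) *\<^sub>R frame_sum ip f (B i) z) < e"
      unfolding summable_Cauchy by blast
    have "norm (\<Sum>i=m..<n. ip z (X i) * ip (X i) z) \<le> norm (\<Sum>i=m..<n. (1 / c) *\<^sub>R frame_sum ip f (B i) z)"
      for m n by (intro cstar_le_norm_mono positive_sum cstar_le_sum positive_ip_mult X_le)
    then show "\<exists>N. \<forall>m\<ge>N. \<forall>n. norm (\<Sum>i=m..<n. ip z (X i) * ip (X i) z) < e"
      using N le_less_trans by blast
  qed
  have X: "admissible ip X"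
  proof (rule admissibleI[OF X_summable])
    fix z n
    have "cstar_le (frame_sum ip X {..<n} z) (\<Sum>i<n. (1 / c) *\<^sub>R frame_sum ip f (B i) z)"
      unfolding frame_sum_def[of ip X] by (intro cstar_le_sum X_le)
    also have "(\<Sum>i<n. (1 / c) *\<^sub>R frame_sum ip f (B i) z) = (1 / c) *\<^sub>R frame_sum ip f (U n) z"
      by (simp add: blocks flip: scaleR_sum_right)
    also have "cstar_le \<dots> ((1 / c) *\<^sub>R (c *\<^sub>R ip z z))"
      using U c by (intro cstar_le_scaleR bessel) auto
    finally show "cstar_le (frame_sum ip X {..<n} z) (ip z z)" using c by simp
  qed
  have "\<exists>\<phi>. state \<phi> \<and> \<phi> (a n) = of_real (norm (a n))" for n
    using norming_state[of "a n"] B(4)[of n] \<epsilon> unfolding a_def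
    by (metis norm_zero not_less_iff_gr_or_eq positive_frame_sum order_less_trans)
  then obtain \<phi> where \<phi>: "\<And>n. state (\<phi> n)" "\<And>n. \<phi> n (a n) = of_real (norm (a n))" by metis
  have yX: "cmod (\<phi> n (ip (y n) (X n))) > \<rho> * \<epsilon>" for n
  proof -
    have "ip (y n) (X n) = \<rho> *\<^sub>R a n"
      by (simp add: X_def ip_scaleR_right ip_synthesis a_def frame_sum_def)
    moreover have "linear (\<phi> n)" using \<phi>(1)[of n] by (simp add: state_def bounded_linear.linear)
    ultimately have "\<phi> n (ip (y n) (X n)) = \<rho> *\<^sub>R of_real (norm (a n))"
      by (simp only: linear_scale \<phi>(2))
    then show ?thesis using B(4)[of n] \<rho>(1) by (simp add: norm_mult)
  qed
  define \<delta> where "\<delta> = \<rho> * \<epsilon> / 2"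
  have \<delta>: "\<delta> > 0" using \<rho> \<epsilon> by (simp add: \<delta>_def)
  obtain T where T: "finite T" "Y \<subseteq> (\<Union>t\<in>T. {y \<in> Y. frame_dist ip X \<phi> t y < \<delta>})"
    using tb X \<phi>(1) \<delta> unfolding NN_totally_bounded_def by meson
  have "\<forall>\<^sub>F n in sequentially. \<forall>t\<in>T. norm (ip t (X n) * ip (X n) t) < \<delta>\<^sup>2"
    unfolding eventually_ball_finite_distrib[OF T(1)]
  proof
    fix t
    have "(\<lambda>n. norm (ip t (X n) * ip (X n) t)) \<longlonglongrightarrow> 0"
      by (rule tendsto_norm_zero[OF summable_LIMSEQ_zero[OF X_summable]])
    then show "\<forall>\<^sub>F n in sequentially. norm (ip t (X n) * ip (X n) t) < \<delta>\<^sup>2"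
      by (rule order_tendstoD) (use \<delta> in simp)
  qed
  from eventually_happens'[OF sequentially_bot this]
  obtain n where n: "\<forall>t\<in>T. norm (ip t (X n) * ip (X n) t) < \<delta>\<^sup>2" ..
  have "y n \<in> (\<Union>t\<in>T. {y \<in> Y. frame_dist ip X \<phi> t y < \<delta>})" using T(2) B(3)[of n] by (rule subsetD)
  then obtain t where t: "t \<in> T" "frame_dist ip X \<phi> t (y n) < \<delta>" by auto
  have "(cmod (\<phi> n (ip t (X n))))\<^sup>2 \<le> norm (ip t (X n) * ip (X n) t)"
    using state_frame_sum_le[OF \<phi>(1)[of n], where x=t and X=X and E="{n}"] by (simp add: frame_sum_def)
  also have "\<dots> < \<delta>\<^sup>2" by (rule bspec[OF n t(1)])
  finally have "cmod (\<phi> n (ip t (X n))) < \<delta>" using \<delta> by (simp add: power2_less_imp_less)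
  moreover have "cmod (\<phi> n (ip (t - y n) (X n))) < \<delta>"
    using frame_dist_ge[where \<phi>=\<phi> and k=n and x=t and y="y n", OF X \<phi>(1)] t(2) by simp
  moreover have "\<phi> n (ip (t - y n) (X n)) = \<phi> n (ip t (X n)) - \<phi> n (ip (y n) (X n))"
    using \<phi>(1)[of n] by (simp add: ip_diff_left state_def linear_diff[OF bounded_linear.linear])
  moreover have "cmod (\<phi> n (ip (y n) (X n)))
      \<le> cmod (\<phi> n (ip t (X n))) + cmod (\<phi> n (ip t (X n)) - \<phi> n (ip (y n) (X n)))"
    by (metis norm_minus_commute norm_triangle_sub)
  ultimately show False using yX[of n] by (simp add: \<delta>_def)
qed

end

section \<open>Uniformly small frame tails force compactness\<close>

lemma theta_span_mono: "D \<subseteq> D' \<Longrightarrow> theta_span actN D \<subseteq> theta_span actN D'"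
proof
  fix T assume D: "D \<subseteq> D'" and "T \<in> theta_span actN D"
  then obtain k c x f where "\<forall>i<(k::nat). f i \<in> D"
    "\<forall>z. blinfun_apply T z = (\<Sum>i<k. c i *\<^sub>C theta actN (x i) (f i) z)"
    unfolding theta_span_def by blast
  with D show "T \<in> theta_span actN D'"
    unfolding theta_span_def
    by (intro CollectI exI[of _ k] exI[of _ c] exI[of _ x] exI[of _ f]) (simp add: subset_iff)
qed

lemma theta_span_zero: "0 \<in> theta_span actN D"
  unfolding theta_span_def by (intro CollectI exI[of _ 0]) simp

lemma theta_span_add:
  fixes actN :: "'a::{complex_vector, banach} \<Rightarrow> 'b \<Rightarrow> 'a"
  assumes "S \<in> theta_span actN D" "T \<in> theta_span actN D"
  shows "S + T \<in> theta_span actN D"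
proof -
  obtain k c x f where S: "\<forall>i<(k::nat). f i \<in> D"
    "\<And>z. blinfun_apply S z = (\<Sum>i<k. c i *\<^sub>C theta actN (x i) (f i) z)"
    using assms(1) unfolding theta_span_def by blast
  obtain l d y g where T: "\<forall>i<(l::nat). g i \<in> D"
    "\<And>z. blinfun_apply T z = (\<Sum>i<l. d i *\<^sub>C theta actN (y i) (g i) z)"
    using assms(2) unfolding theta_span_def by blast
  let ?join = "\<lambda>p q i. if i < k then p i else q (i - k)"
  have split: "(\<Sum>i<k + l. h i) = (\<Sum>i<k. h i) + (\<Sum>i<l. h (k + i))" for h :: "nat \<Rightarrow> 'a"
    by (induction l) (auto simp: add.assoc)
  have "blinfun_apply (S + T) z =
      (\<Sum>i<k + l. ?join c d i *\<^sub>C theta actN (?join x y i) (?join f g i) z)" for z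
    unfolding split blinfun.add_left S(2) T(2) by (intro arg_cong2[of _ _ _ _ "(+)"] sum.cong) auto
  moreover have "\<forall>i<k + l. ?join f g i \<in> D" using S(1) T(1) by auto
  ultimately show ?thesis unfolding theta_span_def
    by (intro CollectI exI[of _ "k + l"] exI[of _ "?join c d"] exI[of _ "?join x y"]
        exI[of _ "?join f g"]) simp
qed

lemma theta_span_finite_sum:
  fixes P :: "'m::{complex_vector, banach} \<Rightarrow>\<^sub>L 'n::{complex_vector, banach}"
  assumes E: "finite E" and g: "\<And>j. j \<in> E \<Longrightarrow> g j \<in> D"
    and P: "\<And>z. blinfun_apply P z = a *\<^sub>C (\<Sum>j\<in>E. actN (x j) (g j z))"
  shows "P \<in> theta_span actN D"
proof -
  obtain h where h: "bij_betw h {0..<card E} E" using ex_bij_betw_nat_finite[OF E] by blast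
  have "blinfun_apply P z = (\<Sum>i<card E. a *\<^sub>C theta actN (x (h i)) (g (h i)) z)" for z
    using sum.reindex_bij_betw[OF h, of "\<lambda>j. actN (x j) (g j z)"]
    by (simp add: P theta_def atLeast0LessThan flip: scaleC_sum_right)
  moreover have "\<forall>i<card E. g (h i) \<in> D" using bij_betwE[OF h] g by auto
  ultimately show ?thesis unfolding theta_span_def
    by (intro CollectI exI[of _ "card E"] exI[of _ "\<lambda>_. a"] exI[of _ "\<lambda>i. x (h i)"]
        exI[of _ "\<lambda>i. g (h i)"]) simp
qed

lemma theta_span_compose:
  fixes T :: "'n::{complex_vector, banach} \<Rightarrow>\<^sub>L 'n"
  assumes T: "\<And>c x. blinfun_apply T (c *\<^sub>C x) = c *\<^sub>C blinfun_apply T x"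
    "\<And>x a. blinfun_apply T (actN x a) = actN (blinfun_apply T x) a"
    and G: "G \<in> theta_span actN D"
  shows "T o\<^sub>L G \<in> theta_span actN D"
proof -
  obtain k c x f where G: "\<forall>i<(k::nat). f i \<in> D"
    "\<And>z. blinfun_apply G z = (\<Sum>i<k. c i *\<^sub>C theta actN (x i) (f i) z)"
    using G unfolding theta_span_def by blast
  then have "blinfun_apply (T o\<^sub>L G) z = (\<Sum>i<k. c i *\<^sub>C theta actN (blinfun_apply T (x i)) (f i) z)" for z
    by (simp add: blinfun.sum_right T theta_def)
  then show ?thesis unfolding theta_span_def
    by (intro CollectI exI[of _ k] exI[of _ c] exI[of _ "\<lambda>i. blinfun_apply T (x i)"] exI[of _ f])
       (simp add: G(1))
qed

lemma theta_span_closure_add: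
  fixes actN :: "'n::{complex_vector, banach} \<Rightarrow> 'a \<Rightarrow> 'n"
  assumes "S \<in> closure (theta_span actN D)" "T \<in> closure (theta_span actN D)"
  shows "S + T \<in> closure (theta_span actN D)"
proof -
  obtain s t where "\<And>n. s n \<in> theta_span actN D" "s \<longlonglongrightarrow> S" "\<And>n. t n \<in> theta_span actN D" "t \<longlonglongrightarrow> T"
    using assms unfolding closure_sequential by blast
  then show ?thesis unfolding closure_sequential
    by (intro exI[of _ "\<lambda>n. s n + t n"]) (auto intro: theta_span_add tendsto_add)
qed

lemma theta_span_closure_compose:
  fixes T :: "'n::{complex_vector, banach} \<Rightarrow>\<^sub>L 'n"
  assumes T: "\<And>c x. blinfun_apply T (c *\<^sub>C x) = c *\<^sub>C blinfun_apply T x"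
    "\<And>x a. blinfun_apply T (actN x a) = actN (blinfun_apply T x) a"
    and G: "G \<in> closure (theta_span actN D)"
  shows "T o\<^sub>L G \<in> closure (theta_span actN D)"
proof -
  obtain g where "\<And>n. g n \<in> theta_span actN D" "g \<longlonglongrightarrow> G"
    using G unfolding closure_sequential by blast
  then show ?thesis unfolding closure_sequential
    by (intro exI[of _ "\<lambda>n. T o\<^sub>L g n"])
       (auto intro: theta_span_compose[where T=T and actN=actN, OF T]
          bounded_bilinear.tendsto[OF bounded_bilinear_blinfun_compose tendsto_const])
qed

lemma norm_blinfun_le_of_unit_ball:
  assumes "\<And>z. norm z \<le> 1 \<Longrightarrow> norm (blinfun_apply A z) \<le> b"
  shows "norm A \<le> b"
proof (rule norm_blinfun_bound)
  show "b \<ge> 0" using assms[of 0] by simp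
  show "norm (blinfun_apply A z) \<le> b * norm z" for z
  proof (cases "z = 0")
    case False
    then have "norm (blinfun_apply A ((1 / norm z) *\<^sub>R z)) \<le> b" by (intro assms) simp
    then show ?thesis using False by (simp add: blinfun.scaleR_right field_simps)
  qed simp
qed

text \<open>The frame operator is divided by \<open>c = c1 + c2\<close> rather than \<open>c2\<close>, so that \<open>1 - c1 / c \<ge> 0\<close> also in the
  zero module, where the frame inequalities do not imply \<open>c1 \<le> c2\<close>.\<close>

lemma (in hilbert_module) frame_operator_contraction:
  fixes f :: "'i \<Rightarrow> 'm"
  assumes c1: "c1 > 0" and c2: "c2 > 0"
    and s: "\<And>x. (\<lambda>j. ip x (f j) * ip (f j) x) summable_on J"
    and lower: "\<And>x. cstar_le (c1 *\<^sub>R ip x x) (\<Sum>\<^sub>\<infinity>j\<in>J. ip x (f j) * ip (f j) x)"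
    and upper: "\<And>x. cstar_le (\<Sum>\<^sub>\<infinity>j\<in>J. ip x (f j) * ip (f j) x) (c2 *\<^sub>R ip x x)"
  obtains T r where "positive_contraction act ip T r" "r < 1"
    "\<And>x. ((\<lambda>j. act (f j) (ip (f j) x)) has_sum (c1 + c2) *\<^sub>R (x - T x)) J"
proof -
  define c where "c = c1 + c2"
  have c: "c > 0" using c1 c2 by (simp add: c_def)
  have upper: "cstar_le (\<Sum>\<^sub>\<infinity>j\<in>J. ip x (f j) * ip (f j) x) (c *\<^sub>R ip x x)" for x
    by (rule cstar_le_trans[OF upper]) (use c1 in \<open>simp add: c_def cstar_le_scaleR_left ip_positive\<close>)
  have bessel: "norm (frame_sum ip f E x) \<le> c * (norm x)\<^sup>2" if "finite E" "E \<subseteq> J" for E x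
    using cstar_le_norm_mono[OF positive_frame_sum cstar_le_trans[OF frame_sum_le_infsum[OF s that] upper]] c
    by (simp add: norm_square_eq)
  have summable: "(\<lambda>j. act (f j) (ip (f j) x)) summable_on J" for x
  proof (rule summable_on_CauchyI)
    fix \<epsilon> :: real assume \<epsilon>: "\<epsilon> > 0"
    then have "\<epsilon>\<^sup>2 / c > 0" using c by simp
    from summable_on_tails[OF s this]
    obtain E where E: "finite E" "E \<subseteq> J"
      "\<And>E'. finite E' \<Longrightarrow> E' \<subseteq> J - E \<Longrightarrow> norm (frame_sum ip f E' x) \<le> \<epsilon>\<^sup>2 / c"
      unfolding frame_sum_def by blast
    have "norm (\<Sum>j\<in>E'. act (f j) (ip (f j) x)) \<le> \<epsilon>" if E': "finite E'" "E' \<subseteq> J - E" for E'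
    proof (rule power2_le_imp_le)
      have "(norm (synthesis f E' x))\<^sup>2 \<le> c * norm (frame_sum ip f E' x)"
        using E' by (intro norm_synthesis_le bessel) auto
      also have "\<dots> \<le> c * (\<epsilon>\<^sup>2 / c)" using c E(3)[OF E'] by (intro mult_left_mono) auto
      finally show "(norm (\<Sum>j\<in>E'. act (f j) (ip (f j) x)))\<^sup>2 \<le> \<epsilon>\<^sup>2"
        using c by (simp add: synthesis_def)
    qed (use \<epsilon> in simp)
    then show "\<exists>E. finite E \<and> E \<subseteq> J \<and>
        (\<forall>E'. finite E' \<longrightarrow> E' \<subseteq> J - E \<longrightarrow> norm (\<Sum>j\<in>E'. act (f j) (ip (f j) x)) \<le> \<epsilon>)"
      using E(1,2) by blast
  qed
  define S where "S x = (\<Sum>\<^sub>\<infinity>j\<in>J. act (f j) (ip (f j) x))" for x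
  have S: "((\<lambda>j. act (f j) (ip (f j) x)) has_sum S x) J" for x
    unfolding S_def using summable by (rule has_sum_infsum)
  have right: "((\<lambda>j. ip y (f j) * ip (f j) x) has_sum ip y (S x)) J" for x y
    using has_sum_bounded_linear[OF bounded_bilinear.bounded_linear_right[OF bounded_bilinear_ip] S]
    by (simp add: ip_act_right)
  have left: "((\<lambda>j. ip x (f j) * ip (f j) y) has_sum ip (S x) y) J" for x y
    using has_sum_bounded_linear[OF bounded_bilinear.bounded_linear_left[OF bounded_bilinear_ip] S]
    by (simp add: ip_act_left star_ip)
  have self_adjoint: "ip x (S y) = ip (S x) y" for x y by (rule has_sum_unique[OF right left])
  have diag: "(\<Sum>\<^sub>\<infinity>j\<in>J. ip x (f j) * ip (f j) x) = ip x (S x)" for x by (rule infsumI[OF right])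
  define T where "T x = x - (1 / c) *\<^sub>R S x" for x
  have ipT: "ip x (T x) = ip x x - (1 / c) *\<^sub>R ip x (S x)" for x
    by (simp add: T_def ip_diff_right ip_scaleR_right)
  have "positive_contraction act ip T (1 - c1 / c)"
  proof
    show "ip x (T y) = ip (T x) y" for x y
      by (simp add: T_def ip_diff_left ip_diff_right ip_scaleR_left ip_scaleR_right self_adjoint)
    show "positive (ip x (T x))" for x
      using cstar_le_scaleR[OF upper[of x], of "1 / c"] c unfolding ipT diag cstar_le_def by simp
    show "cstar_le (ip x (T x)) ((1 - c1 / c) *\<^sub>R ip x x)" for x
      using cstar_le_scaleR[OF lower[of x], of "1 / c"] c
      unfolding ipT diag cstar_le_def by (simp add: algebra_simps)
    show "0 \<le> 1 - c1 / c" using c c2 by (simp add: c_def)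
  qed
  moreover have "((\<lambda>j. act (f j) (ip (f j) x)) has_sum (c1 + c2) *\<^sub>R (x - T x)) J" for x
    using S[of x] c by (simp add: T_def c_def)
  ultimately show thesis using that[of T "1 - c1 / c"] c1 c by simp
qed

text \<open>The frame operator is \<open>c (1 - T)\<close> with \<open>\<parallel>T\<parallel> < 1\<close>. Uniformly small tails make \<open>(1 - T) F\<close> a norm limit of
  finite sums of \<open>theta\<close>s, and composition with \<open>T\<close> preserves these limits. So the distance
  from \<open>F = (1 - T) F + T F\<close> to them is at most \<open>\<parallel>T\<parallel>\<close> times itself, and vanishes.\<close>

lemma uniform_tails_imp_compact:
  fixes F :: "'m::{complex_vector, banach} \<Rightarrow>\<^sub>L 'n::{complex_vector, banach}"
    and actN :: "'n \<Rightarrow> 'a::cstar_algebra \<Rightarrow> 'n" and f :: "'i \<Rightarrow> 'n"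
  assumes N: "hilbert_module actN ipN" and frame: "standard_frame ipN J f"
    and tails: "uniform_tails ipN f J (blinfun_apply F ` cball 0 1)"
    and D: "\<And>j. j \<in> J \<Longrightarrow> (\<lambda>z. ipN (f j) (blinfun_apply F z)) \<in> D"
  shows "F \<in> closure (theta_span actN D)"
proof -
  interpret N: hilbert_module actN ipN by (rule N)
  obtain c1 c2 where c12: "c1 > 0" "c2 > 0"
    and s: "\<And>x. (\<lambda>j. ipN x (f j) * ipN (f j) x) summable_on J"
    and lower: "\<And>x. cstar_le (c1 *\<^sub>R ipN x x) (\<Sum>\<^sub>\<infinity>j\<in>J. ipN x (f j) * ipN (f j) x)"
    and upper: "\<And>x. cstar_le (\<Sum>\<^sub>\<infinity>j\<in>J. ipN x (f j) * ipN (f j) x) (c2 *\<^sub>R ipN x x)"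
    using frame unfolding standard_frame_def by blast
  obtain T r where T: "positive_contraction actN ipN T r" and r: "r < 1"
    and S: "\<And>x. ((\<lambda>j. actN (f j) (ipN (f j) x)) has_sum (c1 + c2) *\<^sub>R (x - T x)) J"
    using N.frame_operator_contraction[OF c12 s lower upper] by blast
  interpret T: positive_contraction actN ipN T r by (rule T)
  define c where "c = c1 + c2"
  have c: "c > 0" using c12 by (simp add: c_def)
  have bessel: "norm (frame_sum ipN f E x) \<le> c2 * (norm x)\<^sup>2" if "finite E" "E \<subseteq> J" for E x
    using cstar_le_norm_mono[OF N.positive_frame_sum cstar_le_trans[OF N.frame_sum_le_infsum[OF s that] upper]] c12
    by (simp add: N.norm_square_eq)
  define TB where "TB = Blinfun T"
  have TB: "blinfun_apply TB = T" unfolding TB_def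
    by (rule bounded_linear_Blinfun_apply[OF T.bounded_linear_T])
  have TB_norm: "norm TB \<le> r"
    by (rule norm_blinfun_bound) (auto simp: TB T.norm_T_le T.r_nonneg)
  let ?K = "closure (theta_span actN D)"
  have compose: "TB o\<^sub>L G \<in> ?K" if "G \<in> ?K" for G
    by (rule theta_span_closure_compose[OF _ _ that]) (simp_all add: TB T.T_scaleC T.T_act)
  define G where "G = F - (TB o\<^sub>L F)"
  have "G \<in> ?K" unfolding closure_approachable
  proof (intro allI impI)
    fix e :: real assume e: "e > 0"
    define \<delta> where "\<delta> = (c * e / 2)\<^sup>2 / c2"
    have "\<delta> > 0" using e c c12 by (simp add: \<delta>_def)
    then obtain E where E: "finite E" "E \<subseteq> J"
      "\<And>E' y. finite E' \<Longrightarrow> E' \<subseteq> J - E \<Longrightarrow> y \<in> blinfun_apply F ` cball 0 1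
        \<Longrightarrow> norm (frame_sum ipN f E' y) \<le> \<delta>"
      using tails unfolding uniform_tails_def by meson
    define P where "P = Blinfun (\<lambda>z. (1 / c) *\<^sub>R N.synthesis f E (blinfun_apply F z))"
    have bl: "bounded_linear (\<lambda>z. (1 / c) *\<^sub>R N.synthesis f E (blinfun_apply F z))"
      unfolding N.synthesis_def
      by (intro bounded_linear_const_scaleR bounded_linear_sum
          bounded_linear_compose[OF N.bounded_linear_act_right]
          bounded_linear_compose[OF bounded_bilinear.bounded_linear_right[OF N.bounded_bilinear_ip]]
          blinfun.bounded_linear_right)
    have P: "blinfun_apply P z = (1 / c) *\<^sub>R N.synthesis f E (blinfun_apply F z)" for z
      unfolding P_def by (simp add: bounded_linear_Blinfun_apply[OF bl])
    have "P \<in> theta_span actN D"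
    proof (rule theta_span_finite_sum[OF E(1)])
      show "blinfun_apply P z = complex_of_real (1 / c) *\<^sub>C (\<Sum>j\<in>E. actN (f j) (ipN (f j) (blinfun_apply F z)))"
        for z unfolding P N.synthesis_def scaleC_of_real ..
    qed (use E(2) D in blast)
    moreover have "norm (G - P) \<le> e / 2"
    proof (rule norm_blinfun_le_of_unit_ball)
      fix z :: 'm assume z: "norm z \<le> 1"
      let ?y = "blinfun_apply F z"
      have y: "?y \<in> blinfun_apply F ` cball 0 1" using z by auto
      have "((\<lambda>E'. norm ((\<Sum>j\<in>E'. actN (f j) (ipN (f j) ?y)) - N.synthesis f E ?y)) \<longlongrightarrow>
          norm (c *\<^sub>R (?y - T ?y) - N.synthesis f E ?y)) (finite_subsets_at_top J)"
        using S[of ?y] unfolding has_sum_def c_def by (intro tendsto_intros)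
      moreover have "\<forall>\<^sub>F E' in finite_subsets_at_top J.
          norm ((\<Sum>j\<in>E'. actN (f j) (ipN (f j) ?y)) - N.synthesis f E ?y) \<le> c * e / 2"
        unfolding eventually_finite_subsets_at_top
      proof (intro exI[of _ E] conjI allI impI E(1,2))
        fix E' assume E': "finite E' \<and> E \<subseteq> E' \<and> E' \<subseteq> J"
        have "(\<Sum>j\<in>E'. actN (f j) (ipN (f j) ?y)) - N.synthesis f E ?y = N.synthesis f (E' - E) ?y"
          unfolding N.synthesis_def using E' by (simp add: sum_diff)
        moreover have "norm (N.synthesis f (E' - E) ?y) \<le> c * e / 2"
        proof (rule power2_le_imp_le)
          have "(norm (N.synthesis f (E' - E) ?y))\<^sup>2 \<le> c2 * norm (frame_sum ipN f (E' - E) ?y)"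
            using E' by (intro N.norm_synthesis_le bessel) auto
          also have "\<dots> \<le> c2 * \<delta>" using E' c12 by (intro mult_left_mono E(3) y) auto
          finally show "(norm (N.synthesis f (E' - E) ?y))\<^sup>2 \<le> (c * e / 2)\<^sup>2"
            using c12 by (simp add: \<delta>_def)
        qed (use c e in simp)
        ultimately show "norm ((\<Sum>j\<in>E'. actN (f j) (ipN (f j) ?y)) - N.synthesis f E ?y) \<le> c * e / 2"
          by simp
      qed
      ultimately have "norm (c *\<^sub>R (?y - T ?y) - N.synthesis f E ?y) \<le> c * e / 2"
        by (rule tendsto_upperbound) simp
      note le = this
      have "blinfun_apply (G - P) z = (1 / c) *\<^sub>R (c *\<^sub>R (?y - T ?y) - N.synthesis f E ?y)"
        using c by (simp add: G_def P TB blinfun.diff_left scaleR_diff_right)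
      then have "norm (blinfun_apply (G - P) z)
          = (1 / c) * norm (c *\<^sub>R (?y - T ?y) - N.synthesis f E ?y)"
        using c by (simp only: norm_scaleR) simp
      also have "\<dots> \<le> (1 / c) * (c * e / 2)" using c by (intro mult_left_mono le) simp
      finally show "norm (blinfun_apply (G - P) z) \<le> e / 2" using c by simp
    qed
    ultimately show "\<exists>P\<in>theta_span actN D. dist P G < e"
      using e by (intro bexI[of _ P]) (auto simp: dist_norm norm_minus_commute)
  qed
  have ne: "?K \<noteq> {}" using theta_span_zero[of actN D] closure_subset by blast
  have step: "infdist F ?K \<le> r * dist F k" if k: "k \<in> ?K" for k
  proof -
    have "G + (TB o\<^sub>L k) \<in> ?K" by (rule theta_span_closure_add[OF \<open>G \<in> ?K\<close> compose[OF k]])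
    then have "infdist F ?K \<le> dist F (G + (TB o\<^sub>L k))" by (rule infdist_le)
    also have "F - (G + (TB o\<^sub>L k)) = TB o\<^sub>L (F - k)"
      by (rule blinfun_eqI) (simp add: G_def blinfun.bilinear_simps)
    then have "dist F (G + (TB o\<^sub>L k)) = norm (TB o\<^sub>L (F - k))" by (simp add: dist_norm)
    also have "\<dots> \<le> norm TB * norm (F - k)" by (rule norm_blinfun_compose)
    also have "\<dots> \<le> r * dist F k" using TB_norm by (simp add: dist_norm mult_right_mono)
    finally show ?thesis .
  qed
  have "infdist F ?K \<le> r * infdist F ?K"
  proof (cases "r = 0")
    case True
    have "0 \<in> ?K" using theta_span_zero closure_subset by (rule rev_subsetD)
    from step[OF this] show ?thesis using True by simp
  next
    case False
    then have r0: "r > 0" using T.r_nonneg by simp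
    have "infdist F ?K / r \<le> infdist F ?K"
      unfolding infdist_notempty[OF ne, of F]
      by (rule cINF_greatest[OF ne])
         (use step r0 in \<open>simp add: infdist_notempty[OF ne] field_simps\<close>)
    then show ?thesis using r0 by (simp add: field_simps)
  qed
  then have "(1 - r) * infdist F ?K \<le> 0" by (simp add: algebra_simps)
  then have "infdist F ?K = 0"
    using r infdist_nonneg[of F ?K] by (simp add: mult_le_0_iff)
  then show ?thesis using in_closure_iff_infdist_zero[OF ne, of F] by simp
qed

section \<open>Countably generated modules have standard frames\<close>

lemma has_sum_positiveI:
  fixes a :: "'i \<Rightarrow> 'a::cstar_algebra"
  assumes pos: "\<And>i. positive (a i)" and le: "\<And>E. finite E \<Longrightarrow> cstar_le (sum a E) s"
    and approx: "\<And>\<epsilon>. \<epsilon> > 0 \<Longrightarrow> \<exists>E. finite E \<and> norm (s - sum a E) < \<epsilon>"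
  shows "(a has_sum s) UNIV"
  unfolding has_sum_def tendsto_iff eventually_finite_subsets_at_top
proof (intro allI impI)
  fix \<epsilon> :: real assume "\<epsilon> > 0"
  then obtain E where E: "finite E" "norm (s - sum a E) < \<epsilon>" using approx by blast
  have "dist (sum a E') s < \<epsilon>" if E': "finite E'" "E \<subseteq> E'" for E'
  proof -
    have "cstar_le (sum a E) (sum a E')" using E' pos by (intro cstar_le_sum_mono) auto
    then have "norm (s - sum a E') \<le> norm (s - sum a E)"
      using le[OF E'(1)] by (intro cstar_le_norm_mono) (simp_all add: cstar_le_def)
    then show ?thesis using E(2) by (simp add: dist_norm norm_minus_commute)
  qed
  then show "\<exists>X. finite X \<and> X \<subseteq> UNIV \<and> (\<forall>Y. finite Y \<and> X \<subseteq> Y \<and> Y \<subseteq> UNIV \<longrightarrow> dist (sum a Y) s < \<epsilon>)"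
    using E(1) by blast
qed

locale unit_contraction = positive_contraction act ip T 1
  for act :: "'m::{complex_vector, banach} \<Rightarrow> 'a::cstar_algebra \<Rightarrow> 'm"
    and ip :: "'m \<Rightarrow> 'm \<Rightarrow> 'a" and T
begin

abbreviation h :: "'m \<Rightarrow> 'm" where "h x \<equiv> x - T x"

lemma h_positive: "positive (ip x (h x))"
  using T_le[of x] by (simp add: cstar_le_def ip_diff_right)

lemma T_zero: "T 0 = 0"
  using T_scaleR[of 0 0] by simp

lemma funpow_simps:
  "(T ^^ k) (x + y) = (T ^^ k) x + (T ^^ k) y" "(T ^^ k) (x - y) = (T ^^ k) x - (T ^^ k) y"
  "(T ^^ k) (r *\<^sub>R x) = r *\<^sub>R (T ^^ k) x" "(T ^^ k) (act x a) = act ((T ^^ k) x) a" "(T ^^ k) 0 = 0"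
  by (induction k) (auto simp: T_add T_diff T_scaleR T_act T_zero)

lemma funpow_self_adjoint: "ip x ((T ^^ k) y) = ip ((T ^^ k) x) y"
  by (induction k arbitrary: x y) (auto simp: T_self_adjoint funpow_swap1)

lemma norm_funpow_le: "norm ((T ^^ k) x) \<le> norm x"
  by (induction k) (auto intro: order_trans[OF norm_T_le])

text \<open>Splitting \<open>T\<^sup>k\<close> symmetrically reduces forms in \<open>T\<^sup>k\<close> to the exponents \<open>0\<close> and \<open>1\<close>.\<close>

lemma ip_funpow_split:
  "ip x ((T ^^ (2 * m)) y) = ip ((T ^^ m) x) ((T ^^ m) y)"
  "ip x ((T ^^ Suc (2 * m)) y) = ip ((T ^^ m) x) (T ((T ^^ m) y))"
  by (simp_all add: mult_2 funpow_add funpow_self_adjoint T_self_adjoint funpow_swap1)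

text \<open>\<open>T - T\<^sup>2 = T h\<close> is positive because \<open>T h = h T h + T h T\<close>.\<close>

lemma positive_T_h: "positive (ip x (T (h x)))"
proof -
  have "ip x (T (h x)) = ip (h x) (T (h x)) + ip (T x) (h (T x))"
    by (simp add: ip_diff_left ip_diff_right T_diff T_self_adjoint)
  then show ?thesis by (simp add: positive_add T_positive h_positive)
qed

lemma powers_decreasing_convex:
  fixes x :: 'm
  defines "c \<equiv> \<lambda>k. ip x ((T ^^ k) x)"
  shows "positive (c k)" "positive (c k - c (Suc k))"
    "positive (c k - c (Suc k) - (c (Suc k) - c (Suc (Suc k))))"
proof -
  obtain m where "k = 2 * m \<or> k = Suc (2 * m)" by (metis evenE oddE Suc_eq_plus1)
  moreover define u where "u = (T ^^ m) x"
  have diff: "c k - c (Suc k) = ip x ((T ^^ k) (h x))" for k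
    by (simp add: c_def funpow_simps ip_diff_right funpow_swap1)
  have h: "(T ^^ m) (h y) = h ((T ^^ m) y)" for m y by (simp add: funpow_simps funpow_swap1)
  have diff2: "c k - c (Suc k) - (c (Suc k) - c (Suc (Suc k))) = ip (h x) ((T ^^ k) (h x))"
    unfolding diff by (simp add: funpow_simps ip_diff_right ip_diff_left funpow_swap1 T_diff
        flip: T_self_adjoint)
  consider "k = 2 * m" | "k = Suc (2 * m)" using calculation by blast
  then have "positive (c k) \<and> positive (ip x ((T ^^ k) (h x))) \<and> positive (ip (h x) ((T ^^ k) (h x)))"
  proof cases
    case 1
    then show ?thesis unfolding c_def 1 ip_funpow_split unfolding h
      using ip_positive h_positive by (simp del: funpow.simps)
  next
    case 2
    then show ?thesis unfolding c_def 2 ip_funpow_split unfolding h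
      using T_positive positive_T_h by (simp del: funpow.simps)
  qed
  note pos = this
  show "positive (c k)" using pos by blast
  show "positive (c k - c (Suc k))" unfolding diff using pos by blast
  show "positive (c k - c (Suc k) - (c (Suc k) - c (Suc (Suc k))))" unfolding diff2 using pos by blast
qed

lemma norm_ip_funpow_h_le: "real (Suc (2 * m)) * norm (ip ((T ^^ m) x) (h ((T ^^ m) x))) \<le> (norm x)\<^sup>2"
proof -
  have "real (Suc (2 * m)) * norm (ip x ((T ^^ (2 * m)) x) - ip x ((T ^^ Suc (2 * m)) x))
      \<le> norm (ip x ((T ^^ 0) x))"
    by (rule convex_decreasing_increments[of "\<lambda>k. ip x ((T ^^ k) x)"]) (rule powers_decreasing_convex)+
  then show ?thesis unfolding ip_funpow_split by (simp add: norm_square_eq ip_diff_right)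
qed

text \<open>If \<open>\<theta>_{g,g} \<le> h\<close> then \<open>\<parallel>\<langle>g, T\<^sup>m x\<rangle>\<parallel>\<^sup>2 \<le> \<parallel>\<langle>T\<^sup>m x, h T\<^sup>m x\<rangle>\<parallel>\<close>, which is of
  order \<open>\<parallel>x\<parallel>\<^sup>2 / m\<close>; the choice \<open>x = T\<^sup>m g\<close> then bounds \<open>\<parallel>T\<^sup>m g\<parallel>\<close>.\<close>

lemma funpow_tendsto_zero:
  assumes g: "\<And>x. cstar_le (ip x g * ip g x) (ip x (h x))"
  shows "(\<lambda>m. (T ^^ m) g) \<longlonglongrightarrow> 0"
proof -
  have bound: "(norm ((T ^^ m) g))\<^sup>2 \<le> 1 / real (Suc (2 * m))" for m
  proof -
    let ?x = "(T ^^ m) g"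
    have "(norm ?x)\<^sup>2 * (norm ?x)\<^sup>2 = (norm (ip ?x ?x))\<^sup>2" by (simp add: power2_eq_square flip: norm_square_eq)
    also have "ip ?x ?x = ip g ((T ^^ m) ?x)" by (simp add: funpow_self_adjoint)
    also have "(norm (ip g ((T ^^ m) ?x)))\<^sup>2 = norm (ip ((T ^^ m) ?x) g * ip g ((T ^^ m) ?x))"
      using norm_star_mult[of "ip g ((T ^^ m) ?x)"] by (simp add: star_ip)
    also have "\<dots> \<le> norm (ip ((T ^^ m) ?x) (h ((T ^^ m) ?x)))"
      by (intro cstar_le_norm_mono positive_ip_mult g)
    also have "\<dots> \<le> (norm ?x)\<^sup>2 / real (Suc (2 * m))"
      using norm_ip_funpow_h_le[of m ?x] by (simp add: pos_le_divide_eq mult.commute del: of_nat_Suc)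
    finally have le: "(norm ?x)\<^sup>2 * (norm ?x)\<^sup>2 \<le> 1 / real (Suc (2 * m)) * (norm ?x)\<^sup>2" by simp
    show ?thesis
    proof (cases "?x = 0")
      case False
      then show ?thesis by (intro mult_right_le_imp_le[OF le]) simp
    qed simp
  qed
  have "(\<lambda>m. (norm ((T ^^ m) g))\<^sup>2) \<longlonglongrightarrow> 0"
  proof (rule tendsto_sandwich[OF _ _ tendsto_const LIMSEQ_inverse_real_of_nat])
    show "\<forall>\<^sub>F m in sequentially. (norm ((T ^^ m) g))\<^sup>2 \<le> inverse (real (Suc m))"
    proof (intro always_eventually allI)
      fix m
      have "1 / real (Suc (2 * m)) \<le> 1 / real (Suc m)" by (intro divide_left_mono) auto
      then show "(norm ((T ^^ m) g))\<^sup>2 \<le> inverse (real (Suc m))"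
        using bound[of m] by (simp add: inverse_eq_divide)
    qed
  qed simp
  from tendsto_real_sqrt[OF this] have "(\<lambda>m. norm ((T ^^ m) g)) \<longlonglongrightarrow> 0" by simp
  then show ?thesis by (rule tendsto_norm_zero_cancel)
qed

lemma funpow_tendsto_zero_closure:
  assumes C: "\<And>x. x \<in> C \<Longrightarrow> (\<lambda>m. (T ^^ m) x) \<longlonglongrightarrow> 0"
    and dense: "closure {\<Sum>x\<in>D. act x (a x) | D a. finite D \<and> D \<subseteq> C} = UNIV"
  shows "(\<lambda>m. (T ^^ m) x) \<longlonglongrightarrow> 0"
proof -
  have comb: "(\<lambda>m. (T ^^ m) (\<Sum>x\<in>D. act x (a x))) \<longlonglongrightarrow> 0" if "finite D" "D \<subseteq> C" for D a
    using that
  proof (induction D rule: finite_induct)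
    case empty
    then show ?case by (simp add: funpow_simps)
  next
    case (insert y D)
    have "(\<lambda>m. act ((T ^^ m) y) (a y)) \<longlonglongrightarrow> act 0 (a y)"
      using insert by (intro bounded_linear.tendsto[OF bounded_linear_act_left] C) auto
    moreover have "act 0 (a y) = 0" using act_diff_left[of 0 0 "a y"] by simp
    ultimately have "(\<lambda>m. act ((T ^^ m) y) (a y) + (T ^^ m) (\<Sum>x\<in>D. act x (a x))) \<longlonglongrightarrow> 0 + 0"
      using insert by (intro tendsto_add) auto
    then show ?case using insert by (simp add: funpow_simps)
  qed
  show ?thesis
  proof (rule LIMSEQ_I)
    fix \<epsilon> :: real assume \<epsilon>: "\<epsilon> > 0"
    have "x \<in> closure {\<Sum>x\<in>D. act x (a x) | D a. finite D \<and> D \<subseteq> C}" using dense by simp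
    then obtain z where z: "z \<in> {\<Sum>x\<in>D. act x (a x) | D a. finite D \<and> D \<subseteq> C}" "dist z x < \<epsilon> / 2"
      using \<epsilon> unfolding closure_approachable by (meson half_gt_zero)
    then have "(\<lambda>m. (T ^^ m) z) \<longlonglongrightarrow> 0" using comb by blast
    then obtain N where N: "\<And>m. m \<ge> N \<Longrightarrow> norm ((T ^^ m) z) < \<epsilon> / 2"
      using LIMSEQ_D[of "\<lambda>m. (T ^^ m) z" 0 "\<epsilon> / 2"] \<epsilon> by auto
    have "norm ((T ^^ m) x - 0) < \<epsilon>" if "m \<ge> N" for m
    proof -
      have "norm ((T ^^ m) x) \<le> norm ((T ^^ m) z) + norm ((T ^^ m) (x - z))"
        using norm_triangle_ineq[of "(T ^^ m) z" "(T ^^ m) (x - z)"] by (simp add: funpow_simps)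
      then show ?thesis
        using N[OF that] norm_funpow_le[of m "x - z"] z(2) by (simp add: dist_norm norm_minus_commute)
    qed
    then show "\<exists>N. \<forall>m\<ge>N. norm ((T ^^ m) x - 0) < \<epsilon>" by blast
  qed
qed

text \<open>Let \<open>q m = \<langle>T\<^sup>m x, h T\<^sup>m x\<rangle> = c (2 m) - c (2 m + 1)\<close> with \<open>c k = \<langle>x, T\<^sup>k x\<rangle>\<close>. Since \<open>c\<close> is decreasing
  and convex, \<open>c (2 m) - c (2 m + 2)\<close> lies between \<open>q m\<close> and \<open>2 q m\<close>, and these differences
  telescope to \<open>\<langle>x, x\<rangle>\<close>. On the scalar level this is
  \<open>1/2 \<le> \<Sum> t (1 - t)^(2 m) = 1 / (2 - t) \<le> 1\<close> for \<open>0 < t \<le> 1\<close>.\<close>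

lemma powers_sum_bounds:
  assumes lim: "(\<lambda>m. (T ^^ m) x) \<longlonglongrightarrow> 0"
  defines "q \<equiv> \<lambda>m. ip ((T ^^ m) x) (h ((T ^^ m) x))"
  shows "summable q" "cstar_le (suminf q) (ip x x)" "cstar_le ((1/2) *\<^sub>R ip x x) (suminf q)"
proof -
  define c where "c k = ip x ((T ^^ k) x)" for k
  have q: "q m = c (2 * m) - c (Suc (2 * m))" for m
    unfolding q_def c_def ip_funpow_split by (simp add: ip_diff_right)
  have q_pos: "positive (q m)" for m unfolding q_def by (rule h_positive)
  have c_pos: "positive (c k)" for k unfolding c_def by (rule powers_decreasing_convex)
  have upper: "cstar_le (q m) (c (2 * m) - c (2 * Suc m))" for m
    using powers_decreasing_convex(2)[of x "Suc (2 * m)"] by (simp add: cstar_le_def q c_def)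
  have lower: "cstar_le (c (2 * m) - c (2 * Suc m)) (2 *\<^sub>R q m)" for m
    using powers_decreasing_convex(3)[of x "2 * m"]
    by (simp add: cstar_le_def q c_def scaleR_2 algebra_simps)
  have telescope: "(\<Sum>m=k..<n. c (2 * m) - c (2 * Suc m)) = c (2 * k) - c (2 * n)" if "k \<le> n" for k n
    using sum_Suc_diff'[OF that, of "\<lambda>m. - c (2 * m)"] by simp
  have c_even: "norm (c (2 * m)) = (norm ((T ^^ m) x))\<^sup>2" for m
    unfolding c_def ip_funpow_split by (simp add: norm_square_eq)
  have "(\<lambda>m. (norm ((T ^^ m) x))\<^sup>2) \<longlonglongrightarrow> 0\<^sup>2" by (intro tendsto_power tendsto_norm_zero lim)
  then have c_norm_lim: "(\<lambda>m. norm (c (2 * m))) \<longlonglongrightarrow> 0" by (simp add: c_even)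
  then have c_lim: "(\<lambda>m. c (2 * m)) \<longlonglongrightarrow> 0" by (rule tendsto_norm_zero_cancel)
  have block: "cstar_le (\<Sum>m=k..<n. q m) (c (2 * k))" for k n
  proof (cases "k \<le> n")
    case True
    have "cstar_le (\<Sum>m=k..<n. q m) (\<Sum>m=k..<n. c (2 * m) - c (2 * Suc m))"
      by (intro cstar_le_sum upper)
    also have "(\<Sum>m=k..<n. c (2 * m) - c (2 * Suc m)) = c (2 * k) - c (2 * n)" by (rule telescope[OF True])
    also have "cstar_le \<dots> (c (2 * k))" by (simp add: cstar_le_def c_pos)
    finally show ?thesis .
  qed (simp add: c_pos)
  show summable: "summable q"
    unfolding summable_Cauchy
  proof (intro allI impI)
    fix e :: real assume "e > 0"
    then obtain N where N: "\<And>k. k \<ge> N \<Longrightarrow> norm (c (2 * k)) < e"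
      using order_tendstoD(2)[OF c_norm_lim] unfolding eventually_sequentially by blast
    have "norm (\<Sum>m=k..<n. q m) < e" if "k \<ge> N" for k n
      using cstar_le_norm_mono[OF positive_sum[OF q_pos] block] N[OF that] by (rule le_less_trans)
    then show "\<exists>N. \<forall>k\<ge>N. \<forall>n. norm (\<Sum>m=k..<n. q m) < e" by blast
  qed
  have c0: "c 0 = ip x x" by (simp add: c_def)
  show "cstar_le (suminf q) (ip x x)"
    by (rule cstar_le_tendsto[OF summable_LIMSEQ[OF summable] tendsto_const])
       (use block[of 0] in \<open>auto simp: c0 atLeast0LessThan\<close>)
  have "(\<lambda>n. c (2 * 0) - c (2 * n)) \<longlonglongrightarrow> c (2 * 0) - 0" by (intro tendsto_intros c_lim)
  moreover have "(\<lambda>n. \<Sum>m<n. 2 *\<^sub>R q m) \<longlonglongrightarrow> 2 *\<^sub>R suminf q"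
    unfolding scaleR_sum_right[symmetric] by (intro tendsto_intros summable_LIMSEQ summable)
  moreover have "cstar_le (c (2 * 0) - c (2 * n)) (\<Sum>m<n. 2 *\<^sub>R q m)" for n
    unfolding telescope[OF le0, symmetric] atLeast0LessThan[symmetric] by (intro cstar_le_sum lower)
  ultimately have "cstar_le (c (2 * 0) - 0) (2 *\<^sub>R suminf q)"
    by (intro cstar_le_tendsto) auto
  from cstar_le_scaleR[OF this, of "1/2"] show "cstar_le ((1/2) *\<^sub>R ip x x) (suminf q)" by (simp add: c0)
qed

end

text \<open>Rescale the generators to \<open>g n\<close> with \<open>\<Sum> \<parallel>g n\<parallel>\<^sup>2 \<le> 1\<close>, so that \<open>h = \<Sum> \<theta>_{g n, g n}\<close> satisfies
  \<open>0 \<le> h \<le> 1\<close>, and put \<open>T = 1 - h\<close>. The vectors \<open>T\<^sup>m (g n)\<close> form a frame: summing over \<open>n\<close> gives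
  \<open>\<langle>T\<^sup>m x, h T\<^sup>m x\<rangle>\<close>, and the sum of these over \<open>m\<close> lies between \<open>\<langle>x, x\<rangle> / 2\<close> and \<open>\<langle>x, x\<rangle>\<close> because \<open>T\<^sup>m\<close>
  tends to zero on the generators, hence everywhere.\<close>

lemma countably_generated_imp_standard_frame:
  fixes act :: "'m::{complex_vector, banach} \<Rightarrow> 'a::cstar_algebra \<Rightarrow> 'm"
  assumes "hilbert_module act ip" and cg: "countably_generated act"
  shows "\<exists>(J :: nat set) x. standard_frame ip J x"
proof -
  interpret hilbert_module act ip by fact
  obtain C where C: "countable C" "closure {\<Sum>x\<in>D. act x (a x) | D a. finite D \<and> D \<subseteq> C} = UNIV"
    using cg unfolding countably_generated_def by blast
  define g0 where "g0 = from_nat_into (insert 0 C)"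
  have g0: "range g0 = insert 0 C" unfolding g0_def using C(1) by (intro range_from_nat_into) auto
  define w where "w n = (1/2) ^ Suc n / (1 + norm (g0 n))" for n
  have w: "w n > 0" for n by (simp add: w_def add_pos_nonneg)
  define g where "g n = w n *\<^sub>R g0 n" for n
  have g_norm: "(norm (g n))\<^sup>2 \<le> (1/2) ^ Suc n" for n
  proof -
    have "norm (g n) = (1/2) ^ Suc n * (norm (g0 n) / (1 + norm (g0 n)))"
      by (simp add: g_def w_def)
    also have "\<dots> \<le> (1/2) ^ Suc n * 1"
      by (intro mult_left_mono) (auto simp: divide_le_eq_1 add_pos_nonneg)
    finally have le: "norm (g n) \<le> (1/2) ^ Suc n" by simp
    also have "\<dots> \<le> 1" by (rule power_le_one) auto
    finally have "norm (g n) * norm (g n) \<le> 1 * norm (g n)" by (rule mult_right_mono) simp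
    then show ?thesis using le by (simp add: power2_eq_square)
  qed
  have half: "summable (\<lambda>n. (1/2::real) ^ Suc n)" "(\<Sum>n<N. (1/2::real) ^ Suc n) \<le> 1" for N
  proof -
    show s: "summable (\<lambda>n. (1/2::real) ^ Suc n)"
      using power_half_series by (rule sums_summable)
    show "(\<Sum>n<N. (1/2::real) ^ Suc n) \<le> 1"
      using sum_le_suminf[OF s, of "{..<N}"] sums_unique[OF power_half_series] by simp
  qed
  have p_summable: "summable (\<lambda>n. act (g n) (ip (g n) x))" for x
  proof (rule summable_comparison_test')
    show "summable (\<lambda>n. (1/2) ^ Suc n * norm x)" by (intro summable_mult2 half)
    fix n
    have "norm (act (g n) (ip (g n) x)) \<le> norm (g n) * (norm (g n) * norm x)"
      by (intro order_trans[OF norm_act_le] mult_left_mono norm_ip_le) auto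
    also have "\<dots> = (norm (g n))\<^sup>2 * norm x" by (simp add: power2_eq_square)
    also have "\<dots> \<le> (1/2) ^ Suc n * norm x" by (intro mult_right_mono g_norm) auto
    finally show "norm (act (g n) (ip (g n) x)) \<le> (1/2) ^ Suc n * norm x" .
  qed
  define h where "h x = (\<Sum>n. act (g n) (ip (g n) x))" for x
  have h: "(\<lambda>n. act (g n) (ip (g n) x)) sums h x" for x
    unfolding h_def using p_summable by (rule summable_sums)
  have right: "(\<lambda>n. ip y (g n) * ip (g n) x) sums ip y (h x)" for x y
    using bounded_linear.sums[OF bounded_bilinear.bounded_linear_right[OF bounded_bilinear_ip] h]
    by (simp add: ip_act_right)
  have left: "(\<lambda>n. ip x (g n) * ip (g n) y) sums ip (h x) y" for x y
    using bounded_linear.sums[OF bounded_bilinear.bounded_linear_left[OF bounded_bilinear_ip] h]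
    by (simp add: ip_act_left star_ip)
  have h_le: "cstar_le (ip x (h x)) (ip x x)" for x
  proof (rule cstar_le_tendsto[OF right[unfolded sums_def] tendsto_const])
    have "cstar_le (\<Sum>n<N. ip x (g n) * ip (g n) x) (ip x x)" for N
    proof -
      have "cstar_le (ip x (g n) * ip (g n) x) ((1/2) ^ Suc n *\<^sub>R ip x x)" for n
        using g_norm[of n] unfolding norm_square_eq
        by (rule cstar_le_trans[OF cauchy_schwarz cstar_le_scaleR_left[OF ip_positive]])
      then have "cstar_le (\<Sum>n<N. ip x (g n) * ip (g n) x) (\<Sum>n<N. (1/2) ^ Suc n *\<^sub>R ip x x)"
        by (intro cstar_le_sum)
      also have "cstar_le (\<Sum>n<N. (1/2) ^ Suc n *\<^sub>R ip x x) (1 *\<^sub>R ip x x)"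
        unfolding scaleR_sum_left[symmetric] by (intro cstar_le_scaleR_left ip_positive half)
      finally show ?thesis by simp
    qed
    then show "\<forall>\<^sub>F N in sequentially. cstar_le (\<Sum>n<N. ip x (g n) * ip (g n) x) (ip x x)" by simp
  qed simp
  have partial: "cstar_le (\<Sum>n<N. ip x (g n) * ip (g n) x) (ip x (h x))" for N x
  proof (rule cstar_le_tendsto[OF tendsto_const right[unfolded sums_def]])
    show "\<forall>\<^sub>F K in sequentially.
        cstar_le (\<Sum>n<N. ip x (g n) * ip (g n) x) (\<Sum>n<K. ip x (g n) * ip (g n) x)"
      by (rule eventually_sequentiallyI[of N]) (intro cstar_le_sum_mono positive_ip_mult; simp)
  qed simp
  define T where "T x = x - h x" for x
  interpret T: unit_contraction act ip T
  proof
    show "ip x (T y) = ip (T x) y" for x y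
      using sums_unique2[OF right left] by (simp add: T_def ip_diff_left ip_diff_right)
    show "positive (ip x (T x))" for x
      using h_le[of x] by (simp add: T_def ip_diff_right cstar_le_def)
    show "cstar_le (ip x (T x)) (1 *\<^sub>R ip x x)" for x
      using partial[of x 0] by (simp add: T_def ip_diff_right cstar_le_def)
  qed simp
  have T_h: "y - T y = h y" for y by (simp add: T_def)
  have g_le: "cstar_le (ip x (g n) * ip (g n) x) (ip x (h x))" for n x
  proof -
    have "cstar_le (\<Sum>k\<in>{n}. ip x (g k) * ip (g k) x) (\<Sum>k<Suc n. ip x (g k) * ip (g k) x)"
      by (intro cstar_le_sum_mono positive_ip_mult) auto
    from cstar_le_trans[OF this partial] show ?thesis by simp
  qed
  have "(\<lambda>m. (T ^^ m) y) \<longlonglongrightarrow> 0" if "y \<in> C" for y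
  proof -
    have "y \<in> range g0" using that g0 by simp
    then obtain n where n: "y = g0 n" by blast
    have "(\<lambda>m. (T ^^ m) (g n)) \<longlonglongrightarrow> 0"
      by (rule T.funpow_tendsto_zero) (simp add: T_h g_le)
    then have "(\<lambda>m. (1 / w n) *\<^sub>R (T ^^ m) (g n)) \<longlonglongrightarrow> (1 / w n) *\<^sub>R 0" by (intro tendsto_intros)
    then show ?thesis using w[of n] by (simp add: g_def n T.funpow_simps)
  qed
  then have lim: "(\<lambda>m. (T ^^ m) x) \<longlonglongrightarrow> 0" for x
    by (rule T.funpow_tendsto_zero_closure[OF _ C(2)])
  define q where "q x m = ip ((T ^^ m) x) (h ((T ^^ m) x))" for x m
  note bounds = T.powers_sum_bounds[OF lim, unfolded T_h, folded q_def]
  define fr where "fr i = (case prod_decode i of (m, n) \<Rightarrow> (T ^^ m) (g n))" for i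
  define t where "t x m n = ip ((T ^^ m) x) (g n) * ip (g n) ((T ^^ m) x)" for x m n
  have fr: "ip x (fr i) * ip (fr i) x = case_prod (t x) (prod_decode i)" for x i
    by (simp add: fr_def t_def T.funpow_self_adjoint split: prod.split)
  have rectangle: "(\<Sum>i\<in>prod_encode ` ({..<M} \<times> {..<L}). ip x (fr i) * ip (fr i) x)
      = (\<Sum>m<M. \<Sum>n<L. t x m n)" for M L x
    by (subst sum.reindex) (simp_all add: fr sum.cartesian_product case_prod_beta inj_on_def)
  have frame: "((\<lambda>i. ip x (fr i) * ip (fr i) x) has_sum suminf (q x)) UNIV" for x
  proof (rule has_sum_positiveI)
    show "positive (ip x (fr i) * ip (fr i) x)" for i by (rule positive_ip_mult)
    fix E :: "nat set" assume E: "finite E"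
    obtain M where M: "fst ` prod_decode ` E \<subseteq> {..<M}"
      using E finite_nat_bounded[of "fst ` prod_decode ` E"] by auto
    obtain L where L: "snd ` prod_decode ` E \<subseteq> {..<L}"
      using E finite_nat_bounded[of "snd ` prod_decode ` E"] by auto
    have "E \<subseteq> prod_encode ` ({..<M} \<times> {..<L})"
    proof
      fix i assume "i \<in> E"
      then have "fst (prod_decode i) \<in> {..<M}" "snd (prod_decode i) \<in> {..<L}"
        using M L unfolding image_subset_iff by blast+
      then have "prod_decode i \<in> {..<M} \<times> {..<L}" by (simp add: mem_Times_iff)
      from imageI[OF this, of prod_encode] show "i \<in> prod_encode ` ({..<M} \<times> {..<L})" by simp
    qed
    then have "cstar_le (\<Sum>i\<in>E. ip x (fr i) * ip (fr i) x) (\<Sum>m<M. \<Sum>n<L. t x m n)"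
      unfolding rectangle[symmetric] by (intro cstar_le_sum_mono positive_ip_mult) auto
    also have "cstar_le \<dots> (\<Sum>m<M. q x m)"
      unfolding t_def q_def by (intro cstar_le_sum partial)
    also have "cstar_le \<dots> (suminf (q x))"
    proof (rule cstar_le_tendsto[OF tendsto_const summable_LIMSEQ[OF bounds(1)]])
      have "positive (q x m)" for m unfolding q_def using partial[of _ 0] by simp
      then show "\<forall>\<^sub>F K in sequentially. cstar_le (\<Sum>m<M. q x m) (\<Sum>m<K. q x m)"
        by (intro eventually_sequentiallyI[of M] cstar_le_sum_mono) auto
    qed simp
    finally show "cstar_le (\<Sum>i\<in>E. ip x (fr i) * ip (fr i) x) (suminf (q x))" .
  next
    fix \<epsilon> :: real assume \<epsilon>: "\<epsilon> > 0"
    obtain M where M: "norm ((\<Sum>m<M. q x m) - suminf (q x)) < \<epsilon> / 2"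
      using LIMSEQ_D[OF summable_LIMSEQ[OF bounds(1)], of "\<epsilon> / 2" x] \<epsilon> by auto
    have "(\<lambda>L. \<Sum>m<M. \<Sum>n<L. t x m n) \<longlonglongrightarrow> (\<Sum>m<M. q x m)"
      unfolding t_def q_def by (intro tendsto_sum right[unfolded sums_def])
    from LIMSEQ_D[OF this, of "\<epsilon> / 2"]
    obtain L where L: "norm ((\<Sum>m<M. \<Sum>n<L. t x m n) - (\<Sum>m<M. q x m)) < \<epsilon> / 2"
      using \<epsilon> by auto
    have "norm (suminf (q x) - (\<Sum>m<M. \<Sum>n<L. t x m n)) < \<epsilon>"
      using norm_diff_triangle_less[of "suminf (q x)" "\<Sum>m<M. q x m" "\<epsilon> / 2" "\<Sum>m<M. \<Sum>n<L. t x m n" "\<epsilon> / 2"] M L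
      by (simp add: norm_minus_commute)
    then show "\<exists>E. finite E \<and> norm (suminf (q x) - (\<Sum>i\<in>E. ip x (fr i) * ip (fr i) x)) < \<epsilon>"
      by (intro exI[of _ "prod_encode ` ({..<M} \<times> {..<L})"]) (simp add: rectangle)
  qed
  have "standard_frame ip (UNIV :: nat set) fr"
    unfolding standard_frame_def
  proof (rule exI[of _ "1/2"], rule conjI, simp, rule exI[of _ 1], intro conjI allI)
    fix x
    show "(\<lambda>i. ip x (fr i) * ip (fr i) x) summable_on UNIV"
      using frame[of x] by (rule has_sum_imp_summable)
    show "cstar_le ((1/2) *\<^sub>R ip x x) (\<Sum>\<^sub>\<infinity>i. ip x (fr i) * ip (fr i) x)"
      "cstar_le (\<Sum>\<^sub>\<infinity>i. ip x (fr i) * ip (fr i) x) (1 *\<^sub>R ip x x)"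
      unfolding infsumI[OF frame] using bounds(2,3) by simp_all
  qed simp_all
  then show ?thesis by blast
qed

section \<open>Compactness and total boundedness\<close>

lemma NN_totally_bounded_imp_compact:
  fixes F :: "'m::{complex_vector, banach} \<Rightarrow>\<^sub>L 'n::{complex_vector, banach}"
    and actN :: "'n \<Rightarrow> 'a::cstar_algebra \<Rightarrow> 'n" and f :: "'i \<Rightarrow> 'n"
  assumes N: "hilbert_module actN ipN" and frame: "standard_frame ipN J f"
    and tb: "NN_totally_bounded ipN (blinfun_apply F ` cball 0 1)"
    and D: "\<And>y. (\<lambda>z. ipN y (blinfun_apply F z)) \<in> D"
  shows "F \<in> closure (theta_span actN D)"
proof -
  interpret N: hilbert_module actN ipN by (rule N)
  obtain c1 c2 where c2: "c2 > 0"
    and s: "\<And>x. (\<lambda>j. ipN x (f j) * ipN (f j) x) summable_on J"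
    and upper: "\<And>x. cstar_le (\<Sum>\<^sub>\<infinity>j\<in>J. ipN x (f j) * ipN (f j) x) (c2 *\<^sub>R ipN x x)"
    using frame unfolding standard_frame_def by blast
  have "uniform_tails ipN f J (blinfun_apply F ` cball 0 1)"
  proof (rule N.NN_totally_bounded_imp_uniform_tails[OF tb _ s _ c2])
    show "norm y \<le> norm F" if "y \<in> blinfun_apply F ` cball 0 1" for y
    proof -
      obtain z where "norm z \<le> 1" "y = blinfun_apply F z"
        using \<open>y \<in> blinfun_apply F ` cball 0 1\<close> by auto
      then show ?thesis using norm_blinfun[of F z] mult_left_mono[of "norm z" 1 "norm F"] by simp
    qed
  qed (rule cstar_le_trans[OF N.frame_sum_le_infsum[OF s] upper])
  then show ?thesis by (rule uniform_tails_imp_compact[OF N frame _ D])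
qed

theorem corollary4p7:
  fixes actM :: "'m::{complex_vector, banach} \<Rightarrow> 'a::cstar_algebra \<Rightarrow> 'm"
    and ipM :: "'m \<Rightarrow> 'm \<Rightarrow> 'a"
    and actN :: "'n::{complex_vector, banach} \<Rightarrow> 'a \<Rightarrow> 'n"
    and ipN :: "'n \<Rightarrow> 'n \<Rightarrow> 'a"
    and F :: "'m \<Rightarrow>\<^sub>L 'n"
  assumes "hilbert_module actM ipM"
    and "hilbert_module actN ipN"
    and "bounded_module_map actM actN (blinfun_apply F)"
  shows "(banach_compact actM actN F \<longrightarrow>
            NN_totally_bounded ipN (blinfun_apply F ` cball 0 1)) \<and>
         (adjointable ipM ipN (blinfun_apply F) \<longrightarrow> A_compact ipM actN F \<longrightarrow>
            NN_totally_bounded ipN (blinfun_apply F ` cball 0 1)) \<and>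
         ((\<exists>(J :: 'j set) x. standard_frame ipN J x) \<longrightarrow>
            (NN_totally_bounded ipN (blinfun_apply F ` cball 0 1) \<longrightarrow>
               banach_compact actM actN F) \<and>
            (adjointable ipM ipN (blinfun_apply F) \<longrightarrow>
             NN_totally_bounded ipN (blinfun_apply F ` cball 0 1) \<longrightarrow>
               A_compact ipM actN F)) \<and>
         (countably_generated actN \<longrightarrow> (\<exists>(J :: nat set) x. standard_frame ipN J x))"
proof (intro conjI impI)
  interpret M: hilbert_module actM ipM by fact
  interpret N: hilbert_module actN ipN by fact
  let ?Y = "blinfun_apply F ` cball 0 1"
  show banach: "NN_totally_bounded ipN ?Y" if "banach_compact actM actN F"
    using that unfolding banach_compact_def by (rule compact_imp_NN_totally_bounded[OF N.hilbert_module_axioms])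
  have "range ipM \<subseteq> module_dual actM" by (auto simp: module_dual_def M.bounded_module_map_ip)
  then have "closure (theta_span actN (range ipM)) \<subseteq> closure (theta_span actN (module_dual actM))"
    by (intro closure_mono theta_span_mono)
  then show "NN_totally_bounded ipN ?Y" if "A_compact ipM actN F"
    using that by (intro banach) (auto simp: banach_compact_def A_compact_def)
  show "\<exists>(J :: nat set) x. standard_frame ipN J x" if "countably_generated actN"
    by (rule countably_generated_imp_standard_frame[OF N.hilbert_module_axioms that])
  assume "\<exists>(J :: 'j set) x. standard_frame ipN J x"
  then obtain J :: "'j set" and x where frame: "standard_frame ipN J x" by blast
  assume tb: "NN_totally_bounded ipN ?Y"
  show "banach_compact actM actN F"
    unfolding banach_compact_def
  proof (rule NN_totally_bounded_imp_compact[OF N.hilbert_module_axioms frame tb])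
    fix y
    have "bounded_linear (\<lambda>z. ipN y (blinfun_apply F z))"
      using N.bounded_module_map_ip[of y] bounded_linear_compose[OF _ blinfun.bounded_linear_right]
      unfolding bounded_module_map_def by blast
    then show "(\<lambda>z. ipN y (blinfun_apply F z)) \<in> module_dual actM"
      using assms(3)
      by (simp add: module_dual_def bounded_module_map_def N.ip_scaleC_right N.ip_act_right)
  qed
  show "A_compact ipM actN F" if "adjointable ipM ipN (blinfun_apply F)"
    unfolding A_compact_def
  proof (rule NN_totally_bounded_imp_compact[OF N.hilbert_module_axioms frame tb])
    fix y
    obtain G where G: "\<And>x y. ipN (blinfun_apply F x) y = ipM x (G y)"
      using \<open>adjointable ipM ipN (blinfun_apply F)\<close> unfolding adjointable_def by blast
    have "ipN y (blinfun_apply F z) = ipM (G y) z" for z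
      using arg_cong[OF G[of z y], of star] by (simp add: N.star_ip M.star_ip)
    then have "(\<lambda>z. ipN y (blinfun_apply F z)) = ipM (G y)" by (rule ext)
    then show "(\<lambda>z. ipN y (blinfun_apply F z)) \<in> range ipM" by simp
  qed
qed

end
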